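(* Let $G:=G_{1}\times G_{2}$ be a product of topological groups, $\mu_{1}\in\mathcal{P}_{\sigma}(G_{1})$, $\mu_{2}\in\mathcal{P}_{\sigma}(G_{2})$ Baire probability measures and $(V,\rho)$ a uniformly bounded strongly operator continuous Banach $G$-module. Assume that $(V,\rho|_{G_{1}})$ is weakly uniquely $\mu_{1}$-stationary without almost invariant unit vectors, and that $(V,\rho|_{G_{2}})$ is weakly uniquely $\mu_{2}$-stationary. Then the assignment $$[b]\mapsto[\widetilde{\mathbb{E}}_{\mu_{2}}\circ(b|_{G_{1}\times G_1})]\oplus[\widetilde{\mathbb{E}}_{\mu_{1}}\circ(b|_{G_{2}\times G_2})]$$ defines an embedding of topological vector spaces $H_{c}^{1}(G_{1}\times G_{2},V)\hookrightarrow H_{c}^{1}(G_{1},V^{\mu_{2}})\oplus H_{c}^{1}(G_{2},V^{\mu_{1}})$. If furthermore $V^{\mu_{1}}=V^{G_{1}}$ and $V^{\mu_{2}}=V^{G_{2}}$, then this embedding is surjective, i.e. $H_{c}^{1}(G_{1}\times G_{2},V)\cong H_{c}^{1}(G_{1},V^{G_{2}})$.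
   Context: Banach spaces are real or complex; topological groups are not assumed Hausdorff. The Baire $\sigma$-algebra of a topological space $X$ is the smallest $\sigma$-algebra for which all continuous functions $X\to\mathbb{R}$ are measurable; $\mathcal{P}_\sigma(X)$ is the set of probability measures on it (Baire probability measures). A uniformly bounded Banach $G$-module $(V,\rho)$ is a Banach space $V$ with a group homomorphism $\rho:G\to \mathrm{GL}(V)$, $g\mapsto\rho_g$, into the invertible bounded operators such that $\sup_{g}\Vert\rho_g\Vert<\infty$. It is strongly (resp. weakly) operator continuous if for every $v\in V$ the map $g\mapsto\rho_g(v)$ is continuous for the norm (resp. weak) topology on $V$. $V^G$ is the subspace of vectors fixed by $G$. The module has almost invariant unit vectors if for all compact $K\subseteq G$ and $\varepsilon>0$ there is $v\in V$ with $\Vert v\Vert=1$ and $\Vert v-\rho_g(v)\Vert<\varepsilon$ for all $g\in K$. For $\mu\in\mathcal{P}_\sigma(G)$, $(V,\rho)$ is $\mu$-integrable if it is weakly operator continuous and for every $v\in V$ there is $\rho_\mu(v)\in V$ with $\phi(\rho_\mu(v))=\int_G\phi(\rho_g(v))\,d\mu(g)$ for all $\phi\in V^*$; then $\rho_\mu\in\mathcal{B}(V)$, and $V^\mu:=\{v\in V\mid\rho_\mu(v)=v\}$. $(V,\rho)$ is weakly uniquely $\mu$-stationary if it is uniformly bounded, $\mu$-integrable, and for every non-zero $\phi\in V^*$ with $\phi\circ\rho_\mu=\phi$ there is $v\in V^\mu$ with $\phi(v)\neq0$. In that case $\widetilde{\mathbb{E}}_\mu\in\mathcal{B}(V)$ denotes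 the projection onto $V^\mu$ given by the (existing) norm limit $\widetilde{\mathbb{E}}_\mu(v)=\lim_{n\to\infty}\frac1n\sum_{i=0}^{n-1}\rho_\mu^i(v)$. In the claim, $V^{\mu_i}$ and $\widetilde{\mathbb{E}}_{\mu_i}$ are formed with respect to $\rho|_{G_i}$; since $G_1$ and $G_2$ commute, $V^{\mu_2},V^{G_2}$ are closed $G_1$-invariant subspaces and $V^{\mu_1},V^{G_1}$ are closed $G_2$-invariant subspaces. For a uniformly bounded strongly operator continuous Banach $G$-module $(V,\rho)$, $C^n(G,V)$ is the space of continuous functions $G^n\to V$ (norm topology on $V$) with the compact-open topology, and $C^n(G,V)^G$ is the subspace of $f$ with $f(gg_1,\dots,gg_n)=\rho_g(f(g_1,\dots,g_n))$. Define $\partial^n:C^n(G,V)^G\to C^{n+1}(G,V)^G$ by $(\partial^nf)(g_1,\dots,g_{n+1})=\sum_{i=1}^{n+1}(-1)^{i+1}f(g_1,\dots,\widehat{g}_i,\dots,g_{n+1})$. Set $Z^n(G,V):=\ker(\partial^{n+1})\subseteq C^{n+1}(G,V)^G$, $B^n(G,V):=\mathrm{im}(\partial^n)\subseteq C^{n+1}(G,V)^G$, and $H_c^n(G,V):=Z^n(G,V)/B^n(G,V)$ with the quotient topology. An embedding of topological vector spaces is a linear map that is a homeomorphism onto its image. *)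

theory Defs
  imports "HOL-Probability.Probability"
begin

section \<open>Conventions\<close>

text \<open>
  Groups are written additively: \<^class>\<open>topological_group_add\<close> is the library's class of topological
  groups; it assumes neither commutativity nor any separation axiom.
\<close>

instance prod :: (topological_monoid_add, topological_monoid_add) topological_monoid_add
proof
  fix a b :: "'a \<times> 'b"
  have "((\<lambda>x. (fst (fst x) + fst (snd x), snd (fst x) + snd (snd x)))
      \<longlongrightarrow> (fst a + fst b, snd a + snd b)) (nhds (a, b))"
    using tendsto_fst[OF filterlim_ident, of "(a, b)"] tendsto_snd[OF filterlim_ident, of "(a, b)"]
    by (intro tendsto_Pair tendsto_add tendsto_fst tendsto_snd) simp_all
  then show "LIM x nhds a \<times>\<^sub>F nhds b. fst x + snd x :> nhds (a + b)"
    by (simp add: nhds_prod[symmetric] plus_prod_def)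
qed

instance prod :: (topological_group_add, topological_group_add) topological_group_add
proof
  fix a :: "'a \<times> 'b"
  have "((\<lambda>x. (- fst x, - snd x)) \<longlongrightarrow> (- fst a, - snd a)) (nhds a)"
    by (intro tendsto_intros filterlim_ident)
  moreover have "(uminus :: 'a \<times> 'b \<Rightarrow> _) = (\<lambda>x. (- fst x, - snd x))"
    by (simp add: fun_eq_iff uminus_prod_def)
  ultimately show "(uminus \<longlongrightarrow> - a) (nhds a)"
    by (cases a) simp
qed

section \<open>Real and complex Banach spaces\<close>

text \<open>
  The scalars form a type \<open>'k\<close> of sort \<open>{real_normed_field, euclidean_space}\<close>.  Both \<^typ>\<open>real\<close> and
  \<^typ>\<open>complex\<close> have this sort and, by Frobenius' theorem, every type of this sort is isomorphic to one of
  them, so real and complex Banach spaces are treated at once.  The real scalar multiplication built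
  into \<^class>\<open>banach\<close> is required to be the restriction of \<open>smul\<close>.
\<close>

locale banach_space_over = vector_space smul
  for smul :: "'k::{real_normed_field, euclidean_space} \<Rightarrow> 'v::banach \<Rightarrow> 'v" +
  assumes scale_of_real: "smul (of_real r) v = r *\<^sub>R v"
    and norm_scale: "norm (smul a v) = norm a * norm v"

definition bounded_operators ::
    "('k::{real_normed_field, euclidean_space} \<Rightarrow> 'v::banach \<Rightarrow> 'v) \<Rightarrow> ('v \<Rightarrow> 'v) set" where
  "bounded_operators smul = {T. Vector_Spaces.linear smul smul T \<and> bounded_linear T}"

definition dual_space ::
    "('k::{real_normed_field, euclidean_space} \<Rightarrow> 'v::banach \<Rightarrow> 'v) \<Rightarrow> ('v \<Rightarrow> 'k) set" where
  "dual_space smul = {\<phi>. Vector_Spaces.linear smul (*) \<phi> \<and> bounded_linear \<phi>}"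

definition GL ::
    "('k::{real_normed_field, euclidean_space} \<Rightarrow> 'v::banach \<Rightarrow> 'v) \<Rightarrow> ('v \<Rightarrow> 'v) set" where
  "GL smul = {T \<in> bounded_operators smul.
     \<exists>S \<in> bounded_operators smul. S \<circ> T = id \<and> T \<circ> S = id}"

definition weak_topology ::
    "('k::{real_normed_field, euclidean_space} \<Rightarrow> 'v::banach \<Rightarrow> 'v) \<Rightarrow> 'v topology" where
  "weak_topology smul = topology_generated_by {\<phi> -` U |\<phi> U. \<phi> \<in> dual_space smul \<and> open U}"


section \<open>Banach modules\<close>

definition uniformly_bounded_module ::
    "('k::{real_normed_field, euclidean_space} \<Rightarrow> 'v::banach \<Rightarrow> 'v) \<Rightarrow>
     ('g::topological_group_add \<Rightarrow> 'v \<Rightarrow> 'v) \<Rightarrow> bool" where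
  "uniformly_bounded_module smul \<rho> \<longleftrightarrow>
     banach_space_over smul \<and>
     range \<rho> \<subseteq> GL smul \<and> (\<forall>g h. \<rho> (g + h) = \<rho> g \<circ> \<rho> h) \<and>
     bdd_above (range (\<lambda>g. onorm (\<rho> g)))"

definition strongly_operator_continuous ::
    "('g::topological_group_add \<Rightarrow> 'v::banach \<Rightarrow> 'v) \<Rightarrow> bool" where
  "strongly_operator_continuous \<rho> \<longleftrightarrow> (\<forall>v. continuous_on UNIV (\<lambda>g. \<rho> g v))"

definition weakly_operator_continuous ::
    "('k::{real_normed_field, euclidean_space} \<Rightarrow> 'v::banach \<Rightarrow> 'v) \<Rightarrow>
     ('g::topological_group_add \<Rightarrow> 'v \<Rightarrow> 'v) \<Rightarrow> bool" where
  "weakly_operator_continuous smul \<rho> \<longleftrightarrow>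
     (\<forall>v. continuous_map euclidean (weak_topology smul) (\<lambda>g. \<rho> g v))"

definition fixed_vectors :: "('g \<Rightarrow> 'v \<Rightarrow> 'v) \<Rightarrow> 'v set" where
  "fixed_vectors \<rho> = {v. \<forall>g. \<rho> g v = v}"

text \<open>As the group need not be Hausdorff, \<^const>\<open>compact\<close> means quasi-compact.\<close>

definition almost_invariant_unit_vectors ::
    "('g::topological_group_add \<Rightarrow> 'v::banach \<Rightarrow> 'v) \<Rightarrow> bool" where
  "almost_invariant_unit_vectors \<rho> \<longleftrightarrow>
     (\<forall>K \<epsilon>. compact K \<longrightarrow> \<epsilon> > 0 \<longrightarrow>
        (\<exists>v. norm v = 1 \<and> (\<forall>g\<in>K. norm (v - \<rho> g v) < \<epsilon>)))"


section \<open>Baire probability measures and stationarity\<close>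

definition baire :: "'a::topological_space measure" where
  "baire = sigma UNIV {f -` S |(f :: 'a \<Rightarrow> real) S. continuous_on UNIV f \<and> S \<in> sets borel}"

definition baire_probability :: "'a::topological_space measure \<Rightarrow> bool" where
  "baire_probability \<mu> \<longleftrightarrow> prob_space \<mu> \<and> sets \<mu> = sets (baire :: 'a measure)"

definition weak_integral ::
    "('k::{real_normed_field, euclidean_space} \<Rightarrow> 'v::banach \<Rightarrow> 'v) \<Rightarrow>
     ('g::topological_group_add \<Rightarrow> 'v \<Rightarrow> 'v) \<Rightarrow> 'g measure \<Rightarrow> 'v \<Rightarrow> 'v \<Rightarrow> bool" where
  "weak_integral smul \<rho> \<mu> v w \<longleftrightarrow>
     (\<forall>\<phi> \<in> dual_space smul. has_bochner_integral \<mu> (\<lambda>g. \<phi> (\<rho> g v)) (\<phi> w))"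

definition integrable_module ::
    "('k::{real_normed_field, euclidean_space} \<Rightarrow> 'v::banach \<Rightarrow> 'v) \<Rightarrow>
     ('g::topological_group_add \<Rightarrow> 'v \<Rightarrow> 'v) \<Rightarrow> 'g measure \<Rightarrow> bool" where
  "integrable_module smul \<rho> \<mu> \<longleftrightarrow>
     weakly_operator_continuous smul \<rho> \<and> (\<forall>v. \<exists>w. weak_integral smul \<rho> \<mu> v w)"

text \<open>The operator \<open>\<rho>\<^sub>\<mu>\<close>; the vector is unique because the dual space separates points.\<close>

definition avg ::
    "('k::{real_normed_field, euclidean_space} \<Rightarrow> 'v::banach \<Rightarrow> 'v) \<Rightarrow>
     ('g::topological_group_add \<Rightarrow> 'v \<Rightarrow> 'v) \<Rightarrow> 'g measure \<Rightarrow> 'v \<Rightarrow> 'v" where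
  "avg smul \<rho> \<mu> v = (THE w. weak_integral smul \<rho> \<mu> v w)"

definition stationary_vectors ::
    "('k::{real_normed_field, euclidean_space} \<Rightarrow> 'v::banach \<Rightarrow> 'v) \<Rightarrow>
     ('g::topological_group_add \<Rightarrow> 'v \<Rightarrow> 'v) \<Rightarrow> 'g measure \<Rightarrow> 'v set" where
  "stationary_vectors smul \<rho> \<mu> = {v. avg smul \<rho> \<mu> v = v}"

definition weakly_uniquely_stationary ::
    "('k::{real_normed_field, euclidean_space} \<Rightarrow> 'v::banach \<Rightarrow> 'v) \<Rightarrow>
     ('g::topological_group_add \<Rightarrow> 'v \<Rightarrow> 'v) \<Rightarrow> 'g measure \<Rightarrow> bool" where
  "weakly_uniquely_stationary smul \<rho> \<mu> \<longleftrightarrow>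
     uniformly_bounded_module smul \<rho> \<and> integrable_module smul \<rho> \<mu> \<and>
     (\<forall>\<phi> \<in> dual_space smul. \<phi> \<noteq> (\<lambda>_. 0) \<longrightarrow> \<phi> \<circ> avg smul \<rho> \<mu> = \<phi> \<longrightarrow>
        (\<exists>v \<in> stationary_vectors smul \<rho> \<mu>. \<phi> v \<noteq> 0))"

text \<open>The projection \<open>E\<^sub>\<mu>\<close> onto the stationary vectors.\<close>

definition mean_projection ::
    "('k::{real_normed_field, euclidean_space} \<Rightarrow> 'v::banach \<Rightarrow> 'v) \<Rightarrow>
     ('g::topological_group_add \<Rightarrow> 'v \<Rightarrow> 'v) \<Rightarrow> 'g measure \<Rightarrow> 'v \<Rightarrow> 'v" where
  "mean_projection smul \<rho> \<mu> v =
     lim (\<lambda>n. (1 / real n) *\<^sub>R (\<Sum>i<n. (avg smul \<rho> \<mu> ^^ i) v))"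


section \<open>Topological vector spaces given by explicit carriers\<close>

text \<open>
  The carrier is the \<^const>\<open>topspace\<close> of the topology; cohomology spaces have cosets as elements, so
  they do not form types.
\<close>

record ('k, 'a) tvs =
  tvs_topology :: "'a topology"
  tvs_add :: "'a \<Rightarrow> 'a \<Rightarrow> 'a"
  tvs_scale :: "'k \<Rightarrow> 'a \<Rightarrow> 'a"

abbreviation tvs_carrier :: "('k, 'a) tvs \<Rightarrow> 'a set" where
  "tvs_carrier X \<equiv> topspace (tvs_topology X)"

definition tvs_sum :: "('k, 'a) tvs \<Rightarrow> ('k, 'b) tvs \<Rightarrow> ('k, 'a \<times> 'b) tvs" where
  "tvs_sum X Y = \<lparr>
     tvs_topology = prod_topology (tvs_topology X) (tvs_topology Y),
     tvs_add = (\<lambda>p q. (tvs_add X (fst p) (fst q), tvs_add Y (snd p) (snd q))),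
     tvs_scale = (\<lambda>a p. (tvs_scale X a (fst p), tvs_scale Y a (snd p)))\<rparr>"

definition tvs_linear :: "('k, 'a) tvs \<Rightarrow> ('k, 'b) tvs \<Rightarrow> ('a \<Rightarrow> 'b) \<Rightarrow> bool" where
  "tvs_linear X Y f \<longleftrightarrow>
     f ` tvs_carrier X \<subseteq> tvs_carrier Y \<and>
     (\<forall>x \<in> tvs_carrier X. \<forall>y \<in> tvs_carrier X. f (tvs_add X x y) = tvs_add Y (f x) (f y)) \<and>
     (\<forall>a. \<forall>x \<in> tvs_carrier X. f (tvs_scale X a x) = tvs_scale Y a (f x))"

definition tvs_embedding :: "('k, 'a) tvs \<Rightarrow> ('k, 'b) tvs \<Rightarrow> ('a \<Rightarrow> 'b) \<Rightarrow> bool" where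
  "tvs_embedding X Y f \<longleftrightarrow>
     tvs_linear X Y f \<and> embedding_map (tvs_topology X) (tvs_topology Y) f"

definition tvs_isomorphism :: "('k, 'a) tvs \<Rightarrow> ('k, 'b) tvs \<Rightarrow> ('a \<Rightarrow> 'b) \<Rightarrow> bool" where
  "tvs_isomorphism X Y f \<longleftrightarrow>
     tvs_linear X Y f \<and> homeomorphic_map (tvs_topology X) (tvs_topology Y) f"

definition quotient_topology :: "'a topology \<Rightarrow> ('a \<Rightarrow> 'b) \<Rightarrow> 'b topology" where
  "quotient_topology X q =
     topology (\<lambda>U. U \<subseteq> q ` topspace X \<and> openin X {x \<in> topspace X. q x \<in> U})"

lemma openin_quotient_topology:
  "openin (quotient_topology X q) U \<longleftrightarrow>
     U \<subseteq> q ` topspace X \<and> openin X {x \<in> topspace X. q x \<in> U}"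
proof -
  have "istopology (\<lambda>U. U \<subseteq> q ` topspace X \<and> openin X {x \<in> topspace X. q x \<in> U})"
    unfolding istopology_def
  proof (intro conjI allI impI)
    fix S T
    assume S: "S \<subseteq> q ` topspace X \<and> openin X {x \<in> topspace X. q x \<in> S}"
      and T: "T \<subseteq> q ` topspace X \<and> openin X {x \<in> topspace X. q x \<in> T}"
    show "S \<inter> T \<subseteq> q ` topspace X" using S by blast
    have "{x \<in> topspace X. q x \<in> S \<inter> T} =
        {x \<in> topspace X. q x \<in> S} \<inter> {x \<in> topspace X. q x \<in> T}" by blast
    then show "openin X {x \<in> topspace X. q x \<in> S \<inter> T}" using S T by auto
  next
    fix \<K>
    assume K: "\<forall>S\<in>\<K>. S \<subseteq> q ` topspace X \<and> openin X {x \<in> topspace X. q x \<in> S}"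
    show "\<Union>\<K> \<subseteq> q ` topspace X" using K by blast
    have "{x \<in> topspace X. q x \<in> \<Union>\<K>} = \<Union>((\<lambda>S. {x \<in> topspace X. q x \<in> S}) ` \<K>)" by blast
    then show "openin X {x \<in> topspace X. q x \<in> \<Union>\<K>}" using K by auto
  qed
  then show ?thesis
    unfolding quotient_topology_def by (simp add: topology_inverse')
qed

lemma topspace_quotient_topology: "topspace (quotient_topology X q) = q ` topspace X"
proof
  show "topspace (quotient_topology X q) \<subseteq> q ` topspace X"
    using openin_topspace openin_quotient_topology by metis
  have "{x \<in> topspace X. q x \<in> q ` topspace X} = topspace X" by blast
  then have "openin (quotient_topology X q) (q ` topspace X)"
    by (simp add: openin_quotient_topology)
  then show "q ` topspace X \<subseteq> topspace (quotient_topology X q)"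
    by (rule openin_subset)
qed

lemma quotient_map_quotient_topology: "quotient_map X (quotient_topology X q) q"
  by (simp add: quotient_map_def topspace_quotient_topology openin_quotient_topology)


section \<open>Continuous cohomology\<close>

text \<open>
  Elements of \<open>G\<^sup>n\<close> are functions on \<open>{..<n}\<close>, with value \<^const>\<open>undefined\<close> elsewhere.  Indices start
  at 0.
\<close>

definition tuples :: "nat \<Rightarrow> (nat \<Rightarrow> 'g::topological_space) topology" where
  "tuples n = product_topology (\<lambda>_. euclidean) {..<n}"

text \<open>
  The coefficient module is a subset \<open>W\<close> of the Banach space \<open>'v\<close>, to be used for closed invariant
  subspaces.  Cochains are extended by 0 outside \<open>G\<^sup>n\<close>, so that they are added pointwise.
\<close>

definition cochains :: "nat \<Rightarrow> 'v::banach set \<Rightarrow> ((nat \<Rightarrow> 'g::topological_group_add) \<Rightarrow> 'v) set" where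
  "cochains n W =
     {f. continuous_map (tuples n) (top_of_set W) f \<and> (\<forall>x. x \<notin> topspace (tuples n) \<longrightarrow> f x = 0)}"

definition cochain_topology ::
    "nat \<Rightarrow> 'v::banach set \<Rightarrow> ((nat \<Rightarrow> 'g::topological_group_add) \<Rightarrow> 'v) topology" where
  "cochain_topology n W = topology_generated_by
     {{f \<in> cochains n W. f ` K \<subseteq> U} |K U. compactin (tuples n) K \<and> openin (top_of_set W) U}"

definition invariant_cochains ::
    "nat \<Rightarrow> 'v::banach set \<Rightarrow> ('g::topological_group_add \<Rightarrow> 'v \<Rightarrow> 'v) \<Rightarrow> ((nat \<Rightarrow> 'g) \<Rightarrow> 'v) set" where
  "invariant_cochains n W \<rho> =
     {f \<in> cochains n W. \<forall>g. \<forall>x \<in> topspace (tuples n). f (\<lambda>i\<in>{..<n}. g + x i) = \<rho> g (f x)}"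

definition omit :: "nat \<Rightarrow> nat \<Rightarrow> (nat \<Rightarrow> 'g) \<Rightarrow> nat \<Rightarrow> 'g" where
  "omit n i x = (\<lambda>j\<in>{..<n}. if j < i then x j else x (Suc j))"

definition coboundary ::
    "nat \<Rightarrow> ((nat \<Rightarrow> 'g::topological_group_add) \<Rightarrow> 'v::banach) \<Rightarrow> (nat \<Rightarrow> 'g) \<Rightarrow> 'v" where
  "coboundary n f = (\<lambda>x. if x \<in> topspace (tuples (n + 1))
     then \<Sum>i\<le>n. (-1) ^ i *\<^sub>R f (omit n i x) else 0)"

definition cocycles ::
    "nat \<Rightarrow> 'v::banach set \<Rightarrow> ('g::topological_group_add \<Rightarrow> 'v \<Rightarrow> 'v) \<Rightarrow> ((nat \<Rightarrow> 'g) \<Rightarrow> 'v) set" where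
  "cocycles n W \<rho> = {f \<in> invariant_cochains (n + 1) W \<rho>. coboundary (n + 1) f = (\<lambda>_. 0)}"

definition coboundaries ::
    "nat \<Rightarrow> 'v::banach set \<Rightarrow> ('g::topological_group_add \<Rightarrow> 'v \<Rightarrow> 'v) \<Rightarrow> ((nat \<Rightarrow> 'g) \<Rightarrow> 'v) set" where
  "coboundaries n W \<rho> = coboundary n ` invariant_cochains n W \<rho>"

definition cohomology_class ::
    "nat \<Rightarrow> 'v::banach set \<Rightarrow> ('g::topological_group_add \<Rightarrow> 'v \<Rightarrow> 'v) \<Rightarrow>
     ((nat \<Rightarrow> 'g) \<Rightarrow> 'v) \<Rightarrow> ((nat \<Rightarrow> 'g) \<Rightarrow> 'v) set" where
  "cohomology_class n W \<rho> b = {(\<lambda>x. b x + d x) |d. d \<in> coboundaries n W \<rho>}"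

text \<open>
  The coboundary summand in \<^const>\<open>tvs_scale\<close> only matters for the scalar 0, for which the pointwise
  multiples of a coset would not fill the zero coset.
\<close>

definition cohomology ::
    "('k::{real_normed_field, euclidean_space} \<Rightarrow> 'v::banach \<Rightarrow> 'v) \<Rightarrow> nat \<Rightarrow> 'v set \<Rightarrow>
     ('g::topological_group_add \<Rightarrow> 'v \<Rightarrow> 'v) \<Rightarrow> ('k, ((nat \<Rightarrow> 'g) \<Rightarrow> 'v) set) tvs" where
  "cohomology smul n W \<rho> = \<lparr>
     tvs_topology = quotient_topology
       (subtopology (cochain_topology (n + 1) W) (cocycles n W \<rho>)) (cohomology_class n W \<rho>),
     tvs_add = (\<lambda>S T. {(\<lambda>x. s x + t x) |s t. s \<in> S \<and> t \<in> T}),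
     tvs_scale = (\<lambda>a S. {(\<lambda>x. smul a (s x) + d x) |s d. s \<in> S \<and> d \<in> coboundaries n W \<rho>})\<rparr>"

text \<open>The cochain \<open>T \<circ> (b|H\<^sup>n)\<close>, where \<open>\<iota>\<close> is the inclusion of \<open>H\<close> into \<open>G\<close>.\<close>

definition restrict_cochain ::
    "nat \<Rightarrow> ('v \<Rightarrow> 'v) \<Rightarrow> ('h \<Rightarrow> 'g) \<Rightarrow> ((nat \<Rightarrow> 'g) \<Rightarrow> 'v) \<Rightarrow>
     (nat \<Rightarrow> 'h::topological_group_add) \<Rightarrow> 'v::banach" where
  "restrict_cochain n T \<iota> b =
     (\<lambda>x. if x \<in> topspace (tuples n) then T (b (\<lambda>i\<in>{..<n}. \<iota> (x i))) else 0)"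

end

theory Submission
  imports Defs "HOL-Library.Function_Algebras"
begin

text \<open>
  A cocycle is encoded by the crossed homomorphism \<open>\<beta> g = b (0, g)\<close>.  Since \<open>G\<^sub>1\<close> and \<open>G\<^sub>2\<close> commute,
  \<open>\<beta> h - \<rho> g (\<beta> h) = \<beta> g - \<rho> h (\<beta> g)\<close> for \<open>g\<close> in \<open>G\<^sub>1\<close> and \<open>h\<close> in \<open>G\<^sub>2\<close>.  Two consequences:

  (1) The absence of almost invariant unit vectors is a gap \<open>\<epsilon> * norm v \<le> max {norm (v - \<rho> g v) | g \<in> K}\<close>,
  so \<open>\<beta>\<close> on \<open>G\<^sub>2\<close> is determined by \<open>\<beta>\<close> on \<open>G\<^sub>1\<close> and is bounded by a multiple of its maximum on the
  compact set \<open>K\<close>.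

  (2) For \<open>T = \<rho> h\<close> the map \<open>g \<mapsto> \<beta> g - T (\<beta> g)\<close> on \<open>G\<^sub>1\<close> is a coboundary \<open>w - \<rho> g w\<close>.  This property
  of \<open>T\<close> passes to convex combinations and, by the gap, to limits that are uniform on compact sets,
  hence to \<open>\<rho>\<^bsub>\<mu>2\<^esub>\<close> (a limit of convex combinations of the \<open>\<rho> h\<close> by Hahn--Banach), to its powers, to their
  Cesaro means and to their limit, the projection \<open>E\<close>.

  By (2) every class has a representative whose restriction to \<open>G\<^sub>1\<close> is \<open>E \<circ> \<beta>\<close>, and by (1) this
  representative depends continuously on that restriction.  So already the first component of the map
  is an embedding.  If \<open>V\<^bsup>\<mu>1\<^esup> = V\<^bsup>G1\<^esup>\<close>, this space is zero by the gap, and the second summand vanishes.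
\<close>

section \<open>The Hahn--Banach theorem\<close>

text \<open>The operator \<open>avg\<close> is known only through scalar integrals, whereas the gap
  needs norm estimates. One convex combination must approximate it in norm at finitely many vectors
  simultaneously, so the separation takes place in the space of all maps
  \<open>'v \<Rightarrow> 'v\<close>, with the seminorm that adds up the norms at these vectors.
  Hence Hahn-Banach is needed for sublinear functionals rather than for norms. Uniform bounds then
  replace the finite set by a compact one, the image of \<open>insert g0 K0\<close>:
  \<open>K0\<close> makes approximate solutions converge, and \<open>g0\<close> tests the limit at
  an arbitrary group element. The functionals so obtained are real-linear, while stationarity and
  weak integrals speak of field-linear ones, so a dictionary between the two is needed. The topology
  of cohomology is not given by a norm; continuity of the inverse of the embedding is therefore
  checked on open sets, through representatives and compact sets of group elements.\<close>

definition sublinear :: "('a::real_vector \<Rightarrow> real) \<Rightarrow> bool" where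
  "sublinear q \<longleftrightarrow> (\<forall>x y. q (x + y) \<le> q x + q y) \<and> (\<forall>t\<ge>0. \<forall>x. q (t *\<^sub>R x) = t * q x)"

lemma sublinear_add: "sublinear q \<Longrightarrow> q (x + y) \<le> q x + q y"
  and sublinear_scale: "sublinear q \<Longrightarrow> 0 \<le> t \<Longrightarrow> q (t *\<^sub>R x) = t * q x"
  by (auto simp: sublinear_def)

lemma sublinear_0: "sublinear q \<Longrightarrow> q 0 = 0"
  using sublinear_scale[of q 0 0] by simp

text \<open>From 0 = \<open>r 0\<close> \<le> \<open>r x + r (- x)\<close> \<le>
  \<open>r x + q (- x)\<close>. The lower bound does not depend on \<open>r\<close>, which keeps
  infima over a chain finite.\<close>

lemma sublinear_minorant_ge:
  assumes "sublinear r" "r \<le> q"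
  shows "- q (- x) \<le> r x"
  using sublinear_add[OF assms(1), of x "- x"] sublinear_0[OF assms(1)] assms(2)
  by (simp add: le_fun_def) (smt (verit))

text \<open>The smaller of two members \<open>r\<close>, \<open>s\<close> of a chain, evaluated at
  \<open>x\<close> and at \<open>y\<close>, stays below \<open>r x + s y\<close>; hence
  subadditivity survives the infimum.\<close>

lemma sublinear_INF:
  fixes C :: "('a::real_vector \<Rightarrow> real) set"
  assumes ne: "C \<noteq> {}" and sub: "\<And>r. r \<in> C \<Longrightarrow> sublinear r \<and> r \<le> q"
    and dir: "\<And>r s. r \<in> C \<Longrightarrow> s \<in> C \<Longrightarrow> r \<le> s \<or> s \<le> r"
  shows "sublinear (\<lambda>x. INF r\<in>C. r x)" and "\<And>r. r \<in> C \<Longrightarrow> (\<lambda>x. INF r\<in>C. r x) \<le> r"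
proof -
  have bdd: "bdd_below ((\<lambda>r. r x) ` C)" for x
    by (rule bdd_belowI2[where m = "- q (- x)"]) (use sub sublinear_minorant_ge in blast)
  then show lower: "(\<lambda>x. INF r\<in>C. r x) \<le> r" if "r \<in> C" for r
    using that by (auto simp: le_fun_def intro!: cINF_lower)
  show "sublinear (\<lambda>x. INF r\<in>C. r x)"
    unfolding sublinear_def
  proof (intro conjI allI impI)
    fix x y
    have "(INF r\<in>C. r (x + y)) \<le> r x + s y" if rs: "r \<in> C" "s \<in> C" for r s
    proof -
      obtain u where u: "u \<in> C" "u \<le> r" "u \<le> s"
        using dir[OF rs] rs by (metis order_refl)
      have "(INF r\<in>C. r (x + y)) \<le> u (x + y)" using u bdd by (auto intro: cINF_lower)
      also have "\<dots> \<le> u x + u y" using sub[OF u(1)] sublinear_add by blast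
      also have "\<dots> \<le> r x + s y" using u by (auto simp: le_fun_def intro: add_mono)
      finally show ?thesis .
    qed
    then have "(INF r\<in>C. r (x + y)) - s y \<le> (INF r\<in>C. r x)" if "s \<in> C" for s
      using that ne by (intro cINF_greatest) (auto simp: algebra_simps)
    then have "(INF r\<in>C. r (x + y)) - (INF r\<in>C. r x) \<le> (INF r\<in>C. r y)"
      using ne by (intro cINF_greatest) (auto simp: algebra_simps)
    then show "(INF r\<in>C. r (x + y)) \<le> (INF r\<in>C. r x) + (INF r\<in>C. r y)" by simp
  next
    fix t :: real and x :: 'a assume t: "0 \<le> t"
    have eq: "(INF r\<in>C. r (t *\<^sub>R x)) = (INF r\<in>C. t * r x)"
      using sub t sublinear_scale by (intro INF_cong) auto
    have cont: "continuous (at_right (INF r\<in>C. r x)) (\<lambda>s. t * s)"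
      by (intro continuous_intros)
    show "(INF r\<in>C. r (t *\<^sub>R x)) = t * (INF r\<in>C. r x)"
      using continuous_at_Inf_mono[of "\<lambda>s. t * s" "(\<lambda>r. r x) ` C"] t cont ne bdd
      by (simp add: eq image_image mono_def mult_left_mono)
  qed
qed

text \<open>A minimal sublinear functional is linear: it lies below its one-sided differences.\<close>

theorem sublinear_dominates_linear:
  fixes q :: "'a::real_vector \<Rightarrow> real"
  assumes q: "sublinear q"
  obtains f where "linear f" "f \<le> q"
proof -
  define A where "A = {r. sublinear r \<and> r \<le> q}"
  have "\<exists>m\<in>A. \<forall>a\<in>A. (\<lambda>r s. s \<le> r) m a \<longrightarrow> a = m"
  proof (rule predicate_Zorn)
    show "partial_order_on A (relation_of (\<lambda>r s. s \<le> r) A)"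
      by (rule partial_order_on_relation_ofI) auto
    fix C assume C: "C \<in> Chains (relation_of (\<lambda>r s. s \<le> r) A)"
    then have CA: "C \<subseteq> A" and dir: "\<And>r s. r \<in> C \<Longrightarrow> s \<in> C \<Longrightarrow> r \<le> s \<or> s \<le> r"
      by (auto simp: Chains_def relation_of_def)
    show "\<exists>u\<in>A. \<forall>a\<in>C. u \<le> a"
    proof (cases "C = {}")
      case True
      then show ?thesis using q by (auto simp: A_def)
    next
      case False
      have sub: "\<And>r. r \<in> C \<Longrightarrow> sublinear r \<and> r \<le> q" using CA by (auto simp: A_def)
      note INF = sublinear_INF[OF False sub dir]
      have "(\<lambda>x. INF r\<in>C. r x) \<le> q"
        using False INF(2) sub by (meson all_not_in_conv order_trans)
      then show ?thesis using INF by (auto simp: A_def)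
    qed
  qed
  then obtain m where m: "sublinear m" "m \<le> q" and min: "\<And>r. sublinear r \<Longrightarrow> r \<le> m \<Longrightarrow> r = m"
    unfolding A_def by (metis (mono_tags, lifting) mem_Collect_eq order_trans)
  \<comment> \<open>The infimum \<open>r\<close> of the differences over all t \<ge> 0 is again
    sublinear and, by t = 0, at most \<open>m\<close>. Minimality gives \<open>r = m\<close>, and t
    = 1 is the claim. Combined with subadditivity it yields additivity.\<close>
  have below: "m x \<le> m (x + a) - m a" for x a
  proof -
    define T where "T x = (\<lambda>t. m (x + t *\<^sub>R a) - t * m a) ` {0..}" for x
    define r where "r x = Inf (T x)" for x
    have bdd: "bdd_below (T x)" for x
    proof (rule bdd_belowI)
      fix y assume "y \<in> T x"
      then obtain t where t: "0 \<le> t" "y = m (x + t *\<^sub>R a) - t * m a" by (auto simp: T_def)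
      have "t * m a \<le> m (x + t *\<^sub>R a) + m (- x)"
        using sublinear_add[OF m(1), of "x + t *\<^sub>R a" "- x"] sublinear_scale[OF m(1) t(1), of a] by simp
      then show "- m (- x) \<le> y" using t by simp
    qed
    have T_ne: "T x \<noteq> {}" for x by (auto simp: T_def)
    have r_le: "r x \<le> m (x + t *\<^sub>R a) - t * m a" if "0 \<le> t" for x t
      unfolding r_def using bdd that by (intro cInf_lower) (auto simp: T_def)
    have r_ge: "c \<le> r x" if "\<And>t. 0 \<le> t \<Longrightarrow> c \<le> m (x + t *\<^sub>R a) - t * m a" for x c
      unfolding r_def using that T_ne by (intro cInf_greatest) (auto simp: T_def)
    have "sublinear r"
      unfolding sublinear_def
    proof (intro conjI allI impI)
      fix x y
      have "r (x + y) - (m (y + t *\<^sub>R a) - t * m a) \<le> r x" if t: "0 \<le> t" for t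
      proof (rule r_ge)
        fix s :: real assume s: "0 \<le> s"
        have "r (x + y) \<le> m ((x + s *\<^sub>R a) + (y + t *\<^sub>R a)) - (s + t) * m a"
          using r_le[of "s + t" "x + y"] s t by (simp add: algebra_simps)
        also have "\<dots> \<le> m (x + s *\<^sub>R a) + m (y + t *\<^sub>R a) - (s + t) * m a"
          using sublinear_add[OF m(1), of "x + s *\<^sub>R a" "y + t *\<^sub>R a"] by linarith
        finally show "r (x + y) - (m (y + t *\<^sub>R a) - t * m a) \<le> m (x + s *\<^sub>R a) - s * m a"
          by (simp add: algebra_simps)
      qed
      then have "r (x + y) - r x \<le> r y"
        by (intro r_ge) (smt (verit))
      then show "r (x + y) \<le> r x + r y" by simp
    next
      fix t :: real and x assume t: "0 \<le> t"
      \<comment> \<open>One inequality suffices: its instance at \<open>inverse t\<close> and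
        \<open>t *\<^sub>R x\<close> is the converse.\<close>
      have le: "r (t *\<^sub>R x) \<le> t * r x" if t: "0 < t" for t x
      proof -
        have "r (t *\<^sub>R x) / t \<le> r x"
        proof (rule r_ge)
          fix s :: real assume s: "0 \<le> s"
          have "r (t *\<^sub>R x) \<le> m (t *\<^sub>R (x + s *\<^sub>R a)) - (t * s) * m a"
            using r_le[of "t * s" "t *\<^sub>R x"] s t by (simp add: algebra_simps)
          also have "m (t *\<^sub>R (x + s *\<^sub>R a)) = t * m (x + s *\<^sub>R a)"
            using t by (intro sublinear_scale[OF m(1)]) simp
          finally show "r (t *\<^sub>R x) / t \<le> m (x + s *\<^sub>R a) - s * m a"
            using t by (simp add: field_simps)
        qed
        then show ?thesis using t by (simp add: field_simps)
      qed
      show "r (t *\<^sub>R x) = t * r x"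
      proof (cases "t = 0")
        case True
        have "r 0 = 0"
          using r_le[of 0 0] r_ge[of 0 0] sublinear_0[OF m(1)] sublinear_scale[OF m(1)] by fastforce
        then show ?thesis using True by simp
      next
        case False
        then have "0 < t" using t by simp
        then show ?thesis
          using le[of t x] le[of "inverse t" "t *\<^sub>R x"] by (simp add: field_simps)
      qed
    qed
    moreover have "r \<le> m" using r_le[of 0] by (simp add: le_fun_def)
    ultimately have "r = m" by (rule min)
    then show ?thesis using r_le[of 1 x] by simp
  qed
  have add: "m (x + a) = m x + m a" for x a
    using below[of x a] sublinear_add[OF m(1), of x a] by simp
  have neg: "m (- x) = - m x" for x
    using add[of x "- x"] sublinear_0[OF m(1)] by simp
  have "linear m"
  proof (rule linearI)
    fix t x
    show "m (t *\<^sub>R x) = t *\<^sub>R m x"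
    proof (cases "0 \<le> t")
      case False
      then show ?thesis
        using sublinear_scale[OF m(1), of "- t" x] neg[of "t *\<^sub>R x"] by simp
    qed (simp add: sublinear_scale[OF m(1)])
  qed (rule add)
  then show ?thesis using m(2) that by blast
qed

text \<open>Any linear functional below the infimum \<open>q x\<close> of
  \<open>p (x + t (s - h)) - t d\<close> does both jobs: t = 0 bounds it by \<open>p\<close>, and t
  = 1 at \<open>x = h - s\<close> bounds \<open>f (h - s)\<close> by \<open>- d\<close>. The
  symmetry of \<open>p\<close> gives the lower bound \<open>- p x\<close> that keeps
  \<open>q\<close> finite.\<close>

theorem separating_functional:
  fixes p :: "'a::real_vector \<Rightarrow> real"
  assumes p: "sublinear p" and S: "convex S" "S \<noteq> {}" and d: "\<And>s. s \<in> S \<Longrightarrow> d \<le> p (s - h)"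
    and p_minus: "\<And>x. p (- x) = p x"
  obtains f where "linear f" "f \<le> p" "\<And>s. s \<in> S \<Longrightarrow> f h + d \<le> f s"
proof -
  define T where "T x = {p (x + t *\<^sub>R (s - h)) - t * d |t s. 0 \<le> t \<and> s \<in> S}" for x
  define q where "q x = Inf (T x)" for x
  have bdd: "bdd_below (T x)" for x
  proof (rule bdd_belowI)
    fix y assume "y \<in> T x"
    then obtain t s where t: "0 \<le> t" "s \<in> S" "y = p (x + t *\<^sub>R (s - h)) - t * d" by (auto simp: T_def)
    have "p (t *\<^sub>R (s - h)) \<le> p (x + t *\<^sub>R (s - h)) + p (- x)"
      using sublinear_add[OF p, of "x + t *\<^sub>R (s - h)" "- x"] by simp
    moreover have "t * d \<le> p (t *\<^sub>R (s - h))"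
      using d[OF t(2)] t(1) sublinear_scale[OF p t(1)] by (simp add: mult_left_mono)
    ultimately show "- p x \<le> y" using t p_minus by simp
  qed
  have q_le: "q x \<le> p (x + t *\<^sub>R (s - h)) - t * d" if "0 \<le> t" "s \<in> S" for x t s
    unfolding q_def using bdd that by (intro cInf_lower) (auto simp: T_def)
  have T_ne: "T x \<noteq> {}" for x using S(2) order_refl[of "0::real"] by (auto simp: T_def)
  have q_ge: "c \<le> q x" if "\<And>t s. 0 \<le> t \<Longrightarrow> s \<in> S \<Longrightarrow> c \<le> p (x + t *\<^sub>R (s - h)) - t * d" for x c
    unfolding q_def using that T_ne by (intro cInf_greatest) (auto simp: T_def)
  have "sublinear q"
    unfolding sublinear_def
  proof (intro conjI allI impI)
    fix x y
    have key: "q (x + y) \<le> (p (x + t *\<^sub>R (s - h)) - t * d) + (p (y + t' *\<^sub>R (s' - h)) - t' * d)"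
      if t: "0 \<le> t" "s \<in> S" "0 \<le> t'" "s' \<in> S" for t s t' s'
    proof -
      \<comment> \<open>Two rays of the cone over \<open>S - h\<close> merge by convexity. The
        weights are normalised by \<open>t + t'\<close>; if this is 0, any point of \<open>S\<close>
        serves.\<close>
      obtain s'' where s'': "s'' \<in> S" "(t + t') *\<^sub>R s'' = t *\<^sub>R s + t' *\<^sub>R s'"
      proof (cases "t + t' = 0")
        case True
        then have "t = 0" "t' = 0" using t by auto
        then show ?thesis using t that by auto
      next
        case False
        have "(t / (t + t')) *\<^sub>R s + (t' / (t + t')) *\<^sub>R s' \<in> S"
          using t False by (intro convexD[OF S(1)]) (auto simp flip: add_divide_distrib)
        moreover have "(t + t') *\<^sub>R ((t / (t + t')) *\<^sub>R s + (t' / (t + t')) *\<^sub>R s') = t *\<^sub>R s + t' *\<^sub>R s'"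
          using False by (simp add: scaleR_right_distrib)
        ultimately show ?thesis using that by blast
      qed
      have "q (x + y) \<le> p ((x + y) + (t + t') *\<^sub>R (s'' - h)) - (t + t') * d"
        using q_le s'' t by simp
      also have "(x + y) + (t + t') *\<^sub>R (s'' - h) = (x + t *\<^sub>R (s - h)) + (y + t' *\<^sub>R (s' - h))"
        using s''(2) by (simp add: algebra_simps)
      also have "p \<dots> \<le> p (x + t *\<^sub>R (s - h)) + p (y + t' *\<^sub>R (s' - h))"
        by (rule sublinear_add[OF p])
      finally show ?thesis by (simp add: algebra_simps)
    qed
    have "q (x + y) - (p (y + t' *\<^sub>R (s' - h)) - t' * d) \<le> q x" if "0 \<le> t'" "s' \<in> S" for t' s'
      using key that by (intro q_ge) (smt (verit))
    then have "q (x + y) - q x \<le> q y"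
      by (intro q_ge) (smt (verit))
    then show "q (x + y) \<le> q x + q y" by simp
  next
    fix t :: real and x assume t: "0 \<le> t"
    have le: "q (t *\<^sub>R x) \<le> t * q x" if t: "0 < t" for t x
    proof -
      have "q (t *\<^sub>R x) / t \<le> q x"
      proof (rule q_ge)
        fix u :: real and s assume s: "0 \<le> u" "s \<in> S"
        have "q (t *\<^sub>R x) \<le> p (t *\<^sub>R (x + u *\<^sub>R (s - h))) - (t * u) * d"
          using q_le[of "t * u" s "t *\<^sub>R x"] s t by (simp add: algebra_simps)
        also have "p (t *\<^sub>R (x + u *\<^sub>R (s - h))) = t * p (x + u *\<^sub>R (s - h))"
          using t by (intro sublinear_scale[OF p]) simp
        finally show "q (t *\<^sub>R x) / t \<le> p (x + u *\<^sub>R (s - h)) - u * d"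
          using t by (simp add: field_simps)
      qed
      then show ?thesis using t by (simp add: field_simps)
    qed
    show "q (t *\<^sub>R x) = t * q x"
    proof (cases "t = 0")
      case True
      obtain s0 where "s0 \<in> S" using S(2) by blast
      then have "q 0 \<le> 0" using q_le[of 0 s0 0] sublinear_0[OF p] by simp
      moreover have "0 \<le> q 0"
        using d sublinear_scale[OF p] by (intro q_ge) (simp add: mult_left_mono)
      ultimately show ?thesis using True by simp
    next
      case False
      then have "0 < t" using t by simp
      then show ?thesis
        using le[of t x] le[of "inverse t" "t *\<^sub>R x"] by (simp add: field_simps)
    qed
  qed
  then obtain f where f: "linear f" "f \<le> q" by (rule sublinear_dominates_linear)
  obtain s0 where s0: "s0 \<in> S" using S(2) by blast
  have "f \<le> p"
    using f(2) q_le[OF order_refl s0] by (simp add: le_fun_def) (meson order_trans)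
  moreover have "f h + d \<le> f s" if "s \<in> S" for s
  proof -
    have "f (h - s) \<le> q (h - s)" using f(2) by (simp add: le_fun_def)
    also have "\<dots> \<le> - d" using q_le[of 1 s "h - s"] that sublinear_0[OF p] by simp
    finally show ?thesis using linear_diff[OF f(1), of h s] by simp
  qed
  ultimately show ?thesis using f(1) that by blast
qed

text \<open>Convex hulls of operators, and the functional that separates \<open>avg\<close> from
  them, live in the real vector space of all maps.\<close>

instantiation "fun" :: (type, real_vector) real_vector
begin

definition "scaleR_fun = (\<lambda>(r::real) f x. r *\<^sub>R f x)"

instance
  by standard (auto simp: scaleR_fun_def fun_eq_iff scaleR_add_right scaleR_add_left)

end

lemma scaleR_fun_apply [simp]: "(r *\<^sub>R f) x = r *\<^sub>R f x"
  by (simp add: scaleR_fun_def)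

lemma sublinear_norm: "sublinear norm"
  by (auto simp: sublinear_def norm_triangle_ineq)

lemma bounded_linear_le_norm:
  fixes f :: "'a::real_normed_vector \<Rightarrow> real"
  assumes "linear f" "f \<le> norm"
  shows "bounded_linear f"
proof -
  interpret linear f by fact
  have "\<bar>f x\<bar> \<le> norm x" for x
    using assms(2)[THEN le_funD, of x] assms(2)[THEN le_funD, of "- x"] neg[of x] by simp
  then show ?thesis
    by (intro bounded_linear_intro[of f 1]) (auto simp: add scale)
qed

lemma exists_separating_functional:
  fixes S :: "'a::real_normed_vector set"
  assumes S: "convex S" "S \<noteq> {}" and d: "\<And>s. s \<in> S \<Longrightarrow> d \<le> norm (s - h)"
  obtains f :: "'a \<Rightarrow> real" where "bounded_linear f" "\<And>s. s \<in> S \<Longrightarrow> f h + d \<le> f s"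
  by (rule separating_functional[OF sublinear_norm S d norm_minus_cancel])
    (auto intro: that bounded_linear_le_norm)

text \<open>The point \<open>v\<close> has a positive distance \<open>d\<close> from
  \<open>N\<close>, so some functional separates it from \<open>N\<close>. Being bounded below on a
  subspace, this functional vanishes there.\<close>

lemma exists_annihilating_functional:
  fixes N :: "'a::real_normed_vector set"
  assumes N: "subspace N" and v: "v \<notin> closure N"
  obtains f :: "'a \<Rightarrow> real" where "bounded_linear f" "\<And>s. s \<in> N \<Longrightarrow> f s = 0" "f v \<noteq> 0"
proof -
  obtain d where d: "0 < d" "\<And>s. s \<in> N \<Longrightarrow> d \<le> norm (s - v)"
    using v by (force simp: closure_approachable dist_norm not_less)
  have N0: "0 \<in> N" using N by (rule subspace_0)
  obtain f :: "'a \<Rightarrow> real" where f: "bounded_linear f" "\<And>s. s \<in> N \<Longrightarrow> f v + d \<le> f s"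
    using exists_separating_functional[of N d v] subspace_imp_convex[OF N] N0 d(2) by blast
  interpret bounded_linear f by (rule f(1))
  have "f s = 0" if "s \<in> N" for s
  proof (rule ccontr)
    assume ne: "f s \<noteq> 0"
    \<comment> \<open>The multiple of \<open>s\<close> at which \<open>f\<close> takes the value
      \<open>f v + d - 1\<close>, which is too small.\<close>
    have "f v + d \<le> f (((f v + d - 1) / f s) *\<^sub>R s)"
      using N that by (intro f(2) subspace_scale)
    then show False using ne by (simp add: scaleR)
  qed
  moreover have "f v \<noteq> 0" using f(2)[OF N0] d(1) zero by linarith
  ultimately show ?thesis using f(1) that by blast
qed

section \<open>Real and field-linear functionals\<close>

context banach_space_over
begin

lemma bounded_linear_scale: "bounded_linear (\<lambda>v. smul a v)"
proof (rule bounded_linear_intro[of _ "norm a"])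
  show "smul a (r *\<^sub>R v) = r *\<^sub>R smul a v" for r v
    using scale_left_commute[of a "of_real r" v] by (simp only: scale_of_real)
qed (simp_all add: scale_right_distrib norm_scale)

lemma bounded_linear_scale_left: "bounded_linear (\<lambda>a. smul a v)"
proof (rule bounded_linear_intro[of _ "norm v"])
  show "smul (r *\<^sub>R a) v = r *\<^sub>R smul a v" for r a
    by (simp only: scaleR_conv_of_real scale_of_real flip: scale_scale)
qed (simp_all add: scale_left_distrib norm_scale)

lemma dual_spaceI:
  assumes "\<And>v w. \<Psi> (v + w) = \<Psi> v + \<Psi> w" "\<And>a v. \<Psi> (smul a v) = a * \<Psi> v"
    and "\<And>v. norm (\<Psi> v) \<le> norm v * K"
  shows "\<Psi> \<in> dual_space smul"
proof -
  have "vector_space ((*) :: 'k \<Rightarrow> 'k \<Rightarrow> 'k)" by unfold_locales (auto simp: algebra_simps)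
  moreover have "bounded_linear \<Psi>"
  proof (intro bounded_linear_intro[of _ K])
    show "\<Psi> (r *\<^sub>R v) = r *\<^sub>R \<Psi> v" for r v
      using assms(2)[of "of_real r" v] by (simp only: scale_of_real scaleR_conv_of_real)
  qed (use assms in auto)
  ultimately show ?thesis
    using assms vector_space_axioms by (auto simp: dual_space_def Vector_Spaces.linear_iff)
qed

lemma dual_spaceD:
  assumes "\<Psi> \<in> dual_space smul"
  shows "bounded_linear \<Psi>" "\<Psi> (smul a v) = a * \<Psi> v"
  using assms by (auto simp: dual_space_def Vector_Spaces.linear_iff)

lemma bounded_operatorsD:
  assumes "T \<in> bounded_operators smul"
  shows "bounded_linear T" "T (smul a v) = smul a (T v)"
  using assms by (auto simp: bounded_operators_def Vector_Spaces.linear_iff)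

lemma dual_space_compose:
  assumes \<Psi>: "\<Psi> \<in> dual_space smul" and T: "T \<in> bounded_operators smul"
  shows "(\<lambda>v. \<Psi> (T v)) \<in> dual_space smul"
proof -
  have bl: "bounded_linear (\<lambda>v. \<Psi> (T v))"
    using bounded_linear_compose dual_spaceD(1)[OF \<Psi>] bounded_operatorsD(1)[OF T] by blast
  then obtain K where "\<And>v. norm (\<Psi> (T v)) \<le> norm v * K"
    using bounded_linear.bounded by blast
  then show ?thesis
    using linear_add[OF bounded_linear.linear[OF bl]]
    by (intro dual_spaceI[of _ K]) (simp_all add: dual_spaceD(2)[OF \<Psi>] bounded_operatorsD(2)[OF T])
qed

text \<open>
  The functional \<open>a \<mapsto> inner a 1\<close> of the field \<open>'k\<close> is non-zero, so every real-linear functional on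
  \<open>'k\<close> is of the form \<open>a \<mapsto> inner (a * b) 1\<close>; applying this to \<open>a \<mapsto> \<phi> (smul a v)\<close> gives \<open>\<Psi> v = b\<close>.
\<close>

lemma real_functional_eq_inner_dual:
  fixes \<phi> :: "'v \<Rightarrow> real"
  assumes \<phi>: "bounded_linear \<phi>"
  obtains \<Psi> where "\<Psi> \<in> dual_space smul" "\<And>a v. \<phi> (smul a v) = (a * \<Psi> v) \<bullet> 1"
proof -
  interpret \<phi>: bounded_linear \<phi> by fact
  define L :: "'k \<Rightarrow> 'k" where "L b = adjoint (\<lambda>a. a * b) 1" for b
  have L: "a \<bullet> L b = (a * b) \<bullet> 1" for a b
    unfolding L_def by (intro adjoint_works bounded_linear.linear[OF bounded_linear_mult_left])
  have inner_1: "(1::'k) \<bullet> 1 = 1" by (simp add: dot_square_norm)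
  have lin: "linear L"
    by (rule linearI; rule iffD1[OF vector_eq_ldot]; rule allI)
      (simp_all add: inner_add_right inner_add_left L distrib_left)
  have "inj L"
    unfolding linear_injective_0[OF lin]
  proof (intro allI impI)
    fix b assume "L b = 0"
    then have "(inverse b * b) \<bullet> 1 = 0" using L[of "inverse b" b] by simp
    then show "b = 0" using inner_1 by (cases "b = 0") auto
  qed
  then have "surj L" by (rule linear_inj_imp_surj[OF lin])
  define c :: "'v \<Rightarrow> 'k" where "c v = adjoint (\<lambda>a. \<phi> (smul a v)) 1" for v
  have c: "a \<bullet> c v = \<phi> (smul a v)" for a v
  proof -
    have "linear (\<lambda>a. \<phi> (smul a v))"
      using bounded_linear_compose[OF \<phi> bounded_linear_scale_left] by (rule bounded_linear.linear)
    from adjoint_works[OF this, of a 1] show ?thesis by (simp add: c_def)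
  qed
  define \<Psi> where "\<Psi> v = inv L (c v)" for v
  have \<Psi>: "(a * \<Psi> v) \<bullet> 1 = \<phi> (smul a v)" for a v
    unfolding L[symmetric] \<Psi>_def using surj_f_inv_f[OF \<open>surj L\<close>] by (simp add: c)
  have eqI: "x = y" if "\<And>a. (a * x) \<bullet> 1 = (a * y) \<bullet> 1" for x y :: 'k
  proof -
    have "a \<bullet> L x = a \<bullet> L y" for a
      using that[of a] by (simp only: L)
    then have "L x = L y" by (metis vector_eq_ldot)
    then show ?thesis using \<open>inj L\<close> by (simp add: inj_eq)
  qed
  obtain K where K: "\<And>v. norm (\<phi> v) \<le> norm v * K" using \<phi>.bounded by blast
  have "\<Psi> \<in> dual_space smul"
  proof (rule dual_spaceI)
    show "\<Psi> (v + w) = \<Psi> v + \<Psi> w" for v w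
      by (rule eqI) (simp add: distrib_left inner_add_left \<Psi> scale_right_distrib \<phi>.add)
    show "\<Psi> (smul a v) = a * \<Psi> v" for a v
      by (rule eqI) (simp add: \<Psi> flip: mult.assoc)
    show "norm (\<Psi> v) \<le> norm v * K" for v
    proof (cases "\<Psi> v = 0")
      case True
      then show ?thesis using order_trans[OF norm_ge_zero K[of v]] by simp
    next
      case False
      \<comment> \<open>On \<open>smul (inverse (\<Psi> v)) v\<close> the functional \<phi> takes
        the value 1; its bound \<open>K\<close> is thereby inherited by \<Psi>.\<close>
      have "1 = \<phi> (smul (inverse (\<Psi> v)) v)"
        using \<Psi>[of "inverse (\<Psi> v)" v] False inner_1 by simp
      also have "\<dots> \<le> norm (smul (inverse (\<Psi> v)) v) * K"
        using K[of "smul (inverse (\<Psi> v)) v"] by (simp only: real_norm_def abs_le_iff)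
      finally show ?thesis using False by (simp add: norm_scale norm_divide norm_inverse field_simps)
    qed
  qed
  then show ?thesis using \<Psi> by (intro that[of \<Psi>]) simp_all
qed

end

section \<open>Stationary modules and the mean ergodic theorem\<close>

locale bounded_module =
  fixes smul :: "'k::{real_normed_field, euclidean_space} \<Rightarrow> 'v::banach \<Rightarrow> 'v"
    and \<rho> :: "'g::topological_group_add \<Rightarrow> 'v \<Rightarrow> 'v"
  assumes uniformly_bounded: "uniformly_bounded_module smul \<rho>"
begin

sublocale banach_space_over smul
  using uniformly_bounded by (simp add: uniformly_bounded_module_def)

lemma action_in_bounded_operators: "\<rho> g \<in> bounded_operators smul"
  using uniformly_bounded by (auto simp: uniformly_bounded_module_def GL_def)

lemma action_smul: "\<rho> g (smul a v) = smul a (\<rho> g v)"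
  using bounded_operatorsD(2)[OF action_in_bounded_operators] .

lemma action_bounded_linear: "bounded_linear (\<rho> g)"
  using bounded_operatorsD(1)[OF action_in_bounded_operators] .

lemmas action_linear = bounded_linear.linear[OF action_bounded_linear]
lemmas action_vec_add = linear_add[OF action_linear]
lemmas action_vec_diff = linear_diff[OF action_linear]
lemmas action_vec_0 = linear_0[OF action_linear]
lemmas action_vec_scaleR = linear_scale[OF action_linear]

lemma action_add: "\<rho> (g + h) v = \<rho> g (\<rho> h v)"
  using uniformly_bounded by (auto simp: uniformly_bounded_module_def)

lemma action_0 [simp]: "\<rho> 0 v = v"
proof -
  have "\<rho> 0 \<in> GL smul" using uniformly_bounded by (auto simp: uniformly_bounded_module_def)
  then obtain S where "S \<circ> \<rho> 0 = id" by (auto simp: GL_def)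
  then show ?thesis using action_add[of 0 0 v] by (metis add_0 comp_apply id_apply)
qed

text \<open>The maximum with 1 keeps the constant positive even on the zero space, so it can serve
  as a divisor.\<close>

definition bound :: real where
  "bound = max 1 (SUP g. onorm (\<rho> g))"

lemma bound_pos: "0 < bound"
  by (auto simp: bound_def)

lemma norm_action_le: "norm (\<rho> g v) \<le> bound * norm v"
proof -
  have "onorm (\<rho> g) \<le> bound"
    using uniformly_bounded unfolding uniformly_bounded_module_def bound_def
    by (meson cSUP_upper UNIV_I le_max_iff_disj)
  then show ?thesis
    using onorm[OF action_bounded_linear, of g v] by (meson mult_right_mono norm_ge_zero order_trans)
qed

end

locale stationary_module = prob_space \<mu> + bounded_module smul \<rho>
  for smul :: "'k::{real_normed_field, euclidean_space} \<Rightarrow> 'v::banach \<Rightarrow> 'v"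
    and \<rho> :: "'g::topological_group_add \<Rightarrow> 'v \<Rightarrow> 'v"
    and \<mu> :: "'g measure" +
  assumes stationary: "weakly_uniquely_stationary smul \<rho> \<mu>"
begin

section \<open>The averaging operator\<close>

abbreviation "P \<equiv> avg smul \<rho> \<mu>"
abbreviation "E \<equiv> mean_projection smul \<rho> \<mu>"

text \<open>A bounded real functional is the inner product with 1 of a field-linear one. Hahn-Banach
  delivers real functionals, so this is the form in which the weak integral is used against
  them.\<close>

lemma weak_integral_real:
  fixes \<phi> :: "'v \<Rightarrow> real"
  assumes w: "weak_integral smul \<rho> \<mu> v w" and \<phi>: "bounded_linear \<phi>"
  shows "has_bochner_integral \<mu> (\<lambda>g. \<phi> (\<rho> g v)) (\<phi> w)"
proof -
  obtain \<Psi> where \<Psi>: "\<Psi> \<in> dual_space smul" "\<And>a v. \<phi> (smul a v) = (a * \<Psi> v) \<bullet> 1"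
    using real_functional_eq_inner_dual[OF \<phi>] by blast
  have "\<phi> v = \<Psi> v \<bullet> 1" for v using \<Psi>(2)[of 1 v] by simp
  then show ?thesis
    using w \<Psi>(1) by (auto simp: weak_integral_def intro!: has_bochner_integral_inner_left)
qed

text \<open>Two values are separated by a functional obtained from the closed subspace {0}; this
  makes the description in \<open>avg\<close> well-defined.\<close>

lemma weak_integral_unique:
  assumes "weak_integral smul \<rho> \<mu> v w" "weak_integral smul \<rho> \<mu> v w'"
  shows "w = w'"
proof (rule ccontr)
  assume "w \<noteq> w'"
  then have "w - w' \<notin> closure {0}" by simp
  then obtain f :: "'v \<Rightarrow> real" where f: "bounded_linear f" "f (w - w') \<noteq> 0"
    using exists_annihilating_functional[OF real_vector.subspace_single_0] by blast
  have "f w = f w'"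
    using assms f(1) weak_integral_real has_bochner_integral_eq by blast
  then show False using f linear_diff[OF bounded_linear.linear] by fastforce
qed

lemma weak_integral_avg: "weak_integral smul \<rho> \<mu> v (P v)"
proof -
  have "\<exists>w. weak_integral smul \<rho> \<mu> v w"
    using stationary by (auto simp: weakly_uniquely_stationary_def integrable_module_def)
  then have "\<exists>!w. weak_integral smul \<rho> \<mu> v w" using weak_integral_unique by blast
  then show ?thesis unfolding avg_def by (rule theI')
qed

lemma avg_eqI: "weak_integral smul \<rho> \<mu> v w \<Longrightarrow> P v = w"
  using weak_integral_avg weak_integral_unique by blast

lemma dual_avg: "\<Psi> \<in> dual_space smul \<Longrightarrow> has_bochner_integral \<mu> (\<lambda>g. \<Psi> (\<rho> g v)) (\<Psi> (P v))"
  using weak_integral_avg by (simp add: weak_integral_def)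

lemma avg_add: "P (v + w) = P v + P w"
proof (rule avg_eqI, unfold weak_integral_def, intro ballI)
  fix \<Psi> assume \<Psi>: "\<Psi> \<in> dual_space smul"
  have "\<Psi> (x + y) = \<Psi> x + \<Psi> y" for x y
    using dual_spaceD(1)[OF \<Psi>] by (simp add: bounded_linear.linear linear_add)
  then show "has_bochner_integral \<mu> (\<lambda>g. \<Psi> (\<rho> g (v + w))) (\<Psi> (P v + P w))"
    using dual_avg[OF \<Psi>] by (simp add: action_vec_add has_bochner_integral_add)
qed

lemma avg_smul: "P (smul a v) = smul a (P v)"
proof (rule avg_eqI, unfold weak_integral_def, intro ballI)
  fix \<Psi> assume \<Psi>: "\<Psi> \<in> dual_space smul"
  show "has_bochner_integral \<mu> (\<lambda>g. \<Psi> (\<rho> g (smul a v))) (\<Psi> (smul a (P v)))"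
    using dual_avg[OF \<Psi>, of v] by (simp add: action_smul dual_spaceD(2)[OF \<Psi>] has_bochner_integral_mult_right)
qed

lemma avg_linear: "linear P"
  using avg_smul[of "of_real _"] by (intro linearI) (auto simp: avg_add scale_of_real)

lemma avg_commute:
  assumes T: "T \<in> bounded_operators smul" and comm: "\<And>g v. T (\<rho> g v) = \<rho> g (T v)"
  shows "P (T v) = T (P v)"
proof (rule avg_eqI, unfold weak_integral_def, intro ballI)
  fix \<Psi> assume "\<Psi> \<in> dual_space smul"
  then show "has_bochner_integral \<mu> (\<lambda>g. \<Psi> (\<rho> g (T v))) (\<Psi> (T (P v)))"
    using dual_avg[OF dual_space_compose[OF _ T], of \<Psi> v] by (simp add: comm)
qed

text \<open>If every convex combination missed \<open>P\<close> by \<delta> somewhere on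
  \<open>L\<close>, a functional would satisfy \<open>f P + \<delta> \<le> f (\<rho> g)\<close> for
  all \<open>g\<close>. But such an \<open>f\<close> is a finite sum of bounded functionals of the
  values on \<open>L\<close>, so \<open>f P\<close> is the mean of \<open>f (\<rho> g)\<close>,
  which contradicts total mass 1.\<close>

lemma avg_approx:
  assumes L: "finite L" and \<delta>: "0 < \<delta>"
  obtains T where "T \<in> convex hull (range \<rho>)" "\<And>v. v \<in> L \<Longrightarrow> norm (T v - P v) < \<delta>"
proof (rule ccontr)
  assume no: "\<not> thesis"
  note witness = that
  define p :: "('v \<Rightarrow> 'v) \<Rightarrow> real" where "p f = (\<Sum>v\<in>L. norm (f v))" for f
  have p_ge: "\<delta> \<le> p (T - P)" if "T \<in> convex hull (range \<rho>)" for T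
  proof (rule ccontr)
    assume "\<not> \<delta> \<le> p (T - P)"
    then have "norm (T v - P v) < \<delta>" if "v \<in> L" for v
      using member_le_sum[OF that, of "\<lambda>v. norm ((T - P) v)"] L by (simp add: p_def)
    then show False using no witness \<open>T \<in> _\<close> by blast
  qed
  have p_sub: "sublinear p"
    unfolding sublinear_def p_def
    by (auto simp: sum_distrib_left sum.distrib[symmetric] intro!: sum_mono norm_triangle_ineq)
  have p_neg: "p (- f) = p f" for f by (simp add: p_def)
  obtain f where f: "linear f" "f \<le> p" and sep: "\<And>T. T \<in> convex hull (range \<rho>) \<Longrightarrow> f P + \<delta> \<le> f T"
    by (rule separating_functional[of p "convex hull (range \<rho>)" \<delta> P])
      (use p_sub p_ge p_neg in auto)
  have f_le: "\<bar>f x\<bar> \<le> p x" for x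
    using f(2)[THEN le_funD, of x] f(2)[THEN le_funD, of "- x"] linear_neg[OF f(1), of x] p_neg[of x]
    by simp
  \<comment> \<open>Since \<open>f\<close> is dominated by \<open>p\<close>, it sees a map only
    through its values on \<open>L\<close>; the one-point maps \<open>e v x\<close> split it into
    functionals of the single values.\<close>
  define e :: "'v \<Rightarrow> 'v \<Rightarrow> 'v \<Rightarrow> 'v" where "e v x = (\<lambda>u. if u = v then x else 0)" for v x
  have e_linear: "e v (x + y) = e v x + e v y" "e v (r *\<^sub>R x) = r *\<^sub>R e v x" for v x y r
    by (auto simp: e_def fun_eq_iff)
  have bl: "bounded_linear (\<lambda>x. f (e v x))" if "v \<in> L" for v
  proof (rule bounded_linear_intro[of _ 1])
    show "norm (f (e v x)) \<le> norm x * 1" for x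
      using f_le[of "e v x"] L that by (simp add: p_def e_def if_distrib[of norm] sum.delta cong: if_cong)
  qed (simp_all add: e_linear linear_add[OF f(1)] linear_scale[OF f(1)])
  have f_eq: "f T = (\<Sum>v\<in>L. f (e v (T v)))" for T
  proof -
    have "(\<Sum>v\<in>L. e v (T v)) u = (\<Sum>v\<in>L. e v (T v) u)" for u
      using L by (induction L) auto
    then have "p (T - (\<Sum>v\<in>L. e v (T v))) = 0"
      using L by (simp add: p_def e_def sum.delta)
    then have "f (T - (\<Sum>v\<in>L. e v (T v))) = 0" using f_le by (metis abs_le_zero_iff)
    then show ?thesis by (simp add: linear_diff[OF f(1)] linear_sum[OF f(1)])
  qed
  have "has_bochner_integral \<mu> (\<lambda>g. \<Sum>v\<in>L. f (e v (\<rho> g v))) (\<Sum>v\<in>L. f (e v (P v)))"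
    using weak_integral_real[OF weak_integral_avg bl] by (intro has_bochner_integral_sum) auto
  then have int: "has_bochner_integral \<mu> (\<lambda>g. f (\<rho> g)) (f P)" by (simp flip: f_eq)
  have "f P + \<delta> \<le> (\<integral>g. f (\<rho> g) \<partial>\<mu>)"
    using int sep by (intro integral_ge_const) (auto simp: has_bochner_integral_iff hull_inc)
  then show False using int \<delta> by (simp add: has_bochner_integral_iff)
qed

lemma convex_hull_action:
  assumes "T \<in> convex hull (range \<rho>)"
  shows "linear T" "norm (T v) \<le> bound * norm v"
proof -
  have "convex hull (range \<rho>) \<subseteq> {T. linear T}"
    by (rule hull_minimal)
      (auto simp: convex_def linear_iff algebra_simps action_vec_add action_vec_scaleR)
  then show "linear T" using assms by blast
  have "convex {T :: 'v \<Rightarrow> 'v. \<forall>v. norm (T v) \<le> bound * norm v}"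
    unfolding convex_def
  proof (clarsimp)
    fix x y :: "'v \<Rightarrow> 'v" and u w v
    assume *: "\<forall>v. norm (x v) \<le> bound * norm v" "\<forall>v. norm (y v) \<le> bound * norm v"
      and u: "0 \<le> u" "0 \<le> w" "u + w = (1::real)"
    have "norm (u *\<^sub>R x v + w *\<^sub>R y v) \<le> u * norm (x v) + w * norm (y v)"
      using u norm_triangle_ineq[of "u *\<^sub>R x v" "w *\<^sub>R y v"] by simp
    also have "\<dots> \<le> bound * norm v"
      using u * by (intro convex_bound_le) auto
    finally show "norm (u *\<^sub>R x v + w *\<^sub>R y v) \<le> bound * norm v" .
  qed
  then have "convex hull (range \<rho>) \<subseteq> {T. \<forall>v. norm (T v) \<le> bound * norm v}"
    by (intro hull_minimal) (auto simp: norm_action_le)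
  then show "norm (T v) \<le> bound * norm v" using assms by blast
qed

text \<open>\<open>\<rho>\<^sub>\<mu>\<close> preserves the closed convex invariant sets \<open>{u. \<forall>g. norm (\<rho> g u) \<le> r}\<close>.\<close>

lemma norm_action_avg_le:
  assumes u: "\<And>g. norm (\<rho> g u) \<le> r"
  shows "norm (\<rho> g (P u)) \<le> r"
proof (rule field_le_epsilon)
  fix \<delta> :: real assume "0 < \<delta>"
  then have "0 < \<delta> / bound" using bound_pos by simp
  then obtain T where T: "T \<in> convex hull (range \<rho>)" "norm (T u - P u) < \<delta> / bound"
    using avg_approx[of "{u}"] by blast
  have "convex {T. norm (\<rho> g (T u)) \<le> r}"
    unfolding convex_def
  proof (clarsimp simp: action_vec_add action_vec_scaleR)
    fix x y :: "'v \<Rightarrow> 'v" and s t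
    assume *: "norm (\<rho> g (x u)) \<le> r" "norm (\<rho> g (y u)) \<le> r"
      and s: "0 \<le> s" "0 \<le> t" "s + t = (1::real)"
    have "norm (s *\<^sub>R \<rho> g (x u) + t *\<^sub>R \<rho> g (y u)) \<le> s * norm (\<rho> g (x u)) + t * norm (\<rho> g (y u))"
      using s norm_triangle_ineq[of "s *\<^sub>R \<rho> g (x u)" "t *\<^sub>R \<rho> g (y u)"] by simp
    also have "\<dots> \<le> r"
      using s * by (intro convex_bound_le) auto
    finally show "norm (s *\<^sub>R \<rho> g (x u) + t *\<^sub>R \<rho> g (y u)) \<le> r" .
  qed
  then have "convex hull (range \<rho>) \<subseteq> {T. norm (\<rho> g (T u)) \<le> r}"
    by (intro hull_minimal) (auto simp: u simp flip: action_add)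
  then have "norm (\<rho> g (T u)) \<le> r" using T by blast
  moreover have "norm (\<rho> g (T u - P u)) \<le> \<delta>"
  proof -
    have "norm (\<rho> g (T u - P u)) \<le> bound * norm (T u - P u)" by (rule norm_action_le)
    also have "\<dots> \<le> bound * (\<delta> / bound)"
      using T(2) bound_pos by (intro mult_left_mono) auto
    finally show ?thesis using bound_pos by simp
  qed
  moreover have "\<rho> g (P u) = \<rho> g (T u) - \<rho> g (T u - P u)" by (simp add: action_vec_diff)
  ultimately show "norm (\<rho> g (P u)) \<le> r + \<delta>"
    using norm_triangle_ineq4[of "\<rho> g (T u)" "\<rho> g (T u - P u)"] by simp
qed

text \<open>The induction carries the bound for all translates by \<open>\<rho> g\<close> at once.
  Iterating a norm bound for \<open>P\<close> alone would only give the power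
  \<open>bound ^ n\<close>.\<close>

lemma norm_avg_pow_le: "norm ((P ^^ n) v) \<le> bound * norm v"
proof -
  have "norm (\<rho> g ((P ^^ n) v)) \<le> bound * norm v" for g
    by (induction n arbitrary: g) (auto simp: norm_action_le intro: norm_action_avg_le)
  from this[of 0] show ?thesis by simp
qed

lemma norm_avg_le: "norm (P v) \<le> bound * norm v"
  using norm_avg_pow_le[of 1 v] by simp

lemma avg_bounded_linear: "bounded_linear P"
  using norm_avg_le avg_smul[of "of_real _"]
  by (intro bounded_linear_intro[of P bound]) (auto simp: avg_add scale_of_real mult.commute)

lemma avg_pow_linear: "linear (P ^^ n)"
proof (induction n)
  case 0
  show ?case by (simp add: linear_iff)
next
  case (Suc n)
  then show ?case using linear_compose[OF Suc avg_linear] by (simp only: funpow.simps)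
qed

section \<open>Cesaro means and their limit\<close>

definition cesaro :: "nat \<Rightarrow> 'v \<Rightarrow> 'v" where
  "cesaro n v = (1 / real n) *\<^sub>R (\<Sum>i<n. (P ^^ i) v)"

lemma cesaro_linear: "linear (cesaro n)"
  unfolding cesaro_def[abs_def]
  by (intro linear_compose_scale_right linear_compose_sum ballI avg_pow_linear)

lemma norm_cesaro_le: "norm (cesaro n v) \<le> bound * norm v"
proof (cases "n = 0")
  case False
  have "norm (\<Sum>i<n. (P ^^ i) v) \<le> (\<Sum>i<n. bound * norm v)"
    by (intro sum_norm_le norm_avg_pow_le)
  then show ?thesis using False by (simp add: cesaro_def field_simps)
qed (simp add: cesaro_def bound_pos less_imp_le)

lemma cesaro_fixed: "P v = v \<Longrightarrow> 0 < n \<Longrightarrow> cesaro n v = v"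
proof -
  assume v: "P v = v" and n: "0 < n"
  have "(P ^^ i) v = v" for i using v by (induction i) auto
  then show ?thesis using n by (simp add: cesaro_def sum_constant_scaleR)
qed

lemma avg_pow_telescope: "(\<Sum>i<n. (P ^^ i) (v - P v)) = v - (P ^^ n) v"
proof -
  have "(\<Sum>i<n. (P ^^ i) (v - P v)) = (\<Sum>i<n. (P ^^ i) v - (P ^^ Suc i) v)"
    by (intro sum.cong) (simp_all add: linear_diff[OF avg_pow_linear] funpow_swap1)
  then show ?thesis using sum_lessThan_telescope'[of "\<lambda>i. (P ^^ i) v" n] by simp
qed

text \<open>Telescoping leaves \<open>v - (P ^^ n) v\<close>, which stays bounded while the factor 1
  / n tends to 0.\<close>

lemma cesaro_coboundary: "(\<lambda>n. cesaro n (v - P v)) \<longlonglongrightarrow> 0"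
proof (rule Lim_null_comparison)
  show "\<forall>\<^sub>F n in sequentially. norm (cesaro n (v - P v)) \<le> (1 / real n) * ((1 + bound) * norm v)"
  proof (intro always_eventually allI)
    fix n
    have "norm (v - (P ^^ n) v) \<le> (1 + bound) * norm v"
      using norm_triangle_ineq4[of v "(P ^^ n) v"] norm_avg_pow_le[of n v]
      by (simp add: algebra_simps)
    then show "norm (cesaro n (v - P v)) \<le> (1 / real n) * ((1 + bound) * norm v)"
      by (simp add: cesaro_def avg_pow_telescope divide_right_mono)
  qed
  show "(\<lambda>n. (1 / real n) * ((1 + bound) * norm v)) \<longlonglongrightarrow> 0"
    using tendsto_mult_right[OF lim_inverse_n', of "(1 + bound) * norm v"] by (simp add: mult.commute)
qed

text \<open>A functional vanishing on the set below is \<open>\<rho>\<^sub>\<mu>\<close>-invariant and kills the stationary vectors.\<close>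

lemma ergodic_dense: "v \<in> closure {x + (y - P y) |x y. P x = x}" (is "_ \<in> closure ?N")
proof (rule ccontr)
  assume v: "v \<notin> closure ?N"
  have N_add: "a + b \<in> ?N" if ab: "a \<in> ?N" "b \<in> ?N" for a b
  proof -
    obtain x y x' y' where *: "P x = x" "a = x + (y - P y)" "P x' = x'" "b = x' + (y' - P y')"
      using ab by auto
    have "a + b = (x + x') + ((y + y') - P (y + y'))" "P (x + x') = x + x'"
      unfolding *(2,4) by (simp_all add: avg_add *(1,3) algebra_simps)
    then show ?thesis by blast
  qed
  \<comment> \<open>Closure under all field scalars lets the real functional \<open>f\<close> be
    replaced by \<Psi>: were \<open>\<Psi> s\<close> non-zero, rescaling \<open>s\<close> by its
    inverse would give \<open>f\<close> the value 1 on the set.\<close>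
  have N_smul: "smul c a \<in> ?N" if a: "a \<in> ?N" for a c
  proof -
    obtain x y where *: "P x = x" "a = x + (y - P y)" using a by auto
    then have "smul c a = smul c x + (smul c y - P (smul c y))" "P (smul c x) = smul c x"
      by (auto simp: avg_smul scale_right_distrib scale_right_diff_distrib)
    then show ?thesis by blast
  qed
  have "0 = 0 + (0 - P 0)" "P 0 = 0" using linear_0[OF avg_linear] by auto
  then have N_0: "0 \<in> ?N" by blast
  have "Real_Vector_Spaces.subspace ?N"
    unfolding real_vector.subspace_def
  proof (intro conjI ballI allI)
    show "c *\<^sub>R x \<in> ?N" if "x \<in> ?N" for c x
      using N_smul[OF that, of "of_real c"] by (simp only: scale_of_real)
    show "x + y \<in> ?N" if "x \<in> ?N" "y \<in> ?N" for x y
      using that by (rule N_add)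
  qed (rule N_0)
  then obtain f :: "'v \<Rightarrow> real" where f: "bounded_linear f" "\<And>s. s \<in> ?N \<Longrightarrow> f s = 0" "f v \<noteq> 0"
    using exists_annihilating_functional v by blast
  obtain \<Psi> where \<Psi>: "\<Psi> \<in> dual_space smul" "\<And>a v. f (smul a v) = (a * \<Psi> v) \<bullet> 1"
    using real_functional_eq_inner_dual[OF f(1)] by blast
  have \<Psi>_N: "\<Psi> s = 0" if "s \<in> ?N" for s
  proof (rule ccontr)
    assume "\<Psi> s \<noteq> 0"
    then have "f (smul (inverse (\<Psi> s)) s) = 1" using \<Psi>(2) by (simp add: dot_square_norm)
    then show False using f(2)[OF N_smul[OF that]] by simp
  qed
  have "y - P y \<in> ?N" for y
  proof -
    have "y - P y = 0 + (y - P y)" "P 0 = 0" using linear_0[OF avg_linear] by auto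
    then show ?thesis by blast
  qed
  then have "\<Psi> (y - P y) = 0" for y using \<Psi>_N by blast
  then have "\<Psi> \<circ> P = \<Psi>"
    using linear_diff[OF bounded_linear.linear[OF dual_spaceD(1)[OF \<Psi>(1)]]] by (simp add: fun_eq_iff)
  moreover have "\<Psi> \<noteq> (\<lambda>_. 0)" using f(3) \<Psi>(2)[of 1 v] by auto
  ultimately obtain x where x: "x \<in> stationary_vectors smul \<rho> \<mu>" "\<Psi> x \<noteq> 0"
    using stationary \<Psi>(1) unfolding weakly_uniquely_stationary_def by blast
  have "x = x + (0 - P 0)" "P x = x"
    using x(1) linear_0[OF avg_linear] by (auto simp: stationary_vectors_def)
  then have "x \<in> ?N" by blast
  then show False using \<Psi>_N x(2) by blast
qed

text \<open>On the dense set of \<open>ergodic_dense\<close> the means converge: they fix the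
  stationary part from n = 1 on, and on differences \<open>y - P y\<close> they tend to 0. The norm
  bound uniform in n carries the Cauchy property to every \<open>v\<close>.\<close>

lemma cesaro_convergent: "convergent (\<lambda>n. cesaro n v)"
  unfolding Cauchy_convergent_iff[symmetric]
proof (rule metric_CauchyI)
  fix \<delta> :: real assume \<delta>: "0 < \<delta>"
  then have "0 < \<delta> / (3 * bound)" using bound_pos by simp
  then obtain x y where x: "P x = x" and close: "dist (x + (y - P y)) v < \<delta> / (3 * bound)"
    using ergodic_dense[of v] unfolding closure_approachable by blast
  let ?u = "x + (y - P y)"
  have "(\<lambda>n. cesaro n x + cesaro n (y - P y)) \<longlonglongrightarrow> x + 0"
    using cesaro_fixed[OF x]
    by (intro tendsto_add cesaro_coboundary tendsto_eventually eventually_sequentiallyI[of 1]) auto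
  then have "Cauchy (\<lambda>n. cesaro n ?u)"
    by (simp add: linear_add[OF cesaro_linear] LIMSEQ_imp_Cauchy)
  then obtain M where M: "\<And>m n. M \<le> m \<Longrightarrow> M \<le> n \<Longrightarrow> dist (cesaro m ?u) (cesaro n ?u) < \<delta> / 3"
    using \<delta> unfolding Cauchy_def by (meson divide_pos_pos zero_less_numeral)
  have near: "dist (cesaro n ?u) (cesaro n v) < \<delta> / 3" for n
  proof -
    have "dist (cesaro n ?u) (cesaro n v) \<le> bound * dist ?u v"
      using norm_cesaro_le[of n "?u - v"] by (simp add: dist_norm linear_diff[OF cesaro_linear])
    also have "\<dots> < bound * (\<delta> / (3 * bound))"
      using close bound_pos by (intro mult_strict_left_mono)
    finally show ?thesis using bound_pos by simp
  qed
  have "dist (cesaro m v) (cesaro n v) < \<delta>" if "M \<le> m" "M \<le> n" for m n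
    using near[of m] near[of n] M[OF that]
      dist_triangle[of "cesaro m v" "cesaro n v" "cesaro m ?u"]
      dist_triangle[of "cesaro m ?u" "cesaro n v" "cesaro n ?u"]
    by (simp add: dist_commute)
  then show "\<exists>M. \<forall>m\<ge>M. \<forall>n\<ge>M. dist (cesaro m v) (cesaro n v) < \<delta>" by blast
qed

lemma cesaro_LIMSEQ: "(\<lambda>n. cesaro n v) \<longlonglongrightarrow> E v"
  using cesaro_convergent[of v]
  by (simp add: convergent_LIMSEQ_iff mean_projection_def cesaro_def)

lemma mean_linear: "linear E"
proof (rule linearI)
  show "E (v + w) = E v + E w" for v w
    using cesaro_LIMSEQ[of "v + w"] tendsto_add[OF cesaro_LIMSEQ cesaro_LIMSEQ, of v w]
    by (auto simp: linear_add[OF cesaro_linear] intro: LIMSEQ_unique)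
  show "E (r *\<^sub>R v) = r *\<^sub>R E v" for r v
    using cesaro_LIMSEQ[of "r *\<^sub>R v"] tendsto_scaleR[OF tendsto_const cesaro_LIMSEQ, of r v]
    by (auto simp: linear_scale[OF cesaro_linear] intro: LIMSEQ_unique)
qed

lemmas mean_diff = linear_diff[OF mean_linear]
lemmas mean_add = linear_add[OF mean_linear]

lemma norm_mean_le: "norm (E v) \<le> bound * norm v"
  by (rule LIMSEQ_le_const2[OF tendsto_norm[OF cesaro_LIMSEQ]]) (auto simp: norm_cesaro_le)

lemma mean_bounded_linear: "bounded_linear E"
  using norm_mean_le by (intro bounded_linear_intro[of E bound])
    (auto simp: mean_add linear_scale[OF mean_linear] mult.commute)

text \<open>Commutation passes from \<open>P\<close> to its powers, their means and the limit. It is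
  used for scalar multiplication, for \<open>P\<close> itself and for the action of the other,
  commuting factor.\<close>

lemma mean_commute:
  assumes T: "bounded_linear T" and comm: "\<And>v. P (T v) = T (P v)"
  shows "E (T v) = T (E v)"
proof -
  have "(P ^^ i) (T v) = T ((P ^^ i) v)" for i v
    by (induction i) (auto simp: comm)
  then have "cesaro n (T v) = T (cesaro n v)" for n
    by (simp add: cesaro_def linear_scale[OF bounded_linear.linear[OF T]] linear_sum[OF bounded_linear.linear[OF T]])
  moreover have "(\<lambda>n. T (cesaro n v)) \<longlonglongrightarrow> T (E v)"
    by (intro bounded_linear.tendsto[OF T] cesaro_LIMSEQ)
  ultimately show ?thesis
    using cesaro_LIMSEQ[of "T v"] by (auto intro: LIMSEQ_unique)
qed

lemma mean_smul: "E (smul a v) = smul a (E v)"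
  by (rule mean_commute[OF bounded_linear_scale avg_smul])

lemma mean_fixed: "P v = v \<Longrightarrow> E v = v"
  using cesaro_LIMSEQ[of v] cesaro_fixed[of v]
  by (intro LIMSEQ_unique[OF cesaro_LIMSEQ] tendsto_eventually eventually_sequentiallyI[of 1]) auto

text \<open>\<open>E\<close> annihilates \<open>v - P v\<close>, so \<open>E v = E (P v)\<close>,
  and \<open>E\<close> commutes with \<open>P\<close>.\<close>

lemma mean_stationary: "P (E v) = E v"
proof -
  have "P v - v = - (v - P v)" by simp
  then have "E (v - P v) = 0"
    using cesaro_coboundary[of v] cesaro_LIMSEQ LIMSEQ_unique by blast
  then show ?thesis
    using mean_commute[OF avg_bounded_linear, of v] by (simp add: mean_diff)
qed

lemma mean_in_stationary: "E v \<in> stationary_vectors smul \<rho> \<mu>"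
  by (simp add: stationary_vectors_def mean_stationary)

lemma stationary_iff: "v \<in> stationary_vectors smul \<rho> \<mu> \<longleftrightarrow> P v = v"
  by (simp add: stationary_vectors_def)

end

text \<open>The common constant \<open>C\<close> makes the operators equicontinuous: closeness is
  assumed on a finite \<open>\<delta> / (3 * C)\<close>-net of \<open>L\<close>, and leaving the net
  costs \<delta> / 3 for each of the two operators. This serves both the convex combinations near
  \<open>P\<close> and the means near \<open>E\<close>.\<close>

lemma approx_on_compact:
  fixes S :: "'a::real_normed_vector \<Rightarrow> 'b::real_normed_vector"
  assumes fin: "\<And>F \<delta>. finite F \<Longrightarrow> 0 < \<delta> \<Longrightarrow> \<exists>T\<in>\<T>. \<forall>v\<in>F. norm (T v - S v) < \<delta>"
    and lin: "linear S" "\<And>T. T \<in> \<T> \<Longrightarrow> linear T"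
    and bd: "\<And>v. norm (S v) \<le> C * norm v" "\<And>T v. T \<in> \<T> \<Longrightarrow> norm (T v) \<le> C * norm v"
    and C: "0 < C" and L: "compact L" and \<delta>: "0 < \<delta>"
  shows "\<exists>T\<in>\<T>. \<forall>v\<in>L. norm (T v - S v) < \<delta>"
proof -
  have e: "0 < \<delta> / (3 * C)" using C \<delta> by simp
  then obtain F where F: "finite F" "L \<subseteq> (\<Union>x\<in>F. ball x (\<delta> / (3 * C)))"
    using L unfolding compact_eq_totally_bounded by blast
  obtain T where T: "T \<in> \<T>" "\<And>v. v \<in> F \<Longrightarrow> norm (T v - S v) < \<delta> / 3"
    using fin[OF F(1), of "\<delta> / 3"] \<delta> by auto
  have "norm (T v - S v) < \<delta>" if v: "v \<in> L" for v
  proof -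
    obtain x where x: "x \<in> F" "norm (v - x) < \<delta> / (3 * C)"
      using subsetD[OF F(2) v] by (auto simp: dist_norm norm_minus_commute)
    then have "C * norm (v - x) < \<delta> / 3" using C by (simp add: field_simps)
    then have small: "norm (T (v - x)) < \<delta> / 3" "norm (S (v - x)) < \<delta> / 3"
      using bd(1)[of "v - x"] bd(2)[OF T(1), of "v - x"] by simp_all
    have eq: "T v - S v = (T (v - x) + (T x - S x)) - S (v - x)"
      by (simp add: linear_diff[OF lin(1)] linear_diff[OF lin(2)[OF T(1)]])
    have "norm (T v - S v) \<le> norm (T (v - x)) + norm (T x - S x) + norm (S (v - x))"
      unfolding eq
      using norm_triangle_ineq4[of "T (v - x) + (T x - S x)" "S (v - x)"]
        norm_triangle_ineq[of "T (v - x)" "T x - S x"] by linarith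
    then show ?thesis using small T(2)[OF x(1)] by linarith
  qed
  then show ?thesis using T(1) by blast
qed

context stationary_module
begin

lemma avg_approx_compact:
  assumes "compact L" "0 < \<delta>"
  shows "\<exists>T\<in>convex hull (range \<rho>). \<forall>v\<in>L. norm (T v - P v) < \<delta>"
proof (rule approx_on_compact)
  show "\<exists>T\<in>convex hull range \<rho>. \<forall>v\<in>F. norm (T v - P v) < d" if "finite F" "0 < d" for F d
    by (rule avg_approx[OF that]) blast
qed (rule avg_linear norm_avg_le bound_pos assms | erule convex_hull_action)+

text \<open>Index 0 is excluded because \<open>cesaro 0\<close> is the zero map; solvability for it
  would say that the crossed homomorphism is a coboundary on the first factor.\<close>

lemma cesaro_approx_compact:
  assumes "compact L" "0 < \<delta>"
  shows "\<exists>T\<in>cesaro ` {0<..}. \<forall>v\<in>L. norm (T v - E v) < \<delta>"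
proof (rule approx_on_compact)
  show "\<exists>T\<in>cesaro ` {0<..}. \<forall>v\<in>F. norm (T v - E v) < d" if "finite F" "0 < d" for F d
  proof -
    have "\<forall>v\<in>F. \<forall>\<^sub>F n in sequentially. norm (cesaro n v - E v) < d"
      using tendstoD[OF cesaro_LIMSEQ \<open>0 < d\<close>] by (simp add: dist_norm)
    then have "\<forall>\<^sub>F n in sequentially. 0 < n \<and> (\<forall>v\<in>F. norm (cesaro n v - E v) < d)"
      using \<open>finite F\<close> by (intro eventually_conj eventually_gt_at_top) (simp add: eventually_ball_finite_distrib)
    then show ?thesis by (auto dest!: eventually_happens)
  qed
qed (auto intro: cesaro_linear norm_cesaro_le mean_linear norm_mean_le bound_pos assms)

end

section \<open>The spectral gap\<close>

text \<open>An arbitrary upper bound \<open>r\<close> replaces the maximum over \<open>K0\<close>,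
  so neither its attainment nor \<open>K0\<close> being non-empty has to be discussed. For empty
  \<open>K0\<close> the case r = 0 says that the space is zero.\<close>

locale spectral_gap = bounded_module smul \<rho>
  for smul :: "'k::{real_normed_field, euclidean_space} \<Rightarrow> 'v::banach \<Rightarrow> 'v"
    and \<rho> :: "'g::topological_group_add \<Rightarrow> 'v \<Rightarrow> 'v" +
  fixes K0 :: "'g set" and \<epsilon> :: real
  assumes compact_K0: "compact K0" and \<epsilon>_pos: "0 < \<epsilon>"
    and gap: "\<And>v r. 0 \<le> r \<Longrightarrow> (\<And>g. g \<in> K0 \<Longrightarrow> norm (v - \<rho> g v) \<le> r) \<Longrightarrow> \<epsilon> * norm v \<le> r"

text \<open>Failure of almost invariance provides \<open>K\<close> and \<epsilon>, and homogeneity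
  carries the estimate from unit vectors to all vectors. In the other direction, a unit vector moved
  by less than \<epsilon> / 2 contradicts the gap.\<close>

lemma (in bounded_module) spectral_gap_iff:
  "(\<exists>K0 \<epsilon>. spectral_gap smul \<rho> K0 \<epsilon>) \<longleftrightarrow> \<not> almost_invariant_unit_vectors \<rho>"
proof
  assume "\<exists>K0 \<epsilon>. spectral_gap smul \<rho> K0 \<epsilon>"
  then obtain K0 \<epsilon> where "spectral_gap smul \<rho> K0 \<epsilon>" by blast
  then interpret spectral_gap smul \<rho> K0 \<epsilon> .
  show "\<not> almost_invariant_unit_vectors \<rho>"
  proof
    assume "almost_invariant_unit_vectors \<rho>"
    then obtain v where v: "norm v = 1" "\<And>g. g \<in> K0 \<Longrightarrow> norm (v - \<rho> g v) < \<epsilon> / 2"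
      using compact_K0 \<epsilon>_pos unfolding almost_invariant_unit_vectors_def by (meson half_gt_zero)
    have "\<epsilon> * norm v \<le> \<epsilon> / 2" using v(2) \<epsilon>_pos by (intro gap) (auto intro: less_imp_le)
    then show False using v(1) \<epsilon>_pos by simp
  qed
next
  assume "\<not> almost_invariant_unit_vectors \<rho>"
  then obtain K \<epsilon> where K: "compact K" "0 < \<epsilon>"
    and no: "\<And>v. norm v = 1 \<Longrightarrow> \<exists>g\<in>K. \<epsilon> \<le> norm (v - \<rho> g v)"
    unfolding almost_invariant_unit_vectors_def by (meson not_less)
  have "spectral_gap smul \<rho> K \<epsilon>"
  proof unfold_locales
    fix v r assume r: "0 \<le> r" and le: "\<And>g. g \<in> K \<Longrightarrow> norm (v - \<rho> g v) \<le> r"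
    show "\<epsilon> * norm v \<le> r"
    proof (cases "v = 0")
      case False
      define u where "u = inverse (norm v) *\<^sub>R v"
      have u: "norm u = 1" "v = norm v *\<^sub>R u" using False by (auto simp: u_def)
      obtain g where g: "g \<in> K" "\<epsilon> \<le> norm (u - \<rho> g u)" using no[OF u(1)] by blast
      have "v - \<rho> g v = norm v *\<^sub>R (u - \<rho> g u)"
        by (subst (1 2) u(2)) (simp add: action_vec_scaleR scaleR_diff_right)
      then have "norm (v - \<rho> g v) = norm v * norm (u - \<rho> g u)" by simp
      then show ?thesis using mult_left_mono[OF g(2), of "norm v"] le[OF g(1)] by (simp add: mult.commute)
    qed (use r in simp)
  qed (use K in auto)
  then show "\<exists>K0 \<epsilon>. spectral_gap smul \<rho> K0 \<epsilon>" by blast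
qed

context spectral_gap
begin

lemma no_fixed_vectors: "fixed_vectors \<rho> = {0}"
proof -
  have "v = 0" if "\<forall>g. \<rho> g v = v" for v
    using gap[of 0 v] that \<epsilon>_pos by (simp add: mult_le_0_iff)
  then show ?thesis by (auto simp: fixed_vectors_def action_vec_0)
qed

text \<open>By the gap, approximate solutions of \<open>w - \<rho> g w = h g\<close> on \<open>K0\<close> form a Cauchy net.\<close>

lemma exact_solution:
  assumes approx: "\<And>g0 \<delta>. 0 < \<delta> \<Longrightarrow> \<exists>w. \<forall>g\<in>insert g0 K0. norm (w - \<rho> g w - h g) \<le> \<delta>"
  shows "\<exists>w. \<forall>g. w - \<rho> g w = h g"
proof -
  \<comment> \<open>The difference of two approximate solutions is almost invariant on
    \<open>K0\<close>, hence small.\<close>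
  have close: "\<epsilon> * norm (w - w') \<le> d + d'"
    if w: "\<forall>g\<in>K0. norm (w - \<rho> g w - h g) \<le> d" "\<forall>g\<in>K0. norm (w' - \<rho> g w' - h g) \<le> d'"
      and d: "0 \<le> d" "0 \<le> d'" for w w' d d'
  proof (rule gap)
    fix g assume g: "g \<in> K0"
    have "(w - w') - \<rho> g (w - w') = (w - \<rho> g w - h g) - (w' - \<rho> g w' - h g)"
      by (simp add: action_vec_diff)
    then have "norm ((w - w') - \<rho> g (w - w')) = norm ((w - \<rho> g w - h g) - (w' - \<rho> g w' - h g))"
      by (rule arg_cong)
    then show "norm ((w - w') - \<rho> g (w - w')) \<le> d + d'"
      using norm_triangle_ineq4[of "w - \<rho> g w - h g" "w' - \<rho> g w' - h g"] bspec[OF w(1) g] bspec[OF w(2) g]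
      by linarith
  qed (use d in simp)
  have "\<exists>w. \<forall>g\<in>K0. norm (w - \<rho> g w - h g) \<le> inverse (real (Suc n))" for n
    using approx[of "inverse (real (Suc n))"] by auto
  then obtain w where w: "\<And>n. \<forall>g\<in>K0. norm (w n - \<rho> g (w n) - h g) \<le> inverse (real (Suc n))"
    by metis
  have "Cauchy w"
  proof (rule metric_CauchyI)
    fix d :: real assume "0 < d"
    then have "0 < \<epsilon> * d / 2" using \<epsilon>_pos by simp
    then obtain N where N: "inverse (real (Suc N)) < \<epsilon> * d / 2" using reals_Archimedean by blast
    have "dist (w m) (w n) < d" if "N \<le> m" "N \<le> n" for m n
    proof -
      have "inverse (real (Suc m)) \<le> inverse (real (Suc N))" "inverse (real (Suc n)) \<le> inverse (real (Suc N))"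
        using that by simp_all
      moreover have "\<epsilon> * norm (w m - w n) \<le> inverse (real (Suc m)) + inverse (real (Suc n))"
        by (intro close w) simp_all
      ultimately have "\<epsilon> * norm (w m - w n) < \<epsilon> * d" using N by linarith
      then show ?thesis using \<epsilon>_pos by (simp add: dist_norm)
    qed
    then show "\<exists>N. \<forall>m\<ge>N. \<forall>n\<ge>N. dist (w m) (w n) < d" by blast
  qed
  then obtain W where W: "w \<longlonglongrightarrow> W" using convergent_eq_Cauchy by blast
  \<comment> \<open>\<open>W\<close> was built from solutions on \<open>K0\<close> alone. To test it
    at \<open>g0\<close> it is compared with an approximate solution \<open>u\<close> on
    \<open>insert g0 K0\<close>, which the gap forces to be near \<open>W\<close>.\<close>
  have "norm (W - \<rho> g0 W - h g0) \<le> 0" for g0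
  proof (rule field_le_epsilon)
    fix e :: real assume "0 < e"
    \<comment> \<open>Chosen so that \<open>d + (1 + bound) * (d / \<epsilon>) = e\<close>.\<close>
    define d where "d = e / ((1 + bound) / \<epsilon> + 1)"
    have q: "0 < (1 + bound) / \<epsilon> + 1" using bound_pos \<epsilon>_pos by (simp add: add_pos_pos)
    then have d: "0 < d" using \<open>0 < e\<close> by (simp add: d_def)
    obtain u where u: "\<forall>g\<in>insert g0 K0. norm (u - \<rho> g u - h g) \<le> d" using approx[OF d] by blast
    have "\<epsilon> * norm (u - w n) \<le> d + inverse (real (Suc n))" for n
      using u d by (intro close w) auto
    moreover have "(\<lambda>n. \<epsilon> * norm (u - w n)) \<longlonglongrightarrow> \<epsilon> * norm (u - W)"
      by (intro tendsto_intros W)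
    moreover have "(\<lambda>n. d + inverse (real (Suc n))) \<longlonglongrightarrow> d + 0"
      by (intro tendsto_intros LIMSEQ_inverse_real_of_nat)
    ultimately have "\<epsilon> * norm (u - W) \<le> d + 0"
      by (intro LIMSEQ_le[of "\<lambda>n. \<epsilon> * norm (u - w n)" _ "\<lambda>n. d + inverse (real (Suc n))"]) auto
    then have uW: "norm (W - u) \<le> d / \<epsilon>"
      using \<epsilon>_pos by (simp add: field_simps norm_minus_commute)
    have "W - \<rho> g0 W - h g0 = (u - \<rho> g0 u - h g0) + ((W - u) - \<rho> g0 (W - u))"
      by (simp add: action_vec_diff)
    then have "norm (W - \<rho> g0 W - h g0)
        \<le> norm (u - \<rho> g0 u - h g0) + norm ((W - u) - \<rho> g0 (W - u))"
      by (metis norm_triangle_ineq)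
    also have "\<dots> \<le> d + (norm (W - u) + bound * norm (W - u))"
      using u norm_triangle_ineq4[of "W - u" "\<rho> g0 (W - u)"] norm_action_le[of g0 "W - u"]
      by (intro add_mono) auto
    also have "\<dots> = d + (1 + bound) * norm (W - u)" by (simp add: algebra_simps)
    also have "\<dots> \<le> d + (1 + bound) * (d / \<epsilon>)"
      using uW bound_pos by (intro add_left_mono mult_left_mono) auto
    also have "\<dots> = d * ((1 + bound) / \<epsilon> + 1)" by (simp add: algebra_simps add_divide_distrib)
    also have "\<dots> = e" using q by (simp add: d_def)
    finally show "norm (W - \<rho> g0 W - h g0) \<le> 0 + e" by simp
  qed
  then show ?thesis by (metis norm_le_zero_iff right_minus_eq)
qed

end

section \<open>Products of groups\<close>

definition crossed_homs :: "'v::banach set \<Rightarrow> ('g::topological_group_add \<Rightarrow> 'v \<Rightarrow> 'v) \<Rightarrow> ('g \<Rightarrow> 'v) set" where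
  "crossed_homs W \<rho> =
     {\<beta>. continuous_on UNIV \<beta> \<and> range \<beta> \<subseteq> W \<and> (\<forall>g h. \<beta> (g + h) = \<beta> g + \<rho> g (\<beta> h))}"

lemma crossed_homsD:
  assumes "\<beta> \<in> crossed_homs W \<rho>"
  shows "continuous_on UNIV \<beta>" "\<beta> g \<in> W" "\<beta> (g + h) = \<beta> g + \<rho> g (\<beta> h)"
  using assms by (auto simp: crossed_homs_def)

locale product_module = bounded_module smul \<rho> +
  M1: stationary_module smul "\<lambda>g. \<rho> (g, 0)" \<mu>1 +
  M2: stationary_module smul "\<lambda>g. \<rho> (0, g)" \<mu>2 +
  gap1: spectral_gap smul "\<lambda>g. \<rho> (g, 0)" K0 \<epsilon>
  for smul :: "'k::{real_normed_field, euclidean_space} \<Rightarrow> 'v::banach \<Rightarrow> 'v"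
    and \<rho> :: "'g1::topological_group_add \<times> 'g2::topological_group_add \<Rightarrow> 'v \<Rightarrow> 'v"
    and \<mu>1 :: "'g1 measure" and \<mu>2 :: "'g2 measure" and K0 :: "'g1 set" and \<epsilon> :: real +
  assumes continuous: "strongly_operator_continuous \<rho>"
begin

lemma action_commute: "\<rho> (g, 0) (\<rho> (0, h) v) = \<rho> (0, h) (\<rho> (g, 0) v)"
  and action_split: "\<rho> (g, h) v = \<rho> (g, 0) (\<rho> (0, h) v)"
  by (simp_all flip: action_add)

lemma avg_2_action_1: "M2.P (\<rho> (g, 0) v) = \<rho> (g, 0) (M2.P v)"
  by (rule M2.avg_commute[OF action_in_bounded_operators action_commute])

lemma avg_1_action_2: "M1.P (\<rho> (0, h) v) = \<rho> (0, h) (M1.P v)"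
  by (rule M1.avg_commute[OF action_in_bounded_operators action_commute[symmetric]])

lemma mean_2_action_1: "M2.E (\<rho> (g, 0) v) = \<rho> (g, 0) (M2.E v)"
  by (rule M2.mean_commute[OF action_bounded_linear avg_2_action_1])

lemma mean_1_action_2: "M1.E (\<rho> (0, h) v) = \<rho> (0, h) (M1.E v)"
  by (rule M1.mean_commute[OF action_bounded_linear avg_1_action_2])

lemma crossed_hom_exchange:
  assumes "\<beta> \<in> crossed_homs W \<rho>"
  shows "\<beta> (0, h) - \<rho> (g, 0) (\<beta> (0, h)) = \<beta> (g, 0) - \<rho> (0, h) (\<beta> (g, 0))"
  using crossed_homsD(3)[OF assms, of "(g, 0)" "(0, h)"] crossed_homsD(3)[OF assms, of "(0, h)" "(g, 0)"]
  by (simp add: algebra_simps)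

text \<open>By the exchange identity the displacement of \<open>\<beta> (0, h)\<close> under
  \<open>g\<close> is \<open>\<beta> (g, 0) - \<rho> (0, h) (\<beta> (g, 0))\<close>; this explains
  the factor \<open>1 + bound\<close> and the uniformity in \<open>h\<close>.\<close>

lemma crossed_hom_2_bound:
  assumes \<beta>: "\<beta> \<in> crossed_homs W \<rho>" and r: "0 \<le> r" "\<And>g. g \<in> K0 \<Longrightarrow> norm (\<beta> (g, 0)) \<le> r"
  shows "\<epsilon> * norm (\<beta> (0, h)) \<le> (1 + bound) * r"
proof (rule gap1.gap)
  fix g assume "g \<in> K0"
  then have "norm (\<beta> (g, 0)) + bound * norm (\<beta> (g, 0)) \<le> r + bound * r"
    using r(2) bound_pos by (intro add_mono mult_left_mono) auto
  moreover have "norm (\<beta> (0, h) - \<rho> (g, 0) (\<beta> (0, h))) \<le> norm (\<beta> (g, 0)) + bound * norm (\<beta> (g, 0))"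
    unfolding crossed_hom_exchange[OF \<beta>]
    using norm_triangle_ineq4[of "\<beta> (g, 0)" "\<rho> (0, h) (\<beta> (g, 0))"] norm_action_le[of "(0, h)" "\<beta> (g, 0)"]
    by linarith
  ultimately show "norm (\<beta> (0, h) - \<rho> (g, 0) (\<beta> (0, h))) \<le> (1 + bound) * r"
    by (simp add: algebra_simps)
qed (use r bound_pos in simp)

definition solvable :: "('g1 \<times> 'g2 \<Rightarrow> 'v) \<Rightarrow> ('v \<Rightarrow> 'v) \<Rightarrow> bool" where
  "solvable \<beta> T \<longleftrightarrow> (\<exists>w. \<forall>g. w - \<rho> (g, 0) w = \<beta> (g, 0) - T (\<beta> (g, 0)))"

text \<open>For \<open>T = \<rho> (0, h)\<close> the exchange identity supplies
  \<open>w = \<beta> (0, h)\<close>. Weights with sum 1 reproduce the term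
  \<open>\<beta> (g, 0)\<close>, so solutions combine convexly.\<close>

lemma solvable_convex_hull:
  assumes \<beta>: "\<beta> \<in> crossed_homs W \<rho>" and T: "T \<in> convex hull (range (\<lambda>h. \<rho> (0, h)))"
  shows "solvable \<beta> T"
proof -
  have "convex {T. solvable \<beta> T}"
    unfolding convex_def
  proof (intro ballI allI impI, unfold mem_Collect_eq)
    fix S T and s t :: real
    assume "solvable \<beta> S" "solvable \<beta> T" and st: "0 \<le> s" "0 \<le> t" "s + t = 1"
    then obtain v w where v: "\<And>g. v - \<rho> (g, 0) v = \<beta> (g, 0) - S (\<beta> (g, 0))"
      and w: "\<And>g. w - \<rho> (g, 0) w = \<beta> (g, 0) - T (\<beta> (g, 0))"
      unfolding solvable_def by blast
    have "(s *\<^sub>R v + t *\<^sub>R w) - \<rho> (g, 0) (s *\<^sub>R v + t *\<^sub>R w) =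
        \<beta> (g, 0) - (s *\<^sub>R S + t *\<^sub>R T) (\<beta> (g, 0))" for g
    proof -
      have "(s *\<^sub>R v + t *\<^sub>R w) - \<rho> (g, 0) (s *\<^sub>R v + t *\<^sub>R w) =
          s *\<^sub>R (v - \<rho> (g, 0) v) + t *\<^sub>R (w - \<rho> (g, 0) w)"
        by (simp add: action_vec_add action_vec_scaleR algebra_simps)
      also have "\<dots> = (s + t) *\<^sub>R \<beta> (g, 0) - (s *\<^sub>R S + t *\<^sub>R T) (\<beta> (g, 0))"
        unfolding v w by (simp add: algebra_simps)
      finally show ?thesis using st by simp
    qed
    then show "solvable \<beta> (s *\<^sub>R S + t *\<^sub>R T)" unfolding solvable_def by blast
  qed
  then have "convex hull (range (\<lambda>h. \<rho> (0, h))) \<subseteq> {T. solvable \<beta> T}"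
    using crossed_hom_exchange[OF \<beta>] by (intro hull_minimal) (auto simp: solvable_def)
  then show ?thesis using T by blast
qed

text \<open>A solution for \<open>S\<close> solves the equation for \<open>T\<close> up to the error
  of \<open>S\<close> against \<open>T\<close> at \<open>\<beta> (g, 0)\<close>, which is small for
  \<open>g\<close> in \<open>insert g0 K0\<close> since these values form a compact set.
  \<open>exact_solution\<close> removes the error.\<close>

lemma solvable_limit:
  assumes \<beta>: "\<beta> \<in> crossed_homs W \<rho>"
    and approx: "\<And>L \<delta>. compact L \<Longrightarrow> 0 < \<delta> \<Longrightarrow> \<exists>S. solvable \<beta> S \<and> (\<forall>v\<in>L. norm (S v - T v) < \<delta>)"
  shows "solvable \<beta> T"
  unfolding solvable_def
proof (rule gap1.exact_solution)
  fix g0 and \<delta> :: real assume \<delta>: "0 < \<delta>"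
  have "compact ((\<lambda>g. \<beta> (g, 0)) ` insert g0 K0)"
    using gap1.compact_K0
    by (intro compact_continuous_image compact_insert continuous_on_compose2[OF crossed_homsD(1)[OF \<beta>]] continuous_intros) auto
  then obtain S w where S: "\<forall>v\<in>(\<lambda>g. \<beta> (g, 0)) ` insert g0 K0. norm (S v - T v) < \<delta>"
    and w: "\<And>g. w - \<rho> (g, 0) w = \<beta> (g, 0) - S (\<beta> (g, 0))"
    using approx[OF _ \<delta>] unfolding solvable_def by meson
  have "norm (w - \<rho> (g, 0) w - (\<beta> (g, 0) - T (\<beta> (g, 0)))) \<le> \<delta>" if "g \<in> insert g0 K0" for g
    using S that unfolding w by (force simp: norm_minus_commute)
  then show "\<exists>w. \<forall>g\<in>insert g0 K0. norm (w - \<rho> (g, 0) w - (\<beta> (g, 0) - T (\<beta> (g, 0)))) \<le> \<delta>" by blast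
qed

text \<open>With \<open>P = M2.P\<close>, the right-hand side for \<open>Suc n\<close> is
  \<open>(\<beta> - (P ^^ n) \<beta>) + (P ^^ n) (\<beta> - P \<beta>)\<close>. As \<open>P\<close>
  commutes with the first factor, \<open>(P ^^ n) v\<close> solves the equation for the second
  summand.\<close>

lemma solvable_avg_pow:
  assumes \<beta>: "\<beta> \<in> crossed_homs W \<rho>"
  shows "solvable \<beta> (M2.P ^^ n)"
proof (induction n)
  case 0
  show ?case unfolding solvable_def by (intro exI[of _ 0]) (simp add: action_vec_0)
next
  case (Suc n)
  have "solvable \<beta> M2.P"
    using M2.avg_approx_compact solvable_convex_hull[OF \<beta>] by (intro solvable_limit[OF \<beta>]) blast
  then obtain v where v: "\<And>g. v - \<rho> (g, 0) v = \<beta> (g, 0) - M2.P (\<beta> (g, 0))"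
    unfolding solvable_def by blast
  obtain w where w: "\<And>g. w - \<rho> (g, 0) w = \<beta> (g, 0) - (M2.P ^^ n) (\<beta> (g, 0))"
    using Suc unfolding solvable_def by blast
  have comm: "\<rho> (g, 0) ((M2.P ^^ n) u) = (M2.P ^^ n) (\<rho> (g, 0) u)" for g u
    by (induction n) (auto simp flip: avg_2_action_1)
  have "(w + (M2.P ^^ n) v) - \<rho> (g, 0) (w + (M2.P ^^ n) v) = \<beta> (g, 0) - (M2.P ^^ Suc n) (\<beta> (g, 0))" for g
  proof -
    have "(w + (M2.P ^^ n) v) - \<rho> (g, 0) (w + (M2.P ^^ n) v) =
        (w - \<rho> (g, 0) w) + (M2.P ^^ n) (v - \<rho> (g, 0) v)"
      by (simp add: action_vec_add comm linear_diff[OF M2.avg_pow_linear])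
    then show ?thesis
      unfolding v w by (simp add: linear_diff[OF M2.avg_pow_linear] funpow_swap1)
  qed
  then show ?case unfolding solvable_def by blast
qed

lemma solvable_cesaro:
  assumes \<beta>: "\<beta> \<in> crossed_homs W \<rho>" and n: "0 < n"
  shows "solvable \<beta> (M2.cesaro n)"
proof -
  obtain w where w: "\<And>i g. w i - \<rho> (g, 0) (w i) = \<beta> (g, 0) - (M2.P ^^ i) (\<beta> (g, 0))"
    using solvable_avg_pow[OF \<beta>] unfolding solvable_def by metis
  define u where "u = (1 / real n) *\<^sub>R (\<Sum>i<n. w i)"
  have "u - \<rho> (g, 0) u = \<beta> (g, 0) - M2.cesaro n (\<beta> (g, 0))" for g
  proof -
    have "u - \<rho> (g, 0) u = (1 / real n) *\<^sub>R (\<Sum>i<n. w i - \<rho> (g, 0) (w i))"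
      by (simp add: u_def action_vec_scaleR linear_sum[OF action_linear] sum_subtractf scaleR_diff_right)
    then show ?thesis
      using n by (simp add: w M2.cesaro_def sum_subtractf scaleR_diff_right sum_constant_scaleR)
  qed
  then show ?thesis unfolding solvable_def by blast
qed

lemma solvable_mean:
  assumes \<beta>: "\<beta> \<in> crossed_homs W \<rho>"
  shows "solvable \<beta> M2.E"
proof (rule solvable_limit[OF \<beta>])
  fix L :: "'v set" and \<delta> :: real assume "compact L" "0 < \<delta>"
  from M2.cesaro_approx_compact[OF this]
  show "\<exists>S. solvable \<beta> S \<and> (\<forall>v\<in>L. norm (S v - M2.E v) < \<delta>)"
    using solvable_cesaro[OF \<beta>] by blast
qed

end

section \<open>Cohomology in terms of crossed homomorphisms\<close>

lemma topspace_tuples: "topspace (tuples n) = {..<n} \<rightarrow>\<^sub>E UNIV"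
  by (simp add: tuples_def)

lemma continuous_map_tuples_nth: "i < n \<Longrightarrow> continuous_map (tuples n) euclidean (\<lambda>x. x i)"
  unfolding tuples_def by (rule continuous_map_product_projection) simp

lemma cochains_continuous:
  "f \<in> cochains n W \<Longrightarrow> continuous_map (tuples n) (top_of_set W) f"
  by (simp add: cochains_def)

section \<open>The compact-open topology as uniform closeness on compact sets\<close>

lemma topspace_cochain_topology: "topspace (cochain_topology n W) = cochains n W"
proof
  show "topspace (cochain_topology n W) \<subseteq> cochains n W"
    by (auto simp: cochain_topology_def)
  \<comment> \<open>With \<open>K\<close> and \<open>U\<close> empty, the subbasic set consists of
    all cochains.\<close>
  have "cochains n W \<in> {{f \<in> cochains n W. f ` K \<subseteq> U} |K U. compactin (tuples n) K \<and> openin (top_of_set W) U}"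
    by (rule CollectI, rule exI[of _ "{}"], rule exI[of _ "{}"]) auto
  then show "cochains n W \<subseteq> topspace (cochain_topology n W)"
    by (auto simp: cochain_topology_def)
qed

text \<open>For a subbasic set, the image of \<open>K\<close> under \<open>f\<close> is compact
  inside an open set, which therefore contains a \<delta>-neighbourhood of it. Intersections take
  the union of the compact sets and the smaller radius.\<close>

lemma openin_cochain_topologyD:
  assumes "openin (cochain_topology n W) T" "f \<in> T"
  obtains K \<delta> where "compactin (tuples n) K" "0 < \<delta>"
    "\<And>f'. f' \<in> cochains n W \<Longrightarrow> (\<And>x. x \<in> K \<Longrightarrow> norm (f' x - f x) < \<delta>) \<Longrightarrow> f' \<in> T"
proof -
  have "generate_topology_on {{f \<in> cochains n W. f ` K \<subseteq> U} |K U.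
      compactin (tuples n) K \<and> openin (top_of_set W) U} T"
    using assms(1) by (simp add: cochain_topology_def openin_topology_generated_by_iff)
  then have "\<forall>f\<in>T. \<exists>K \<delta>. compactin (tuples n) K \<and> 0 < \<delta> \<and>
      (\<forall>f'\<in>cochains n W. (\<forall>x\<in>K. norm (f' x - f x) < \<delta>) \<longrightarrow> f' \<in> T)"
  proof (induction rule: generate_topology_on.induct)
    case (Int a b)
    show ?case
    proof
      fix f assume "f \<in> a \<inter> b"
      then obtain K \<delta> K' \<delta>' where *: "compactin (tuples n) K" "0 < \<delta>"
        "\<forall>f'\<in>cochains n W. (\<forall>x\<in>K. norm (f' x - f x) < \<delta>) \<longrightarrow> f' \<in> a"
        "compactin (tuples n) K'" "0 < \<delta>'"
        "\<forall>f'\<in>cochains n W. (\<forall>x\<in>K'. norm (f' x - f x) < \<delta>') \<longrightarrow> f' \<in> b"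
        using Int.IH by (metis IntE)
      show "\<exists>K \<delta>. compactin (tuples n) K \<and> 0 < \<delta> \<and>
          (\<forall>f'\<in>cochains n W. (\<forall>x\<in>K. norm (f' x - f x) < \<delta>) \<longrightarrow> f' \<in> a \<inter> b)"
        by (rule exI[of _ "K \<union> K'"], rule exI[of _ "min \<delta> \<delta>'"]) (use * in \<open>auto intro: compactin_Un\<close>)
    qed
  next
    case (UN \<K>)
    show ?case
    proof
      fix f assume "f \<in> \<Union>\<K>"
      then obtain s where s: "s \<in> \<K>" "f \<in> s" by blast
      then obtain K \<delta> where "compactin (tuples n) K" "0 < \<delta>"
        "\<forall>f'\<in>cochains n W. (\<forall>x\<in>K. norm (f' x - f x) < \<delta>) \<longrightarrow> f' \<in> s"
        using UN.IH by blast
      then show "\<exists>K \<delta>. compactin (tuples n) K \<and> 0 < \<delta> \<and>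
          (\<forall>f'\<in>cochains n W. (\<forall>x\<in>K. norm (f' x - f x) < \<delta>) \<longrightarrow> f' \<in> \<Union>\<K>)"
        using s(1) by blast
    qed
  next
    case (Basis s)
    then obtain K U where s: "s = {f \<in> cochains n W. f ` K \<subseteq> U}"
      and K: "compactin (tuples n) K" and U: "openin (top_of_set W) U" by blast
    obtain U' where U': "open U'" "U = W \<inter> U'" using U by (auto simp: openin_open)
    show ?case
    proof
      fix f assume f: "f \<in> s"
      have "compactin (top_of_set W) (f ` K)"
        using f by (intro image_compactin[OF K] cochains_continuous) (simp add: s)
      then have "compact (f ` K)" by (simp add: compactin_subtopology)
      moreover have "f ` K \<subseteq> U'" using f U'(2) by (auto simp: s)
      ultimately obtain \<delta> where \<delta>: "0 < \<delta>" "(\<Union>y\<in>f ` K. ball y \<delta>) \<subseteq> U'"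
        using U'(1) compact_subset_open_imp_ball_epsilon_subset by blast
      have "f' \<in> s" if f': "f' \<in> cochains n W" "\<forall>x\<in>K. norm (f' x - f x) < \<delta>" for f'
      proof -
        have "f' x \<in> U" if x: "x \<in> K" for x
        proof -
          have "f' x \<in> W"
            using cochains_continuous[OF f'(1)] compactin_subset_topspace[OF K] x
            by (auto simp: continuous_map_def Pi_iff)
          moreover have "f' x \<in> ball (f x) \<delta>"
            using f'(2) x by (simp add: dist_norm norm_minus_commute)
          ultimately show ?thesis using \<delta>(2) x U'(2) by blast
        qed
        then show ?thesis using f' by (auto simp: s)
      qed
      then show "\<exists>K \<delta>. compactin (tuples n) K \<and> 0 < \<delta> \<and>
          (\<forall>f'\<in>cochains n W. (\<forall>x\<in>K. norm (f' x - f x) < \<delta>) \<longrightarrow> f' \<in> s)"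
        using K \<delta>(1) by blast
    qed
  qed auto
  then show ?thesis using assms(2) that by blast
qed

text \<open>Finitely many preimages of \<delta> / 3-balls cover \<open>K\<close>; on each closed
  piece \<open>C x \<inter> K\<close> the cochain \<open>f'\<close> must stay within \<delta> / 2 of
  the centre \<open>f x\<close>, and the two errors add up to less than \<delta>. The pieces are
  closed because closed subsets of a compact set are compact without any separation axiom.\<close>

lemma cochain_topology_uniform_neighbourhood:
  assumes f: "f \<in> cochains n W" and K: "compactin (tuples n) K" and \<delta>: "0 < \<delta>"
  obtains T where "openin (cochain_topology n W) T" "f \<in> T"
    "\<And>f' x. f' \<in> T \<Longrightarrow> x \<in> K \<Longrightarrow> norm (f' x - f x) < \<delta>"
proof -
  have cont: "continuous_map (tuples n) euclidean f"
    using cochains_continuous[OF f] by (rule continuous_map_into_fulltopology)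
  define N where "N x = {y \<in> topspace (tuples n). f y \<in> ball (f x) (\<delta> / 3)}" for x
  define C where "C x = {y \<in> topspace (tuples n). f y \<in> cball (f x) (\<delta> / 3)}" for x
  have "openin (tuples n) (N x)" for x
    unfolding N_def using cont by (rule openin_continuous_map_preimage) simp
  moreover have "K \<subseteq> \<Union>(N ` K)"
    using compactin_subset_topspace[OF K] \<delta> by (auto simp: N_def)
  ultimately obtain \<F> where "finite \<F>" "\<F> \<subseteq> N ` K" "K \<subseteq> \<Union>\<F>"
    using compactinD[OF K, of "N ` K"] by blast
  then obtain F where F: "finite F" "F \<subseteq> K" "K \<subseteq> \<Union>(N ` F)"
    by (metis finite_subset_image)
  have "closedin (tuples n) (C x)" for x
    unfolding C_def using cont by (rule closedin_continuous_map_preimage) simp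
  then have comp: "compactin (tuples n) (C x \<inter> K)" for x
    using K by (rule closed_Int_compactin)
  define B where "B x = {f' \<in> cochains n W. f' ` (C x \<inter> K) \<subseteq> W \<inter> ball (f x) (\<delta> / 2)}" for x
  have "openin (cochain_topology n W) (B x)" for x
  proof -
    have "openin (top_of_set W) (W \<inter> ball (f x) (\<delta> / 2))" by (rule openin_open_Int) simp
    then show ?thesis
      unfolding cochain_topology_def B_def using comp by (intro topology_generated_by_Basis) blast
  qed
  \<comment> \<open>If \<open>F\<close> is empty, the bare intersection is everything, hence the
    extra factor \<open>cochains n W\<close>.\<close>
  then have "openin (cochain_topology n W) ((\<Inter>x\<in>F. B x) \<inter> cochains n W)"
    using openin_INT[OF F(1), of "cochain_topology n W" B] by (simp add: topspace_cochain_topology)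
  moreover have "f \<in> B x" for x
  proof -
    have "f y \<in> W \<inter> ball (f x) (\<delta> / 2)" if "y \<in> C x \<inter> K" for y
    proof
      show "f y \<in> W"
        using cochains_continuous[OF f] that by (auto simp: C_def continuous_map_def Pi_iff)
      show "f y \<in> ball (f x) (\<delta> / 2)" using that \<delta> by (simp add: C_def)
    qed
    then show ?thesis using f by (auto simp: B_def)
  qed
  moreover have "norm (f' y - f y) < \<delta>" if f': "f' \<in> (\<Inter>x\<in>F. B x) \<inter> cochains n W" and y: "y \<in> K" for f' y
  proof -
    obtain x where x: "x \<in> F" "y \<in> N x" using F(3) y by blast
    then have "y \<in> C x \<inter> K" using y by (auto simp: N_def C_def)
    moreover have "f' ` (C x \<inter> K) \<subseteq> W \<inter> ball (f x) (\<delta> / 2)" using f' x(1) by (simp add: B_def)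
    ultimately have "f' y \<in> ball (f x) (\<delta> / 2)" by blast
    then show ?thesis
      using x(2) norm_triangle_ineq4[of "f' y - f x" "f y - f x"] \<delta>
      by (simp add: N_def dist_norm norm_minus_commute)
  qed
  ultimately show ?thesis using f that by blast
qed

section \<open>Degree one: pairs and crossed homomorphisms\<close>

definition two_tuple :: "'g \<Rightarrow> 'g \<Rightarrow> nat \<Rightarrow> 'g" where
  "two_tuple x y = (\<lambda>i\<in>{..<2}. if i = 0 then x else y)"

lemma two_tuple_in_tuples [simp]: "two_tuple x y \<in> topspace (tuples 2)"
  by (auto simp: topspace_tuples two_tuple_def)

lemma two_tuple_nth [simp]: "two_tuple x y 0 = x" "two_tuple x y (Suc 0) = y"
  by (auto simp: two_tuple_def)

lemma two_tuple_eta: "x \<in> topspace (tuples 2) \<Longrightarrow> two_tuple (x 0) (x 1) = x"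
  by (auto simp: topspace_tuples two_tuple_def fun_eq_iff restrict_def PiE_def extensional_def less_2_cases_iff)

lemma shift_two_tuple:
  fixes g :: "'g::plus"
  shows "(\<lambda>i\<in>{..<2}. g + two_tuple x y i) = two_tuple (g + x) (g + y)"
  by (auto simp: two_tuple_def fun_eq_iff restrict_def)

lemma continuous_map_two_tuple: "continuous_map euclidean (tuples 2) (two_tuple x)"
  unfolding tuples_def continuous_map_componentwise
proof (intro conjI ballI)
  show "two_tuple x ` topspace euclidean \<subseteq> extensional {..<2}"
    by (auto simp: two_tuple_def)
  show "continuous_map euclidean euclidean (\<lambda>y. two_tuple x y k)" if "k \<in> {..<2}" for k
    using that by (cases "k = 0") (auto simp: two_tuple_def)
qed

definition crossed_of :: "((nat \<Rightarrow> 'g::zero) \<Rightarrow> 'v) \<Rightarrow> 'g \<Rightarrow> 'v" where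
  "crossed_of b g = b (two_tuple 0 g)"

text \<open>For a crossed homomorphism, \<open>\<beta> y - \<beta> x\<close> equals
  \<open>\<rho> x (\<beta> (- x + y))\<close>, the invariant cochain extending
  \<open>\<beta> g\<close> from the pairs (0, g). The difference form does not mention the action
  and is insensitive to adding constants to \<beta>.\<close>

definition cocycle_of :: "('g::topological_space \<Rightarrow> 'v::ab_group_add) \<Rightarrow> (nat \<Rightarrow> 'g) \<Rightarrow> 'v" where
  "cocycle_of \<beta> x = (if x \<in> topspace (tuples 2) then \<beta> (x 1) - \<beta> (x 0) else 0)"

lemma crossed_of_cocycle_of: "crossed_of (cocycle_of \<beta>) g = \<beta> g - \<beta> 0"
  by (simp add: crossed_of_def cocycle_of_def)

text \<open>This is the coboundary at the triple (z, x, y). For z = 0 it recovers a cocycle from its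
  values at the pairs (0, g).\<close>

lemma cocycle_relation:
  fixes b :: "(nat \<Rightarrow> 'g::topological_group_add) \<Rightarrow> 'v::banach"
  assumes b: "coboundary 2 b = (\<lambda>_. 0)"
  shows "b (two_tuple x y) = b (two_tuple z y) - b (two_tuple z x)"
proof -
  define t where "t = (\<lambda>i\<in>{..<3::nat}. if i = 0 then z else if i = 1 then x else y)"
  have t: "t \<in> topspace (tuples 3)" by (auto simp: t_def topspace_tuples)
  have om: "omit 2 0 t = two_tuple x y" "omit 2 1 t = two_tuple z y" "omit 2 2 t = two_tuple z x"
    by (auto simp: omit_def t_def two_tuple_def fun_eq_iff restrict_def)
  have "{..2::nat} = {0, 1, 2}" by auto
  then have "coboundary 2 b t = b (two_tuple x y) - b (two_tuple z y) + b (two_tuple z x)"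
    using t by (simp add: coboundary_def om[unfolded One_nat_def])
  then show ?thesis by (simp add: b algebra_simps)
qed

lemma cocycles_imp_crossed_of:
  assumes b: "b \<in> cocycles 1 W \<rho>"
  shows "crossed_of b \<in> crossed_homs W \<rho>" "cocycle_of (crossed_of b) = b"
proof -
  have b2: "b \<in> cochains 2 W" "\<And>g x. x \<in> topspace (tuples 2) \<Longrightarrow> b (\<lambda>i\<in>{..<2}. g + x i) = \<rho> g (b x)"
    and cob: "coboundary 2 b = (\<lambda>_. 0)"
    using b by (auto simp: cocycles_def invariant_cochains_def numeral_2_eq_2)
  note rel = cocycle_relation[OF cob]
  have "b (two_tuple g (g + h)) = \<rho> g (b (two_tuple 0 h))" for g h
    using b2(2)[of "two_tuple 0 h" g] by (simp add: shift_two_tuple)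
  then have "crossed_of b (g + h) = crossed_of b g + \<rho> g (crossed_of b h)" for g h
    using rel[of g "g + h" 0] by (simp add: crossed_of_def)
  moreover have "continuous_map euclidean (top_of_set W) (\<lambda>g. b (two_tuple 0 g))"
    using continuous_map_compose[OF continuous_map_two_tuple cochains_continuous[OF b2(1)]]
    by (simp add: o_def)
  ultimately show "crossed_of b \<in> crossed_homs W \<rho>"
    by (auto simp: crossed_homs_def crossed_of_def[abs_def] continuous_map_in_subtopology)
  show "cocycle_of (crossed_of b) = b"
  proof
    fix x
    show "cocycle_of (crossed_of b) x = b x"
    proof (cases "x \<in> topspace (tuples 2)")
      case True
      then show ?thesis
        using rel[of "x 0" "x 1" 0] two_tuple_eta[OF True] by (simp add: cocycle_of_def crossed_of_def)
    next
      case False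
      then show ?thesis using b2(1) by (simp add: cocycle_of_def cochains_def)
    qed
  qed
qed

text \<open>The action stays defined on the whole Banach space and \<open>W\<close> is merely an
  invariant subspace, so one locale covers the coefficients \<open>UNIV\<close>, \<open>V2\<close>
  and \<open>V1\<close>.\<close>

locale coefficient_module = bounded_module smul \<rho>
  for smul :: "'k::{real_normed_field, euclidean_space} \<Rightarrow> 'v::banach \<Rightarrow> 'v"
    and \<rho> :: "'g::topological_group_add \<Rightarrow> 'v \<Rightarrow> 'v" +
  fixes W :: "'v set"
  assumes strongly_continuous: "strongly_operator_continuous \<rho>"
    and W_0: "0 \<in> W" and W_add: "\<And>v w. v \<in> W \<Longrightarrow> w \<in> W \<Longrightarrow> v + w \<in> W"
    and W_smul: "\<And>a v. v \<in> W \<Longrightarrow> smul a v \<in> W"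
    and W_invariant: "\<And>g v. v \<in> W \<Longrightarrow> \<rho> g v \<in> W"
begin

abbreviation "CH \<equiv> crossed_homs W \<rho>"

lemma W_diff: "v \<in> W \<Longrightarrow> w \<in> W \<Longrightarrow> v - w \<in> W"
  using W_add[of v "smul (- 1) w"] W_smul[of w "- 1"] by simp

lemma crossed_hom_0: "\<beta> \<in> CH \<Longrightarrow> \<beta> 0 = 0"
  using crossed_homsD(3)[of \<beta> W \<rho> 0 0] by simp

lemma crossed_hom_add:
  assumes "\<beta> \<in> CH" "\<gamma> \<in> CH"
  shows "(\<lambda>g. \<beta> g + \<gamma> g) \<in> CH"
  using assms by (auto simp: crossed_homs_def W_add action_vec_add image_subset_iff intro!: continuous_intros)

lemma crossed_hom_diff:
  assumes "\<beta> \<in> CH" "\<gamma> \<in> CH"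
  shows "(\<lambda>g. \<beta> g - \<gamma> g) \<in> CH"
  using assms by (auto simp: crossed_homs_def W_diff action_vec_diff image_subset_iff intro!: continuous_intros)

lemma crossed_hom_smul:
  assumes "\<beta> \<in> CH"
  shows "(\<lambda>g. smul a (\<beta> g)) \<in> CH"
  using assms bounded_linear.continuous_on[OF bounded_linear_scale]
  by (auto simp: crossed_homs_def W_smul action_smul scale_right_distrib image_subset_iff)

lemma inner_crossed_hom:
  assumes "v \<in> W"
  shows "(\<lambda>g. \<rho> g v - v) \<in> CH"
  using assms strongly_continuous
  by (auto simp: crossed_homs_def W_diff W_invariant action_add action_vec_diff
      strongly_operator_continuous_def image_subset_iff intro!: continuous_intros)

lemma cocycle_of_in_cocycles:
  assumes \<beta>: "\<beta> \<in> CH"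
  shows "cocycle_of \<beta> \<in> cocycles 1 W \<rho>"
proof -
  have \<beta>_cont: "continuous_map euclidean euclidean \<beta>" using crossed_homsD(1)[OF \<beta>] by simp
  have cont: "continuous_map (tuples 2) euclidean (\<lambda>x. \<beta> (x i))" if "i < 2" for i
    using continuous_map_compose[OF continuous_map_tuples_nth[OF that] \<beta>_cont] by (simp add: o_def)
  have "continuous_map (tuples 2) euclidean (\<lambda>x. \<beta> (x 1) - \<beta> (x 0))"
    by (intro continuous_map_diff cont) auto
  then have "continuous_map (tuples 2) euclidean (cocycle_of \<beta>)"
    by (rule continuous_map_eq) (simp add: cocycle_of_def)
  then have "cocycle_of \<beta> \<in> cochains 2 W"
    using crossed_homsD(2)[OF \<beta>] W_diff W_0
    by (auto simp: cochains_def continuous_map_in_subtopology cocycle_of_def)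
  moreover have "cocycle_of \<beta> (\<lambda>i\<in>{..<2}. g + x i) = \<rho> g (cocycle_of \<beta> x)"
    if "x \<in> topspace (tuples 2)" for g x
  proof -
    have "(\<lambda>i\<in>{..<2}. g + x i) \<in> topspace (tuples 2)" by (simp add: topspace_tuples)
    then show ?thesis
      using that by (simp add: cocycle_of_def crossed_homsD(3)[OF \<beta>] action_vec_diff)
  qed
  moreover have "coboundary 2 (cocycle_of \<beta>) = (\<lambda>_. 0)"
  proof
    fix x :: "nat \<Rightarrow> 'g"
    have "{..2::nat} = {0, 1, 2}" by auto
    moreover have "omit 2 i x \<in> topspace (tuples 2)" for i
      by (simp add: omit_def topspace_tuples)
    ultimately show "coboundary 2 (cocycle_of \<beta>) x = 0"
      by (simp add: coboundary_def cocycle_of_def omit_def)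
  qed
  ultimately show ?thesis by (simp add: cocycles_def invariant_cochains_def numeral_2_eq_2)
qed

lemma cocycles_eq: "cocycles 1 W \<rho> = cocycle_of ` CH"
  using cocycles_imp_crossed_of[of _ W \<rho>] cocycle_of_in_cocycles by force

text \<open>An invariant cochain in one variable is determined by its value \<open>v\<close> at 0,
  being \<open>\<rho> g v\<close> at \<open>g\<close>. Subtracting \<open>v\<close> makes this a
  crossed homomorphism, and \<open>cocycle_of\<close> does not notice the constant.\<close>

lemma coboundaries_eq: "coboundaries 1 W \<rho> = (\<lambda>v. cocycle_of (\<lambda>g. \<rho> g v - v)) ` W"
proof -
  define single where "single g = (\<lambda>i\<in>{..<1::nat}. g)" for g :: 'g
  have single: "single g \<in> topspace (tuples 1)" "single g 0 = g" for g
    by (auto simp: single_def topspace_tuples)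
  have single_eta: "single (x 0) = x" if "x \<in> topspace (tuples 1)" for x
    using that by (auto simp: topspace_tuples single_def fun_eq_iff restrict_def PiE_def extensional_def)
  have om: "omit 1 0 x = single (x 1)" "omit 1 1 x = single (x 0)" for x
    by (auto simp: omit_def single_def fun_eq_iff restrict_def)
  have cob: "coboundary 1 f = cocycle_of (\<lambda>g. f (single g))" for f :: "(nat \<Rightarrow> 'g) \<Rightarrow> 'v"
  proof
    fix x
    have "{..1::nat} = {0, 1}" by auto
    then show "coboundary 1 f x = cocycle_of (\<lambda>g. f (single g)) x"
      by (simp add: coboundary_def cocycle_of_def om[unfolded One_nat_def] numeral_2_eq_2)
  qed
  show ?thesis
  proof
    show "coboundaries 1 W \<rho> \<subseteq> (\<lambda>v. cocycle_of (\<lambda>g. \<rho> g v - v)) ` W"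
    proof
      fix d assume "d \<in> coboundaries 1 W \<rho>"
      then obtain f where f: "f \<in> invariant_cochains 1 W \<rho>" "d = coboundary 1 f"
        by (auto simp: coboundaries_def)
      define v where "v = f (single 0)"
      have "f (single g) = \<rho> g v" for g
      proof -
        have "f (\<lambda>i\<in>{..<1}. g + single 0 i) = \<rho> g (f (single 0))"
          using f(1) single(1) unfolding invariant_cochains_def by blast
        moreover have "(\<lambda>i\<in>{..<1}. g + single 0 i) = single g"
          by (auto simp: single_def fun_eq_iff restrict_def)
        ultimately show ?thesis by (simp add: v_def)
      qed
      then have "d = cocycle_of (\<lambda>g. \<rho> g v)" using f(2) by (simp only: cob)
      then have "d = cocycle_of (\<lambda>g. \<rho> g v - v)" by (auto simp: cocycle_of_def fun_eq_iff)
      moreover have "v \<in> W"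
        using f(1) single(1)[of 0] unfolding v_def invariant_cochains_def cochains_def
        by (auto simp: continuous_map_def Pi_iff)
      ultimately show "d \<in> (\<lambda>v. cocycle_of (\<lambda>g. \<rho> g v - v)) ` W" by blast
    qed
    show "(\<lambda>v. cocycle_of (\<lambda>g. \<rho> g v - v)) ` W \<subseteq> coboundaries 1 W \<rho>"
    proof
      fix d assume "d \<in> (\<lambda>v. cocycle_of (\<lambda>g. \<rho> g v - v)) ` W"
      then obtain v where v: "v \<in> W" "d = cocycle_of (\<lambda>g. \<rho> g v - v)" by blast
      define f where "f x = (if x \<in> topspace (tuples 1) then \<rho> (x 0) v else 0)" for x
      have cont: "continuous_map euclidean euclidean (\<lambda>g. \<rho> g v)"
        using strongly_continuous by (simp add: strongly_operator_continuous_def)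
      have "continuous_map (tuples 1) euclidean (\<lambda>x. \<rho> (x 0) v)"
        using continuous_map_compose[OF continuous_map_tuples_nth cont, of 0 1] by (simp add: o_def)
      then have "continuous_map (tuples 1) euclidean f"
        by (rule continuous_map_eq) (simp add: f_def)
      then have "f \<in> cochains 1 W"
        using v(1) W_invariant W_0 by (auto simp: cochains_def continuous_map_in_subtopology f_def)
      moreover have "(\<lambda>i\<in>{..<1}. g + x i) \<in> topspace (tuples 1)" for g :: 'g and x
        by (simp add: topspace_tuples)
      ultimately have "f \<in> invariant_cochains 1 W \<rho>"
        by (auto simp: invariant_cochains_def f_def action_add)
      moreover have "f (single g) = \<rho> g v" for g by (simp only: f_def single if_True)
      then have "coboundary 1 f = d"
        unfolding cob v(2) by (auto simp: cocycle_of_def fun_eq_iff)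
      ultimately show "d \<in> coboundaries 1 W \<rho>" by (auto simp: coboundaries_def)
    qed
  qed
qed

definition cls :: "('g \<Rightarrow> 'v) \<Rightarrow> ((nat \<Rightarrow> 'g) \<Rightarrow> 'v) set" where
  "cls \<beta> = cohomology_class 1 W \<rho> (cocycle_of \<beta>)"

lemma cls_altdef: "cls \<beta> = (\<lambda>v. cocycle_of (\<lambda>g. \<beta> g + (\<rho> g v - v))) ` W"
proof -
  have eq: "(\<lambda>x. cocycle_of \<beta> x + cocycle_of (\<lambda>g. \<rho> g v - v) x) = cocycle_of (\<lambda>g. \<beta> g + (\<rho> g v - v))" for v
    by (auto simp: cocycle_of_def fun_eq_iff)
  show ?thesis
    unfolding cls_def cohomology_class_def coboundaries_eq setcompr_eq_image Collect_mem_eq image_image eq ..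
qed

lemma cls_eq_iff:
  assumes \<beta>: "\<beta> \<in> CH" "\<beta>' \<in> CH"
  shows "cls \<beta> = cls \<beta>' \<longleftrightarrow> (\<exists>v\<in>W. \<forall>g. \<beta>' g = \<beta> g + (\<rho> g v - v))"
proof
  assume eq: "cls \<beta> = cls \<beta>'"
  have "cocycle_of \<beta>' \<in> cls \<beta>'"
    unfolding cls_altdef using W_0 by (intro image_eqI[of _ _ 0]) (auto simp: action_vec_0)
  then obtain v where v: "v \<in> W" "cocycle_of \<beta>' = cocycle_of (\<lambda>g. \<beta> g + (\<rho> g v - v))"
    unfolding eq[symmetric] unfolding cls_altdef by (rule imageE)
  \<comment> \<open>\<open>cocycle_of\<close> determines a function only up to a constant, but both
    sides vanish at 0.\<close>
  have "\<beta>' g = \<beta> g + (\<rho> g v - v)" for g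
    using arg_cong[OF v(2), of "\<lambda>b. crossed_of b g"] crossed_hom_0[OF \<beta>(1)] crossed_hom_0[OF \<beta>(2)]
    by (simp add: crossed_of_cocycle_of)
  then show "\<exists>v\<in>W. \<forall>g. \<beta>' g = \<beta> g + (\<rho> g v - v)" using v(1) by blast
next
  assume "\<exists>v\<in>W. \<forall>g. \<beta>' g = \<beta> g + (\<rho> g v - v)"
  then obtain v where v: "v \<in> W" "\<beta>' = (\<lambda>g. \<beta> g + (\<rho> g v - v))" by blast
  have 1: "(\<lambda>g. \<beta>' g + (\<rho> g u - u)) = (\<lambda>g. \<beta> g + (\<rho> g (v + u) - (v + u)))" for u
    by (auto simp: v(2) action_vec_add fun_eq_iff)
  have 2: "(\<lambda>g. \<beta> g + (\<rho> g u - u)) = (\<lambda>g. \<beta>' g + (\<rho> g (u - v) - (u - v)))" for u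
    by (auto simp: v(2) action_vec_diff fun_eq_iff)
  show "cls \<beta> = cls \<beta>'"
  proof
    show "cls \<beta>' \<subseteq> cls \<beta>" unfolding cls_altdef 1 using v(1) W_add by blast
    show "cls \<beta> \<subseteq> cls \<beta>'" unfolding cls_altdef 2 using v(1) W_diff by blast
  qed
qed

section \<open>The cohomology space and its topology\<close>

abbreviation "H \<equiv> cohomology smul 1 W \<rho>"

lemma topspace_cocycle_subtopology:
  "topspace (subtopology (cochain_topology (1 + 1) W) (cocycles 1 W \<rho>)) = cocycles 1 W \<rho>"
  by (auto simp: topspace_cochain_topology cocycles_def invariant_cochains_def)

lemma carrier_cohomology: "tvs_carrier H = cls ` CH"
  unfolding cohomology_def tvs.simps topspace_quotient_topology topspace_cocycle_subtopology
  unfolding cocycles_eq image_image cls_def ..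

lemma add_cohomology: "tvs_add H (cls \<beta>) (cls \<gamma>) = cls (\<lambda>g. \<beta> g + \<gamma> g)"
proof
  have eq: "(\<lambda>x. cocycle_of (\<lambda>g. \<beta> g + (\<rho> g u - u)) x + cocycle_of (\<lambda>g. \<gamma> g + (\<rho> g v - v)) x) =
      cocycle_of (\<lambda>g. (\<beta> g + \<gamma> g) + (\<rho> g (u + v) - (u + v)))" for u v
    by (auto simp: cocycle_of_def fun_eq_iff action_vec_add)
  show "tvs_add H (cls \<beta>) (cls \<gamma>) \<subseteq> cls (\<lambda>g. \<beta> g + \<gamma> g)"
    unfolding cohomology_def tvs.simps cls_altdef using eq W_add by blast
  show "cls (\<lambda>g. \<beta> g + \<gamma> g) \<subseteq> tvs_add H (cls \<beta>) (cls \<gamma>)"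
  proof
    fix b assume "b \<in> cls (\<lambda>g. \<beta> g + \<gamma> g)"
    then obtain v where v: "v \<in> W" "b = cocycle_of (\<lambda>g. (\<beta> g + \<gamma> g) + (\<rho> g v - v))"
      unfolding cls_altdef by blast
    \<comment> \<open>The first summand takes the whole twist, the second takes 0.\<close>
    then have "b = (\<lambda>x. cocycle_of (\<lambda>g. \<beta> g + (\<rho> g v - v)) x + cocycle_of (\<lambda>g. \<gamma> g + (\<rho> g 0 - 0)) x)"
      using eq[of v 0] by simp
    then show "b \<in> tvs_add H (cls \<beta>) (cls \<gamma>)"
      unfolding cohomology_def tvs.simps cls_altdef using v(1) W_0 by blast
  qed
qed

lemma scale_cohomology: "tvs_scale H a (cls \<beta>) = cls (\<lambda>g. smul a (\<beta> g))"
proof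
  have eq: "(\<lambda>x. smul a (cocycle_of (\<lambda>g. \<beta> g + (\<rho> g u - u)) x) + cocycle_of (\<lambda>g. \<rho> g v - v) x) =
      cocycle_of (\<lambda>g. smul a (\<beta> g) + (\<rho> g (smul a u + v) - (smul a u + v)))" for u v
    by (auto simp: cocycle_of_def fun_eq_iff action_vec_add action_smul scale_right_distrib scale_right_diff_distrib)
  show "tvs_scale H a (cls \<beta>) \<subseteq> cls (\<lambda>g. smul a (\<beta> g))"
    unfolding cohomology_def tvs.simps cls_altdef coboundaries_eq using eq W_add W_smul by blast
  show "cls (\<lambda>g. smul a (\<beta> g)) \<subseteq> tvs_scale H a (cls \<beta>)"
  proof
    fix b assume "b \<in> cls (\<lambda>g. smul a (\<beta> g))"
    then obtain v where v: "v \<in> W" "b = cocycle_of (\<lambda>g. smul a (\<beta> g) + (\<rho> g v - v))"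
      unfolding cls_altdef by blast
    \<comment> \<open>The twist is placed in the coboundary summand, so that \<open>a = 0\<close> is
      covered as well.\<close>
    then have "b = (\<lambda>x. smul a (cocycle_of (\<lambda>g. \<beta> g + (\<rho> g 0 - 0)) x) + cocycle_of (\<lambda>g. \<rho> g v - v) x)"
      using eq[of 0 v] by simp
    then show "b \<in> tvs_scale H a (cls \<beta>)"
      unfolding cohomology_def tvs.simps cls_altdef coboundaries_eq using v(1) W_0 by blast
  qed
qed

text \<open>Cochains are compared on compact sets of pairs, crossed homomorphisms on compact sets of
  the group. A compact set of pairs has two compact projections, and
  \<open>\<beta> (x 1) - \<beta> (x 0)\<close> spends half of \<delta> on each. Conversely
  \<open>g\<close> goes to the pair (0, g), where the cocycle has the value
  \<open>\<beta> g\<close>.\<close>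

lemma openin_cohomology:
  "openin (tvs_topology H) U \<longleftrightarrow> U \<subseteq> cls ` CH \<and>
     (\<forall>\<beta>\<in>CH. cls \<beta> \<in> U \<longrightarrow> (\<exists>K \<delta>. compact K \<and> 0 < \<delta> \<and>
        (\<forall>\<beta>'\<in>CH. (\<forall>g\<in>K. norm (\<beta>' g - \<beta> g) < \<delta>) \<longrightarrow> cls \<beta>' \<in> U)))"
    (is "_ \<longleftrightarrow> _ \<and> ?R")
proof -
  let ?X = "subtopology (cochain_topology (1 + 1) W) (cocycles 1 W \<rho>)"
  let ?Q = "{b \<in> cocycles 1 W \<rho>. cohomology_class 1 W \<rho> b \<in> U}"
  have "cohomology_class 1 W \<rho> ` cocycles 1 W \<rho> = cls ` CH"
    unfolding cocycles_eq image_image cls_def ..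
  then have "openin (tvs_topology H) U \<longleftrightarrow> U \<subseteq> cls ` CH \<and> openin ?X ?Q"
    unfolding cohomology_def tvs.simps openin_quotient_topology topspace_cocycle_subtopology by simp
  moreover have "openin ?X ?Q \<longleftrightarrow> ?R"
  proof
    assume "openin ?X ?Q"
    then obtain T where T: "openin (cochain_topology 2 W) T" "?Q = T \<inter> cocycles 1 W \<rho>"
      by (auto simp: openin_subtopology numeral_2_eq_2)
    show ?R
    proof (intro ballI impI)
      fix \<beta> assume \<beta>: "\<beta> \<in> CH" "cls \<beta> \<in> U"
      then have "cocycle_of \<beta> \<in> ?Q" using cocycle_of_in_cocycles by (simp add: cls_def)
      then have "cocycle_of \<beta> \<in> T" using T(2) by blast
      then obtain K \<delta> where K: "compactin (tuples 2) K" and \<delta>: "0 < \<delta>"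
        and near: "\<And>f'. f' \<in> cochains 2 W \<Longrightarrow> (\<And>x. x \<in> K \<Longrightarrow> norm (f' x - cocycle_of \<beta> x) < \<delta>) \<Longrightarrow> f' \<in> T"
        using openin_cochain_topologyD[OF T(1)] by metis
      have "compact ((\<lambda>x. x i) ` K)" if "i < 2" for i
        using image_compactin[OF K continuous_map_tuples_nth[OF that]] by simp
      then have "compact ((\<lambda>x. x 0) ` K \<union> (\<lambda>x. x 1) ` K)" by (intro compact_Un) auto
      moreover have "cls \<beta>' \<in> U"
        if \<beta>': "\<beta>' \<in> CH" "\<forall>g\<in>(\<lambda>x. x 0) ` K \<union> (\<lambda>x. x 1) ` K. norm (\<beta>' g - \<beta> g) < \<delta> / 2" for \<beta>'
      proof -
        have "norm (cocycle_of \<beta>' x - cocycle_of \<beta> x) < \<delta>" if x: "x \<in> K" for x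
        proof -
          have "x \<in> topspace (tuples 2)" using compactin_subset_topspace[OF K] x by blast
          then have eq: "cocycle_of \<beta>' x - cocycle_of \<beta> x = (\<beta>' (x 1) - \<beta> (x 1)) - (\<beta>' (x 0) - \<beta> (x 0))"
            by (simp add: cocycle_of_def)
          have "norm (\<beta>' (x 0) - \<beta> (x 0)) < \<delta> / 2" "norm (\<beta>' (x 1) - \<beta> (x 1)) < \<delta> / 2"
            using \<beta>'(2) x by blast+
          then show ?thesis
            unfolding eq using norm_triangle_ineq4[of "\<beta>' (x 1) - \<beta> (x 1)" "\<beta>' (x 0) - \<beta> (x 0)"] by linarith
        qed
        moreover have "cocycle_of \<beta>' \<in> cocycles 1 W \<rho>" using \<beta>'(1) by (rule cocycle_of_in_cocycles)
        moreover from this have "cocycle_of \<beta>' \<in> cochains 2 W"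
          by (auto simp: cocycles_def invariant_cochains_def numeral_2_eq_2)
        ultimately have "cocycle_of \<beta>' \<in> ?Q" using near T(2) by blast
        then show ?thesis by (simp add: cls_def)
      qed
      ultimately show "\<exists>K \<delta>. compact K \<and> 0 < \<delta> \<and>
          (\<forall>\<beta>'\<in>CH. (\<forall>g\<in>K. norm (\<beta>' g - \<beta> g) < \<delta>) \<longrightarrow> cls \<beta>' \<in> U)"
        using \<delta> half_gt_zero by blast
    qed
  next
    assume R: ?R
    show "openin ?X ?Q"
      unfolding openin_subopen[of ?X ?Q]
    proof
      fix b assume b: "b \<in> ?Q"
      then obtain \<beta> where \<beta>: "\<beta> \<in> CH" "b = cocycle_of \<beta>" unfolding cocycles_eq by blast
      then have "cls \<beta> \<in> U" using b by (simp add: cls_def)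
      then obtain K \<delta> where K: "compact K" "0 < \<delta>"
        and near: "\<forall>\<beta>'\<in>CH. (\<forall>g\<in>K. norm (\<beta>' g - \<beta> g) < \<delta>) \<longrightarrow> cls \<beta>' \<in> U"
        using bspec[OF R \<beta>(1)] by blast
      have K2: "compactin (tuples 2) (two_tuple 0 ` K)"
        using K(1) by (intro image_compactin[OF _ continuous_map_two_tuple]) simp
      have "b \<in> cochains 2 W" using b by (auto simp: cocycles_def invariant_cochains_def numeral_2_eq_2)
      then obtain T where T: "openin (cochain_topology 2 W) T" "b \<in> T"
        "\<And>f' x. f' \<in> T \<Longrightarrow> x \<in> two_tuple 0 ` K \<Longrightarrow> norm (f' x - b x) < \<delta>"
        using cochain_topology_uniform_neighbourhood[OF _ K2 K(2)] by metis
      have "T \<inter> cocycles 1 W \<rho> \<subseteq> ?Q"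
      proof
        fix b' assume b': "b' \<in> T \<inter> cocycles 1 W \<rho>"
        then obtain \<beta>' where \<beta>': "\<beta>' \<in> CH" "b' = cocycle_of \<beta>'" unfolding cocycles_eq by blast
        have "norm (\<beta>' g - \<beta> g) < \<delta>" if "g \<in> K" for g
          using T(3)[of b' "two_tuple 0 g"] b' that crossed_hom_0[OF \<beta>(1)] crossed_hom_0[OF \<beta>'(1)]
          by (simp add: \<beta>(2) \<beta>'(2) cocycle_of_def)
        then have "cohomology_class 1 W \<rho> b' \<in> U" using near \<beta>' unfolding cls_def by blast
        then show "b' \<in> ?Q" using b' by blast
      qed
      moreover have "openin ?X (T \<inter> cocycles 1 W \<rho>)"
        using T(1) by (auto simp: openin_subtopology numeral_2_eq_2)
      ultimately show "\<exists>T. openin ?X T \<and> b \<in> T \<and> T \<subseteq> ?Q" using T(2) b by blast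
    qed
  qed
  ultimately show ?thesis by blast
qed

end

text \<open>By the pointwise bound \<open>bd\<close>, a compact set \<open>K\<close> and a radius
  \<delta> for the target pull back to the image of \<open>K\<close> under \<iota> and to \<delta> /
  C. Both restriction maps have this form.\<close>

lemma continuous_map_cohomology:
  fixes f :: "((nat \<Rightarrow> 'g::topological_group_add) \<Rightarrow> 'v::banach) set \<Rightarrow> ((nat \<Rightarrow> 'h::topological_group_add) \<Rightarrow> 'v) set"
  assumes A: "coefficient_module smul \<rho> W" and B: "coefficient_module smul \<rho>' W'"
    and R: "\<And>\<beta>. \<beta> \<in> crossed_homs W \<rho> \<Longrightarrow> R \<beta> \<in> crossed_homs W' \<rho>'"
    and f: "\<And>\<beta>. \<beta> \<in> crossed_homs W \<rho> \<Longrightarrow>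
      f (coefficient_module.cls \<rho> W \<beta>) = coefficient_module.cls \<rho>' W' (R \<beta>)"
    and \<iota>: "continuous_on UNIV \<iota>" and C: "0 < C"
    and bd: "\<And>\<beta> \<beta>' g. norm (R \<beta>' g - R \<beta> g) \<le> C * norm (\<beta>' (\<iota> g) - \<beta> (\<iota> g))"
  shows "continuous_map (tvs_topology (cohomology smul 1 W \<rho>)) (tvs_topology (cohomology smul 1 W' \<rho>')) f"
proof -
  interpret A: coefficient_module smul \<rho> W by fact
  interpret B: coefficient_module smul \<rho>' W' by fact
  show ?thesis
    unfolding continuous_map_def
  proof (intro conjI allI impI)
    show "f \<in> tvs_carrier A.H \<rightarrow> tvs_carrier B.H"
      unfolding A.carrier_cohomology B.carrier_cohomology using R f by auto
    fix U assume U: "openin (tvs_topology B.H) U"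
    show "openin (tvs_topology A.H) {x \<in> tvs_carrier A.H. f x \<in> U}"
      unfolding A.openin_cohomology A.carrier_cohomology
    proof (intro conjI ballI impI)
      fix \<beta> assume \<beta>: "\<beta> \<in> A.CH" "A.cls \<beta> \<in> {x \<in> A.cls ` A.CH. f x \<in> U}"
      then have "B.cls (R \<beta>) \<in> U" using f by simp
      then obtain K \<delta> where K: "compact K" "0 < \<delta>"
        and near: "\<And>\<gamma>. \<gamma> \<in> B.CH \<Longrightarrow> (\<forall>g\<in>K. norm (\<gamma> g - R \<beta> g) < \<delta>) \<Longrightarrow> B.cls \<gamma> \<in> U"
        using U R[OF \<beta>(1)] unfolding B.openin_cohomology by meson
      have "compact (\<iota> ` K)"
        using K(1) continuous_on_subset[OF \<iota>] by (intro compact_continuous_image) auto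
      moreover have "A.cls \<beta>' \<in> {x \<in> A.cls ` A.CH. f x \<in> U}"
        if \<beta>': "\<beta>' \<in> A.CH" "\<forall>g\<in>\<iota> ` K. norm (\<beta>' g - \<beta> g) < \<delta> / C" for \<beta>'
      proof -
        have "norm (R \<beta>' g - R \<beta> g) < \<delta>" if "g \<in> K" for g
        proof -
          have "C * norm (\<beta>' (\<iota> g) - \<beta> (\<iota> g)) < \<delta>"
            using \<beta>'(2) that C by (simp add: field_simps)
          then show ?thesis using bd by (rule order_le_less_trans[rotated])
        qed
        then have "B.cls (R \<beta>') \<in> U" using near R \<beta>'(1) by blast
        then show ?thesis using \<beta>'(1) f by simp
      qed
      ultimately show "\<exists>K \<delta>. compact K \<and> 0 < \<delta> \<and>
          (\<forall>\<beta>'\<in>A.CH. (\<forall>g\<in>K. norm (\<beta>' g - \<beta> g) < \<delta>) \<longrightarrow>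
            A.cls \<beta>' \<in> {x \<in> A.cls ` A.CH. f x \<in> U})"
        using K(2) C by (intro exI[of _ "\<iota> ` K"] exI[of _ "\<delta> / C"]) auto
    qed auto
  qed
qed

text \<open>If an open \<open>T\<close> cuts out the first coordinates of the image of
  \<open>U\<close>, then by injectivity of the first component \<open>T \<times> topspace Z\<close>
  cuts out the image itself. The second component contributes only its continuity.\<close>

lemma embedding_map_if_fst_embedding:
  assumes cont: "continuous_map X (prod_topology Y Z) f" and emb: "embedding_map X Y (fst \<circ> f)"
  shows "embedding_map X (prod_topology Y Z) f"
  unfolding embedding_map_def
proof (rule bijective_open_imp_homeomorphic_map)
  let ?S = "subtopology (prod_topology Y Z) (f ` topspace X)"
  have f_in: "f x \<in> topspace Y \<times> topspace Z" if "x \<in> topspace X" for x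
    using cont that by (auto simp: continuous_map_def Pi_iff)
  have hom: "homeomorphic_map X (subtopology Y ((fst \<circ> f) ` topspace X)) (fst \<circ> f)"
    using emb by (simp add: embedding_map_def)
  have inj: "inj_on (fst \<circ> f) (topspace X)"
    using hom by (simp add: homeomorphic_eq_everything_map)
  show "continuous_map X ?S f" using cont by (simp add: continuous_map_in_subtopology)
  show "f ` topspace X = topspace ?S" using f_in by (simp add: Int_absorb1 image_subsetI)
  show "inj_on f (topspace X)" using inj by (rule inj_on_imageI2)
  show "open_map X ?S f"
    unfolding open_map_def
  proof (intro allI impI)
    fix U assume U: "openin X U"
    then have "openin (subtopology Y ((fst \<circ> f) ` topspace X)) ((fst \<circ> f) ` U)"
      using hom by (simp add: homeomorphic_eq_everything_map open_map_def)
    then obtain T where T: "openin Y T" "(fst \<circ> f) ` U = T \<inter> (fst \<circ> f) ` topspace X"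
      by (auto simp: openin_subtopology)
    have UX: "U \<subseteq> topspace X" using U by (rule openin_subset)
    have "f ` U = (T \<times> topspace Z) \<inter> f ` topspace X"
    proof
      show "f ` U \<subseteq> (T \<times> topspace Z) \<inter> f ` topspace X"
      proof
        fix y assume "y \<in> f ` U"
        then obtain x where x: "x \<in> U" "y = f x" by blast
        then have "(fst \<circ> f) x \<in> T" using T(2) by blast
        moreover have "x \<in> topspace X" using x UX by blast
        ultimately show "y \<in> (T \<times> topspace Z) \<inter> f ` topspace X"
          using f_in[of x] x(2) by (auto simp: mem_Times_iff)
      qed
      show "(T \<times> topspace Z) \<inter> f ` topspace X \<subseteq> f ` U"
      proof
        fix y assume y: "y \<in> (T \<times> topspace Z) \<inter> f ` topspace X"
        then obtain x where x: "x \<in> topspace X" "y = f x" by blast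
        then have "(fst \<circ> f) x \<in> (fst \<circ> f) ` U" using T(2) y by (auto simp: mem_Times_iff)
        then obtain u where "u \<in> U" "(fst \<circ> f) x = (fst \<circ> f) u" by blast
        then have "x \<in> U" using inj x(1) UX by (metis inj_onD subsetD)
        then show "y \<in> f ` U" using x(2) by blast
      qed
    qed
    moreover have "openin (prod_topology Y Z) (T \<times> topspace Z)"
      using T(1) by (simp add: openin_prod_Times_iff)
    ultimately show "openin ?S (f ` U)" by (auto simp: openin_subtopology)
  qed
qed

section \<open>The embedding\<close>

context product_module
begin

abbreviation "V1 \<equiv> stationary_vectors smul (\<lambda>g. \<rho> (g, 0)) \<mu>1"
abbreviation "V2 \<equiv> stationary_vectors smul (\<lambda>g. \<rho> (0, g)) \<mu>2"

lemma action_continuous: "continuous_on UNIV (\<lambda>g. \<rho> g v)"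
  using continuous by (simp add: strongly_operator_continuous_def)

sublocale C: coefficient_module smul \<rho> UNIV
  by unfold_locales (use continuous in auto)

sublocale C1: coefficient_module smul "\<lambda>g. \<rho> (g, 0)" V2
proof unfold_locales
  show "strongly_operator_continuous (\<lambda>g. \<rho> (g, 0))"
    unfolding strongly_operator_continuous_def
    by (intro allI continuous_on_compose2[OF action_continuous] continuous_intros) auto
  show "0 \<in> V2" using linear_0[OF M2.avg_linear] by (simp add: M2.stationary_iff)
qed (simp_all add: M2.stationary_iff M2.avg_add M2.avg_smul avg_2_action_1)

sublocale C2: coefficient_module smul "\<lambda>g. \<rho> (0, g)" V1
proof unfold_locales
  show "strongly_operator_continuous (\<lambda>g. \<rho> (0, g))"
    unfolding strongly_operator_continuous_def
    by (intro allI continuous_on_compose2[OF action_continuous] continuous_intros) auto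
  show "0 \<in> V1" using linear_0[OF M1.avg_linear] by (simp add: M1.stationary_iff)
qed (simp_all add: M1.stationary_iff M1.avg_add M1.avg_smul avg_1_action_2)

section \<open>Restriction to the two factors\<close>

definition R1 :: "('g1 \<times> 'g2 \<Rightarrow> 'v) \<Rightarrow> 'g1 \<Rightarrow> 'v" where "R1 \<beta> g = M2.E (\<beta> (g, 0))"
definition R2 :: "('g1 \<times> 'g2 \<Rightarrow> 'v) \<Rightarrow> 'g2 \<Rightarrow> 'v" where "R2 \<beta> g = M1.E (\<beta> (0, g))"

lemma R1_diff_bound: "norm (R1 \<beta>' g - R1 \<beta> g) \<le> M2.bound * norm (\<beta>' (g, 0) - \<beta> (g, 0))"
  using M2.norm_mean_le[of "\<beta>' (g, 0) - \<beta> (g, 0)"] by (simp add: R1_def M2.mean_diff)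

lemma R2_diff_bound: "norm (R2 \<beta>' g - R2 \<beta> g) \<le> M1.bound * norm (\<beta>' (0, g) - \<beta> (0, g))"
  using M1.norm_mean_le[of "\<beta>' (0, g) - \<beta> (0, g)"] by (simp add: R2_def M1.mean_diff)

lemma R1_crossed_hom:
  assumes \<beta>: "\<beta> \<in> C.CH"
  shows "R1 \<beta> \<in> C1.CH"
proof -
  have "continuous_on UNIV (R1 \<beta>)"
    unfolding R1_def[abs_def]
    by (intro bounded_linear.continuous_on[OF M2.mean_bounded_linear]
        continuous_on_compose2[OF crossed_homsD(1)[OF \<beta>]] continuous_intros) auto
  moreover have "R1 \<beta> (g + h) = R1 \<beta> g + \<rho> (g, 0) (R1 \<beta> h)" for g h
    using crossed_homsD(3)[OF \<beta>, of "(g, 0)" "(h, 0)"]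
    by (simp add: R1_def M2.mean_add mean_2_action_1)
  ultimately show ?thesis
    by (auto simp: crossed_homs_def R1_def M2.mean_in_stationary)
qed

lemma R2_crossed_hom:
  assumes \<beta>: "\<beta> \<in> C.CH"
  shows "R2 \<beta> \<in> C2.CH"
proof -
  have "continuous_on UNIV (R2 \<beta>)"
    unfolding R2_def[abs_def]
    by (intro bounded_linear.continuous_on[OF M1.mean_bounded_linear]
        continuous_on_compose2[OF crossed_homsD(1)[OF \<beta>]] continuous_intros) auto
  moreover have "R2 \<beta> (g + h) = R2 \<beta> g + \<rho> (0, g) (R2 \<beta> h)" for g h
    using crossed_homsD(3)[OF \<beta>, of "(0, g)" "(0, h)"]
    by (simp add: R2_def M1.mean_add mean_1_action_2)
  ultimately show ?thesis
    by (auto simp: crossed_homs_def R2_def M1.mean_in_stationary)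
qed

lemma restrict_cocycle_of_1:
  "restrict_cochain 2 M2.E (\<lambda>g. (g, 0)) (cocycle_of \<beta>) = cocycle_of (R1 \<beta>)"
  by (auto simp: restrict_cochain_def cocycle_of_def fun_eq_iff topspace_tuples R1_def M2.mean_diff)

lemma restrict_cocycle_of_2:
  "restrict_cochain 2 M1.E (\<lambda>g. (0, g)) (cocycle_of \<beta>) = cocycle_of (R2 \<beta>)"
  by (auto simp: restrict_cochain_def cocycle_of_def fun_eq_iff topspace_tuples R2_def M1.mean_diff)

text \<open>The projections commute with the action of the other factor, so a twist by
  \<open>v\<close> restricts to twists by \<open>M2.E v\<close> and \<open>M1.E v\<close>, which lie
  in the coefficient spaces.\<close>

lemma cls_R_cong:
  assumes \<beta>: "\<beta> \<in> C.CH" "\<beta>' \<in> C.CH" and eq: "C.cls \<beta> = C.cls \<beta>'"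
  shows "C1.cls (R1 \<beta>) = C1.cls (R1 \<beta>')" "C2.cls (R2 \<beta>) = C2.cls (R2 \<beta>')"
proof -
  obtain v where v: "\<And>g. \<beta>' g = \<beta> g + (\<rho> g v - v)" using eq C.cls_eq_iff[OF \<beta>] by blast
  have "R1 \<beta>' g = R1 \<beta> g + (\<rho> (g, 0) (M2.E v) - M2.E v)" for g
    by (simp add: R1_def v M2.mean_add M2.mean_diff mean_2_action_1)
  then show "C1.cls (R1 \<beta>) = C1.cls (R1 \<beta>')"
    unfolding C1.cls_eq_iff[OF R1_crossed_hom[OF \<beta>(1)] R1_crossed_hom[OF \<beta>(2)]]
    using M2.mean_in_stationary by blast
  have "R2 \<beta>' g = R2 \<beta> g + (\<rho> (0, g) (M1.E v) - M1.E v)" for g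
    by (simp add: R2_def v M1.mean_add M1.mean_diff mean_1_action_2)
  then show "C2.cls (R2 \<beta>) = C2.cls (R2 \<beta>')"
    unfolding C2.cls_eq_iff[OF R2_crossed_hom[OF \<beta>(1)] R2_crossed_hom[OF \<beta>(2)]]
    using M1.mean_in_stationary by blast
qed

text \<open>On such representatives \<open>M2.E\<close> acts trivially along the first factor, so
  \<open>R1\<close> is plain restriction and closeness of \<open>R1\<close> images is closeness of
  the representatives there.\<close>

definition normalized :: "('g1 \<times> 'g2 \<Rightarrow> 'v) \<Rightarrow> bool" where
  "normalized \<beta> \<longleftrightarrow> \<beta> \<in> C.CH \<and> (\<forall>g. \<beta> (g, 0) \<in> V2)"

lemma normalizedD: "normalized \<beta> \<Longrightarrow> \<beta> \<in> C.CH" "normalized \<beta> \<Longrightarrow> R1 \<beta> = (\<lambda>g. \<beta> (g, 0))"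
  by (auto simp: normalized_def R1_def fun_eq_iff M2.stationary_iff M2.mean_fixed)

lemma normalize:
  assumes \<beta>: "\<beta> \<in> C.CH"
  obtains \<beta>' where "normalized \<beta>'" "C.cls \<beta>' = C.cls \<beta>"
proof -
  obtain w where w: "\<And>g. w - \<rho> (g, 0) w = \<beta> (g, 0) - M2.E (\<beta> (g, 0))"
    using solvable_mean[OF \<beta>] unfolding solvable_def by blast
  \<comment> \<open>\<open>w\<close> is found on the first factor only, but the twist is made on the
    whole product, so the class is kept.\<close>
  define \<beta>' where "\<beta>' = (\<lambda>g. \<beta> g + (\<rho> g w - w))"
  have \<beta>': "\<beta>' \<in> C.CH"
    unfolding \<beta>'_def by (intro C.crossed_hom_add \<beta> C.inner_crossed_hom) simp
  have "\<beta>' (g, 0) = M2.E (\<beta> (g, 0))" for g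
    using w[of g] by (simp add: \<beta>'_def algebra_simps)
  then have "normalized \<beta>'" using \<beta>' by (simp add: normalized_def M2.mean_in_stationary)
  moreover have "C.cls \<beta> = C.cls \<beta>'"
    unfolding C.cls_eq_iff[OF \<beta> \<beta>'] by (auto simp: \<beta>'_def)
  ultimately show ?thesis using that by simp
qed

text \<open>The constant comes from
  \<open>d (g1, g2) = d (g1, 0) + \<rho> (g1, 0) (d (0, g2))\<close>, with
  \<open>crossed_hom_2_bound\<close> for the last term.\<close>

definition M :: real where "M = 1 + bound * ((1 + bound) / \<epsilon>)"

lemma M_pos: "0 < M"
  using bound_pos gap1.\<epsilon>_pos by (simp add: M_def add_pos_pos)

lemma crossed_hom_bound:
  assumes d: "d \<in> C.CH" and r: "0 \<le> r" "\<And>h. h \<in> insert (fst g) K0 \<Longrightarrow> norm (d (h, 0)) \<le> r"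
  shows "norm (d g) \<le> M * r"
proof -
  obtain g1 g2 where g: "g = (g1, g2)" by (cases g)
  have "\<epsilon> * norm (d (0, g2)) \<le> (1 + bound) * r"
    using r by (intro crossed_hom_2_bound[OF d]) auto
  then have *: "norm (d (0, g2)) \<le> (1 + bound) / \<epsilon> * r"
    using gap1.\<epsilon>_pos by (simp add: field_simps)
  have "norm (d g) \<le> norm (d (g1, 0)) + norm (\<rho> (g1, 0) (d (0, g2)))"
    using crossed_homsD(3)[OF d, of "(g1, 0)" "(0, g2)"] by (simp add: g norm_triangle_ineq)
  also have "\<dots> \<le> r + bound * norm (d (0, g2))"
    using r(2)[of g1] norm_action_le by (intro add_mono) (simp_all add: g)
  also have "\<dots> \<le> r + bound * ((1 + bound) / \<epsilon> * r)"
    using * bound_pos by (intro add_left_mono mult_left_mono) auto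
  also have "\<dots> = M * r" by (simp add: M_def algebra_simps)
  finally show ?thesis .
qed

lemma normalized_twist:
  assumes "normalized \<beta>" "v \<in> V2"
  shows "normalized (\<lambda>g. \<beta> g + (\<rho> g v - v))"
  using assms C.crossed_hom_add[OF _ C.inner_crossed_hom[of v]]
  by (simp add: normalized_def C1.W_add C1.W_diff C1.W_invariant)

lemma cls_twist:
  assumes "\<beta> \<in> C.CH"
  shows "C.cls (\<lambda>g. \<beta> g + (\<rho> g v - v)) = C.cls \<beta>"
  using C.cls_eq_iff[OF assms C.crossed_hom_add[OF assms C.inner_crossed_hom[of v]]] by auto

text \<open>The difference is bounded by \<open>M * 0\<close>: the gap leaves no freedom on the
  second factor.\<close>

lemma crossed_homs_eqI:
  assumes \<beta>: "\<beta> \<in> C.CH" "\<gamma> \<in> C.CH" and eq: "\<And>g. \<beta> (g, 0) = \<gamma> (g, 0)"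
  shows "\<beta> = \<gamma>"
proof
  fix g
  show "\<beta> g = \<gamma> g"
    using crossed_hom_bound[OF C.crossed_hom_diff[OF \<beta>], of 0 g] by (simp add: eq)
qed

text \<open>For normalized representatives, equal first components mean equal restrictions up to a
  twist by some \<open>v\<close> in \<open>V2\<close>. Twisting by the same \<open>v\<close> over
  the whole product makes the representatives agree on the first factor, hence everywhere.\<close>

lemma cls_R1_inj:
  assumes \<beta>: "\<beta> \<in> C.CH" "\<beta>' \<in> C.CH" and eq: "C1.cls (R1 \<beta>) = C1.cls (R1 \<beta>')"
  shows "C.cls \<beta> = C.cls \<beta>'"
proof -
  obtain \<gamma> where \<gamma>: "normalized \<gamma>" "C.cls \<gamma> = C.cls \<beta>" by (rule normalize[OF \<beta>(1)])
  obtain \<gamma>' where \<gamma>': "normalized \<gamma>'" "C.cls \<gamma>' = C.cls \<beta>'" by (rule normalize[OF \<beta>(2)])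
  note CH = normalizedD(1)[OF \<gamma>(1)] normalizedD(1)[OF \<gamma>'(1)]
  have "C1.cls (R1 \<gamma>) = C1.cls (R1 \<gamma>')"
    using eq cls_R_cong(1)[OF CH(1) \<beta>(1) \<gamma>(2)] cls_R_cong(1)[OF CH(2) \<beta>(2) \<gamma>'(2)] by simp
  then obtain v where v: "v \<in> V2" "\<And>g. R1 \<gamma>' g = R1 \<gamma> g + (\<rho> (g, 0) v - v)"
    using C1.cls_eq_iff[OF R1_crossed_hom[OF CH(1)] R1_crossed_hom[OF CH(2)]] by blast
  have "\<gamma>' = (\<lambda>g. \<gamma> g + (\<rho> g v - v))"
    using v(2) normalizedD(2)[OF \<gamma>(1)] normalizedD(2)[OF \<gamma>'(1)]
    by (intro crossed_homs_eqI CH C.crossed_hom_add C.inner_crossed_hom) auto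
  then show ?thesis using cls_twist[OF CH(1), of v] \<gamma>(2) \<gamma>'(2) by simp
qed

text \<open>Cohomology classes are bare sets of cochains, so a representative is chosen;
  \<open>cls_R_cong\<close> makes the choice irrelevant.\<close>

definition \<Phi> where
  "\<Phi> c = (let \<beta> = SOME \<beta>. \<beta> \<in> C.CH \<and> C.cls \<beta> = c in (C1.cls (R1 \<beta>), C2.cls (R2 \<beta>)))"

lemma \<Phi>_cls:
  assumes "\<beta> \<in> C.CH"
  shows "\<Phi> (C.cls \<beta>) = (C1.cls (R1 \<beta>), C2.cls (R2 \<beta>))"
proof -
  define \<gamma> where "\<gamma> = (SOME \<gamma>. \<gamma> \<in> C.CH \<and> C.cls \<gamma> = C.cls \<beta>)"
  have "\<gamma> \<in> C.CH \<and> C.cls \<gamma> = C.cls \<beta>"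
    unfolding \<gamma>_def by (rule someI[of _ \<beta>]) (use assms in simp)
  then show ?thesis using cls_R_cong[of \<gamma> \<beta>] assms by (simp add: \<Phi>_def \<gamma>_def[symmetric])
qed

lemma \<Phi>_linear: "tvs_linear C.H (tvs_sum C1.H C2.H) \<Phi>"
proof -
  have add: "R1 (\<lambda>g. \<beta> g + \<gamma> g) = (\<lambda>g. R1 \<beta> g + R1 \<gamma> g)" "R2 (\<lambda>g. \<beta> g + \<gamma> g) = (\<lambda>g. R2 \<beta> g + R2 \<gamma> g)"
    for \<beta> \<gamma>
    by (simp_all add: fun_eq_iff R1_def R2_def M1.mean_add M2.mean_add)
  have smul: "R1 (\<lambda>g. smul a (\<beta> g)) = (\<lambda>g. smul a (R1 \<beta> g))" "R2 (\<lambda>g. smul a (\<beta> g)) = (\<lambda>g. smul a (R2 \<beta> g))"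
    for a \<beta>
    by (simp_all add: fun_eq_iff R1_def R2_def M1.mean_smul M2.mean_smul)
  show ?thesis
    unfolding tvs_linear_def tvs_sum_def tvs.simps topspace_prod_topology
      C.carrier_cohomology C1.carrier_cohomology C2.carrier_cohomology
    by (auto simp: \<Phi>_cls R1_crossed_hom R2_crossed_hom C.crossed_hom_add C.crossed_hom_smul add smul
        C.add_cohomology[simplified] C1.add_cohomology[simplified] C2.add_cohomology[simplified]
        C.scale_cohomology[simplified] C1.scale_cohomology[simplified] C2.scale_cohomology[simplified])
qed

lemma continuous_map_fst_\<Phi>: "continuous_map (tvs_topology C.H) (tvs_topology C1.H) (fst \<circ> \<Phi>)"
proof (rule continuous_map_cohomology[OF C.coefficient_module_axioms C1.coefficient_module_axioms,
      where R = R1 and C = M2.bound])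
  show "continuous_on UNIV (\<lambda>g::'g1. (g, 0::'g2))" by (intro continuous_intros)
qed (simp_all add: R1_crossed_hom \<Phi>_cls M2.bound_pos R1_diff_bound)

lemma continuous_map_snd_\<Phi>: "continuous_map (tvs_topology C.H) (tvs_topology C2.H) (snd \<circ> \<Phi>)"
proof (rule continuous_map_cohomology[OF C.coefficient_module_axioms C2.coefficient_module_axioms,
      where R = R2 and C = M1.bound])
  show "continuous_on UNIV (\<lambda>g::'g2. (0::'g1, g))" by (intro continuous_intros)
qed (simp_all add: R2_crossed_hom \<Phi>_cls M1.bound_pos R2_diff_bound)

text \<open>
  An open set \<open>U\<close> is pushed forward to the classes of all \<open>\<gamma>\<close> close to the restriction of a normalized
  \<open>\<beta>\<close> with class in \<open>U\<close>, where closeness is chosen so that it forces a normalized extension of \<open>\<gamma>\<close>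
  (if there is one) to have its class in \<open>U\<close>.  The margin \<open>r < \<delta>\<close> makes the result open.
\<close>

lemma open_image_\<Phi>:
  assumes U: "openin (tvs_topology C.H) U"
  obtains S where "openin (tvs_topology C1.H) S"
    "(fst \<circ> \<Phi>) ` U = S \<inter> (fst \<circ> \<Phi>) ` tvs_carrier C.H"
proof -
  define good where "good \<beta> K \<delta> \<longleftrightarrow> normalized \<beta> \<and> compact K \<and> 0 < \<delta> \<and>
    (\<forall>\<beta>'. normalized \<beta>' \<longrightarrow> (\<forall>g\<in>K. norm (\<beta>' (g, 0) - \<beta> (g, 0)) < \<delta>) \<longrightarrow> C.cls \<beta>' \<in> U)"
    for \<beta> K \<delta>
  define near where "near \<gamma> \<longleftrightarrow> (\<exists>\<beta> K \<delta> r. good \<beta> K \<delta> \<and> r < \<delta> \<and> (\<forall>g\<in>K. norm (\<gamma> g - \<beta> (g, 0)) \<le> r))"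
    for \<gamma>
  define S where "S = C1.cls ` {\<gamma> \<in> C1.CH. near \<gamma>}"
  have U_sub: "U \<subseteq> C.cls ` C.CH" using U C.openin_cohomology by blast
  have "openin (tvs_topology C1.H) S"
    unfolding C1.openin_cohomology
  proof (intro conjI ballI impI)
    show "S \<subseteq> C1.cls ` C1.CH" by (auto simp: S_def)
    fix \<gamma> assume \<gamma>: "\<gamma> \<in> C1.CH" "C1.cls \<gamma> \<in> S"
    then obtain \<gamma>0 where \<gamma>0: "\<gamma>0 \<in> C1.CH" "near \<gamma>0" "C1.cls \<gamma> = C1.cls \<gamma>0" by (auto simp: S_def)
    obtain v where v: "v \<in> V2" "\<And>g. \<gamma>0 g = \<gamma> g + (\<rho> (g, 0) v - v)"
      using \<gamma>0(3) C1.cls_eq_iff[OF \<gamma>(1) \<gamma>0(1)] by blast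
    obtain \<beta> K \<delta> r where \<beta>: "good \<beta> K \<delta>" "r < \<delta>" "\<And>g. g \<in> K \<Longrightarrow> norm (\<gamma>0 g - \<beta> (g, 0)) \<le> r"
      using \<gamma>0(2) unfolding near_def by blast
    have "C1.cls \<gamma>' \<in> S" if \<gamma>': "\<gamma>' \<in> C1.CH" "\<forall>g\<in>K. norm (\<gamma>' g - \<gamma> g) < (\<delta> - r) / 2" for \<gamma>'
    proof -
      \<comment> \<open>The twist that leads from \<gamma> to \<open>\<gamma>0\<close> is applied to
        \<open>\<gamma>'\<close> too. It preserves differences, so the distance to \<beta> is at
        most (\<delta> - r) / 2 + r = (\<delta> + r) / 2.\<close>
      define \<gamma>1 where "\<gamma>1 = (\<lambda>g. \<gamma>' g + (\<rho> (g, 0) v - v))"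
      have \<gamma>1: "\<gamma>1 \<in> C1.CH"
        unfolding \<gamma>1_def by (intro C1.crossed_hom_add \<gamma>'(1) C1.inner_crossed_hom v(1))
      have "norm (\<gamma>1 g - \<beta> (g, 0)) \<le> (\<delta> + r) / 2" if g: "g \<in> K" for g
      proof -
        have eq: "\<gamma>1 g - \<beta> (g, 0) = (\<gamma>' g - \<gamma> g) + (\<gamma>0 g - \<beta> (g, 0))"
          by (simp add: \<gamma>1_def v(2))
        have "norm (\<gamma>' g - \<gamma> g) < (\<delta> - r) / 2" using \<gamma>'(2) g by blast
        then show ?thesis
          unfolding eq using norm_triangle_ineq[of "\<gamma>' g - \<gamma> g" "\<gamma>0 g - \<beta> (g, 0)"] \<beta>(3)[OF g] \<beta>(2)
          by (simp add: field_simps)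
      qed
      moreover have "(\<delta> + r) / 2 < \<delta>" using \<beta>(2) by simp
      ultimately have "near \<gamma>1" unfolding near_def using \<beta>(1) by blast
      moreover have "C1.cls \<gamma>' = C1.cls \<gamma>1"
        unfolding C1.cls_eq_iff[OF \<gamma>'(1) \<gamma>1] using v(1) by (auto simp: \<gamma>1_def)
      ultimately show ?thesis using \<gamma>1 by (auto simp: S_def)
    qed
    moreover have "compact K" "0 < (\<delta> - r) / 2" using \<beta>(1,2) by (auto simp: good_def)
    ultimately show "\<exists>K \<delta>. compact K \<and> 0 < \<delta> \<and>
        (\<forall>\<gamma>'\<in>C1.CH. (\<forall>g\<in>K. norm (\<gamma>' g - \<gamma> g) < \<delta>) \<longrightarrow> C1.cls \<gamma>' \<in> S)" by blast
  qed
  moreover have "(fst \<circ> \<Phi>) ` U = S \<inter> (fst \<circ> \<Phi>) ` tvs_carrier C.H"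
  proof
    show "(fst \<circ> \<Phi>) ` U \<subseteq> S \<inter> (fst \<circ> \<Phi>) ` tvs_carrier C.H"
    proof
      fix y assume "y \<in> (fst \<circ> \<Phi>) ` U"
      then obtain \<alpha> where \<alpha>: "\<alpha> \<in> C.CH" "C.cls \<alpha> \<in> U" "y = fst (\<Phi> (C.cls \<alpha>))" using U_sub by auto
      obtain \<beta> where \<beta>: "normalized \<beta>" "C.cls \<beta> = C.cls \<alpha>" by (rule normalize[OF \<alpha>(1)])
      note CH = normalizedD(1)[OF \<beta>(1)]
      have "C.cls \<beta> \<in> U" using \<alpha>(2) \<beta>(2) by simp
      then obtain K \<delta> where K: "compact K" "0 < \<delta>"
        and close: "\<forall>\<beta>'\<in>C.CH. (\<forall>g\<in>K. norm (\<beta>' g - \<beta> g) < \<delta>) \<longrightarrow> C.cls \<beta>' \<in> U"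
        using U CH unfolding C.openin_cohomology by blast
      \<comment> \<open>Smallness on the first coordinates of \<open>K\<close> and on
        \<open>K0\<close> is exactly what \<open>crossed_hom_bound\<close> needs at points of
        \<open>K\<close>; it yields \<open>M * (\<delta> / (2 * M))\<close>, half of
        \<delta>.\<close>
      have "good \<beta> (fst ` K \<union> K0) (\<delta> / (2 * M))"
        unfolding good_def
      proof (intro conjI allI impI)
        show "compact (fst ` K \<union> K0)"
          using K(1) gap1.compact_K0 by (intro compact_Un compact_continuous_image continuous_intros) auto
        show "0 < \<delta> / (2 * M)" using K(2) M_pos by simp
        fix \<beta>' assume \<beta>': "normalized \<beta>'"
          "\<forall>g\<in>fst ` K \<union> K0. norm (\<beta>' (g, 0) - \<beta> (g, 0)) < \<delta> / (2 * M)"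
        have "norm (\<beta>' g - \<beta> g) < \<delta>" if g: "g \<in> K" for g
        proof -
          have "norm (\<beta>' g - \<beta> g) \<le> M * (\<delta> / (2 * M))"
            using \<beta>'(2) g K(2) M_pos
            by (intro crossed_hom_bound[OF C.crossed_hom_diff[OF normalizedD(1)[OF \<beta>'(1)] CH]])
              (auto intro: less_imp_le)
          then show ?thesis using M_pos K(2) by simp
        qed
        then show "C.cls \<beta>' \<in> U" using close normalizedD(1)[OF \<beta>'(1)] by blast
      qed (rule \<beta>(1))
      moreover have "0 < \<delta> / (2 * M)" using K(2) M_pos by simp
      ultimately have "near (R1 \<beta>)"
        unfolding near_def normalizedD(2)[OF \<beta>(1)]
        by (intro exI[of _ \<beta>] exI[of _ "fst ` K \<union> K0"] exI[of _ "\<delta> / (2 * M)"] exI[of _ 0]) simp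
      then have "C1.cls (R1 \<beta>) \<in> S" using R1_crossed_hom[OF CH] by (auto simp: S_def)
      moreover have "y = C1.cls (R1 \<beta>)" using \<alpha>(3) \<beta>(2)[symmetric] \<Phi>_cls[OF CH] by simp
      moreover have "y \<in> (fst \<circ> \<Phi>) ` tvs_carrier C.H"
        unfolding C.carrier_cohomology using \<alpha>(1,3) by auto
      ultimately show "y \<in> S \<inter> (fst \<circ> \<Phi>) ` tvs_carrier C.H" by blast
    qed
    show "S \<inter> (fst \<circ> \<Phi>) ` tvs_carrier C.H \<subseteq> (fst \<circ> \<Phi>) ` U"
    proof
      fix y assume y: "y \<in> S \<inter> (fst \<circ> \<Phi>) ` tvs_carrier C.H"
      then obtain \<gamma> where \<gamma>: "\<gamma> \<in> C1.CH" "near \<gamma>" "y = C1.cls \<gamma>" by (auto simp: S_def)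
      obtain \<alpha> where \<alpha>: "\<alpha> \<in> C.CH" "y = fst (\<Phi> (C.cls \<alpha>))"
        using y unfolding C.carrier_cohomology by auto
      obtain \<beta> where \<beta>: "normalized \<beta>" "C.cls \<beta> = C.cls \<alpha>" by (rule normalize[OF \<alpha>(1)])
      note CH = normalizedD(1)[OF \<beta>(1)]
      have "C1.cls (R1 \<beta>) = C1.cls \<gamma>" using \<alpha>(2) \<gamma>(3) \<beta>(2)[symmetric] \<Phi>_cls[OF CH] by simp
      then obtain v where v: "v \<in> V2" "\<And>g. \<gamma> g = \<beta> (g, 0) + (\<rho> (g, 0) v - v)"
        using C1.cls_eq_iff[OF R1_crossed_hom[OF CH] \<gamma>(1)] normalizedD(2)[OF \<beta>(1)] by auto
      \<comment> \<open>Twisting over the whole product turns \<beta> into a normalized extension of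
        \<gamma> in the same class, to which the closeness of \<gamma> to \<eta> applies.\<close>
      define \<beta>' where "\<beta>' = (\<lambda>g. \<beta> g + (\<rho> g v - v))"
      have \<beta>': "normalized \<beta>'" "\<And>g. \<beta>' (g, 0) = \<gamma> g"
        unfolding \<beta>'_def using normalized_twist[OF \<beta>(1) v(1)] v(2) by auto
      obtain \<eta> K \<delta> r where \<eta>: "good \<eta> K \<delta>" "r < \<delta>" "\<And>g. g \<in> K \<Longrightarrow> norm (\<gamma> g - \<eta> (g, 0)) \<le> r"
        using \<gamma>(2) unfolding near_def by blast
      have "\<forall>g\<in>K. norm (\<beta>' (g, 0) - \<eta> (g, 0)) < \<delta>"
        unfolding \<beta>'(2) using \<eta>(2,3) by (meson order_le_less_trans)
      then have "C.cls \<beta>' \<in> U" using \<eta>(1) \<beta>'(1) unfolding good_def by blast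
      moreover have "C.cls \<beta>' = C.cls \<alpha>" unfolding \<beta>'_def using cls_twist[OF CH] \<beta>(2) by simp
      ultimately show "y \<in> (fst \<circ> \<Phi>) ` U" using \<alpha>(2) by auto
    qed
  qed
  ultimately show ?thesis by (rule that)
qed

lemma embedding_map_fst_\<Phi>: "embedding_map (tvs_topology C.H) (tvs_topology C1.H) (fst \<circ> \<Phi>)"
  unfolding embedding_map_def
proof (rule bijective_open_imp_homeomorphic_map)
  let ?S = "subtopology (tvs_topology C1.H) ((fst \<circ> \<Phi>) ` tvs_carrier C.H)"
  show "continuous_map (tvs_topology C.H) ?S (fst \<circ> \<Phi>)"
    using continuous_map_fst_\<Phi> by (simp add: continuous_map_in_subtopology)
  show "open_map (tvs_topology C.H) ?S (fst \<circ> \<Phi>)"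
    unfolding open_map_def openin_subtopology using open_image_\<Phi> by metis
  show "(fst \<circ> \<Phi>) ` tvs_carrier C.H = topspace ?S"
    using continuous_map_fst_\<Phi> by (auto simp: continuous_map_def)
  show "inj_on (fst \<circ> \<Phi>) (tvs_carrier C.H)"
    unfolding C.carrier_cohomology
  proof (rule inj_onI)
    fix c c' assume "c \<in> C.cls ` C.CH" "c' \<in> C.cls ` C.CH" and eq: "(fst \<circ> \<Phi>) c = (fst \<circ> \<Phi>) c'"
    then obtain \<beta> \<beta>' where \<beta>: "\<beta> \<in> C.CH" "\<beta>' \<in> C.CH" and c: "c = C.cls \<beta>" "c' = C.cls \<beta>'"
      by blast
    show "c = c'"
      unfolding c using eq by (intro cls_R1_inj \<beta>) (simp add: c \<Phi>_cls \<beta>)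
  qed
qed

lemma \<Phi>_embedding: "tvs_embedding C.H (tvs_sum C1.H C2.H) \<Phi>"
  unfolding tvs_embedding_def
proof
  have "continuous_map (tvs_topology C.H) (prod_topology (tvs_topology C1.H) (tvs_topology C2.H)) \<Phi>"
    using continuous_map_fst_\<Phi> continuous_map_snd_\<Phi> by (simp add: continuous_map_pairwise)
  then show "embedding_map (tvs_topology C.H) (tvs_topology (tvs_sum C1.H C2.H)) \<Phi>"
    using embedding_map_if_fst_embedding embedding_map_fst_\<Phi> by (simp add: tvs_sum_def)
qed (rule \<Phi>_linear)

text \<open>Values fixed by the second factor make \<gamma> composed with \<open>fst\<close> a
  crossed homomorphism on the product. In the second component both sides take values in the zero
  space.\<close>

lemma \<Phi>_surjective:
  assumes V1: "V1 = fixed_vectors (\<lambda>g. \<rho> (g, 0))" and V2: "V2 = fixed_vectors (\<lambda>g. \<rho> (0, g))"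
  shows "\<Phi> ` tvs_carrier C.H = tvs_carrier (tvs_sum C1.H C2.H)"
proof
  show "\<Phi> ` tvs_carrier C.H \<subseteq> tvs_carrier (tvs_sum C1.H C2.H)"
    using \<Phi>_linear by (simp add: tvs_linear_def)
  show "tvs_carrier (tvs_sum C1.H C2.H) \<subseteq> \<Phi> ` tvs_carrier C.H"
  proof
    fix y assume "y \<in> tvs_carrier (tvs_sum C1.H C2.H)"
    then obtain \<gamma> \<eta> where \<gamma>: "\<gamma> \<in> C1.CH" and \<eta>: "\<eta> \<in> C2.CH" and y: "y = (C1.cls \<gamma>, C2.cls \<eta>)"
      by (auto simp: tvs_sum_def C1.carrier_cohomology[simplified] C2.carrier_cohomology[simplified])
    define \<beta> where "\<beta> g = \<gamma> (fst g)" for g :: "'g1 \<times> 'g2"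
    have fixed: "\<rho> (0, h) (\<gamma> g) = \<gamma> g" for g h
      using crossed_homsD(2)[OF \<gamma>, of g] unfolding V2 fixed_vectors_def by blast
    have "continuous_on UNIV \<beta>"
      unfolding \<beta>_def[abs_def]
      by (intro continuous_on_compose2[OF crossed_homsD(1)[OF \<gamma>]] continuous_intros) auto
    moreover have "\<beta> (g + h) = \<beta> g + \<rho> g (\<beta> h)" for g h
      using action_split[of "fst g" "snd g"] crossed_homsD(3)[OF \<gamma>, of "fst g" "fst h"] fixed
      by (simp add: \<beta>_def)
    ultimately have \<beta>: "\<beta> \<in> C.CH" unfolding crossed_homs_def by blast
    have "R1 \<beta> = \<gamma>"
      using crossed_homsD(2)[OF \<gamma>] by (simp add: fun_eq_iff R1_def \<beta>_def M2.stationary_iff M2.mean_fixed)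
    moreover have "R2 \<beta> = \<eta>"
      using crossed_homsD(2)[OF \<eta>] crossed_homsD(2)[OF R2_crossed_hom[OF \<beta>]]
      unfolding V1 gap1.no_fixed_vectors by (simp add: fun_eq_iff)
    ultimately have "\<Phi> (C.cls \<beta>) = y" using \<Phi>_cls[OF \<beta>] y by simp
    then show "y \<in> \<Phi> ` tvs_carrier C.H" unfolding C.carrier_cohomology using \<beta> by blast
  qed
qed

text \<open>The second carrier is non-empty, so the projection of the full product is onto, and a
  surjective embedding is a homeomorphism.\<close>

lemma fst_\<Phi>_isomorphism:
  assumes V1: "V1 = fixed_vectors (\<lambda>g. \<rho> (g, 0))" and V2: "V2 = fixed_vectors (\<lambda>g. \<rho> (0, g))"
  shows "tvs_isomorphism C.H C1.H (fst \<circ> \<Phi>)"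
proof -
  have "crossed_homs V1 (\<lambda>g. \<rho> (0, g)) \<noteq> {}"
    using C2.inner_crossed_hom[OF C2.W_0] by blast
  then have "tvs_carrier C2.H \<noteq> {}" unfolding C2.carrier_cohomology by simp
  then have "(fst \<circ> \<Phi>) ` tvs_carrier C.H = tvs_carrier C1.H"
    unfolding image_comp[symmetric] \<Phi>_surjective[OF assms] by (simp add: tvs_sum_def)
  then have "homeomorphic_map (tvs_topology C.H) (tvs_topology C1.H) (fst \<circ> \<Phi>)"
    using embedding_map_fst_\<Phi> surjective_embedding_map by blast
  moreover have "tvs_linear C.H C1.H (fst \<circ> \<Phi>)"
    using \<Phi>_linear by (auto simp: tvs_linear_def tvs_sum_def image_subset_iff mem_Times_iff)
  ultimately show ?thesis by (simp add: tvs_isomorphism_def)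
qed

end

theorem theorem4p16:
  fixes smul :: "'k::{real_normed_field, euclidean_space} \<Rightarrow> 'v::banach \<Rightarrow> 'v"
    and \<rho> :: "'g1::topological_group_add \<times> 'g2::topological_group_add \<Rightarrow> 'v \<Rightarrow> 'v"
    and \<mu>1 :: "'g1 measure" and \<mu>2 :: "'g2 measure"
  defines "\<rho>1 \<equiv> \<lambda>g. \<rho> (g, 0)" and "\<rho>2 \<equiv> \<lambda>g. \<rho> (0, g)"
  defines "V1 \<equiv> stationary_vectors smul \<rho>1 \<mu>1" and "V2 \<equiv> stationary_vectors smul \<rho>2 \<mu>2"
  defines "E1 \<equiv> mean_projection smul \<rho>1 \<mu>1" and "E2 \<equiv> mean_projection smul \<rho>2 \<mu>2"
  assumes \<mu>1: "baire_probability \<mu>1" and \<mu>2: "baire_probability \<mu>2"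
    and bounded: "uniformly_bounded_module smul \<rho>"
    and continuous: "strongly_operator_continuous \<rho>"
    and stationary1: "weakly_uniquely_stationary smul \<rho>1 \<mu>1"
    and no_almost_invariant1: "\<not> almost_invariant_unit_vectors \<rho>1"
    and stationary2: "weakly_uniquely_stationary smul \<rho>2 \<mu>2"
  shows "\<exists>\<Phi>.
    (\<forall>b \<in> cocycles 1 UNIV \<rho>.
       restrict_cochain 2 E2 (\<lambda>g. (g, 0)) b \<in> cocycles 1 V2 \<rho>1 \<and>
       restrict_cochain 2 E1 (\<lambda>g. (0, g)) b \<in> cocycles 1 V1 \<rho>2 \<and>
       \<Phi> (cohomology_class 1 UNIV \<rho> b) =
         (cohomology_class 1 V2 \<rho>1 (restrict_cochain 2 E2 (\<lambda>g. (g, 0)) b),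
          cohomology_class 1 V1 \<rho>2 (restrict_cochain 2 E1 (\<lambda>g. (0, g)) b))) \<and>
    tvs_embedding (cohomology smul 1 UNIV \<rho>)
      (tvs_sum (cohomology smul 1 V2 \<rho>1) (cohomology smul 1 V1 \<rho>2)) \<Phi> \<and>
    (V1 = fixed_vectors \<rho>1 \<and> V2 = fixed_vectors \<rho>2 \<longrightarrow>
       \<Phi> ` tvs_carrier (cohomology smul 1 UNIV \<rho>) =
         tvs_carrier (tvs_sum (cohomology smul 1 V2 \<rho>1) (cohomology smul 1 V1 \<rho>2)) \<and>
       tvs_isomorphism (cohomology smul 1 UNIV \<rho>)
         (cohomology smul 1 (fixed_vectors \<rho>2) \<rho>1) (fst \<circ> \<Phi>))"
proof -
  have m1: "stationary_module smul \<rho>1 \<mu>1" and m2: "stationary_module smul \<rho>2 \<mu>2"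
    using \<mu>1 \<mu>2 stationary1 stationary2
    by (auto simp: stationary_module_def stationary_module_axioms_def bounded_module_def
        baire_probability_def weakly_uniquely_stationary_def)
  interpret m1: stationary_module smul \<rho>1 \<mu>1 by (rule m1)
  obtain K0 \<epsilon> where gap: "spectral_gap smul \<rho>1 K0 \<epsilon>"
    using m1.spectral_gap_iff no_almost_invariant1 by blast
  interpret pm: product_module smul \<rho> \<mu>1 \<mu>2 K0 \<epsilon>
    unfolding product_module_def product_module_axioms_def bounded_module_def
    using m1 m2 gap bounded continuous unfolding \<rho>1_def \<rho>2_def by blast
  show ?thesis
    unfolding V1_def V2_def E1_def E2_def \<rho>1_def \<rho>2_def
  proof (rule exI[of _ pm.\<Phi>], intro conjI ballI impI)
    fix b assume "b \<in> cocycles 1 UNIV \<rho>"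
    then obtain \<beta> where \<beta>: "\<beta> \<in> pm.C.CH" "b = cocycle_of \<beta>" unfolding pm.C.cocycles_eq by blast
    show "restrict_cochain 2 pm.M2.E (\<lambda>g. (g, 0)) b \<in> cocycles 1 pm.V2 (\<lambda>g. \<rho> (g, 0))"
      unfolding \<beta>(2) pm.restrict_cocycle_of_1
      by (intro pm.C1.cocycle_of_in_cocycles pm.R1_crossed_hom \<beta>)
    show "restrict_cochain 2 pm.M1.E (\<lambda>g. (0, g)) b \<in> cocycles 1 pm.V1 (\<lambda>g. \<rho> (0, g))"
      unfolding \<beta>(2) pm.restrict_cocycle_of_2
      by (intro pm.C2.cocycle_of_in_cocycles pm.R2_crossed_hom \<beta>)
    show "pm.\<Phi> (cohomology_class 1 UNIV \<rho> b) =
        (cohomology_class 1 pm.V2 (\<lambda>g. \<rho> (g, 0)) (restrict_cochain 2 pm.M2.E (\<lambda>g. (g, 0)) b),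
         cohomology_class 1 pm.V1 (\<lambda>g. \<rho> (0, g)) (restrict_cochain 2 pm.M1.E (\<lambda>g. (0, g)) b))"
      using pm.\<Phi>_cls[OF \<beta>(1)]
      unfolding \<beta>(2) pm.restrict_cocycle_of_1 pm.restrict_cocycle_of_2
        pm.C.cls_def pm.C1.cls_def pm.C2.cls_def .
  next
    show "tvs_embedding pm.C.H (tvs_sum pm.C1.H pm.C2.H) pm.\<Phi>"
      by (rule pm.\<Phi>_embedding)
  next
    assume *: "pm.V1 = fixed_vectors (\<lambda>g. \<rho> (g, 0)) \<and> pm.V2 = fixed_vectors (\<lambda>g. \<rho> (0, g))"
    then show "pm.\<Phi> ` tvs_carrier pm.C.H = tvs_carrier (tvs_sum pm.C1.H pm.C2.H)"
      by (intro pm.\<Phi>_surjective) auto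
    show "tvs_isomorphism pm.C.H
        (cohomology smul 1 (fixed_vectors (\<lambda>g. \<rho> (0, g))) (\<lambda>g. \<rho> (g, 0))) (fst \<circ> pm.\<Phi>)"
      using pm.fst_\<Phi>_isomorphism * by simp
  qed
qed

end
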